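(* Let $\mathcal{P}$ be a reparametrization category with cuts. If $f:D\to D'$ and $g:E\to E'$ are objectwise weak homotopy equivalences of arbitrary $\mathcal{P}$-spaces, then $$f\otimes g:D\otimes E\longrightarrow D'\otimes E'$$ is an objectwise weak homotopy equivalence.
   Context: $\mathrm{Top}$ denotes either the category of $\Delta$-generated spaces (spaces whose topology is final with respect to all continuous maps from standard topological simplices) or its full subcategory of $\Delta$-Hausdorff ones (those for which the image of every continuous map $[0,1]\to X$ is closed). In either case $\mathrm{Top}$ is complete, cocomplete and cartesian closed; products and mapping spaces are taken in $\mathrm{Top}$. A weak homotopy equivalence is a map inducing a bijection on path components and isomorphisms on all based homotopy groups in positive degrees. A reparametrization category $(\mathcal{P},\otimes)$ is a small $\mathrm{Top}$-enriched semimonoidal category (an enriched bifunctor $\otimes$, associative, with no unit required) such that: (1) the semimonoidal structure is strict (so $\otimes$ makes $\mathrm{Obj}(\mathcal{P})$ a semigroup); (2) every hom-space $\mathcal{P}(\ell,\ell')$ is contractible; (3) if $\phi:\ell\to\ell'$ and $\ell'=\ell'_1\otimes\ell'_2$, there are objects $\ell_1,\ell_2$ and maps $\phi_i:\ell_i\to\ell'_i$ with $\ell=\ell_1\otimes\ell_2$ and $\phi=\phi_1\otimes\phi_2$. A cut structure on $\mathcal{P}$ consists of: for every object $L$ a map $\delta_L:L\to L\otimes L$ (not required to be natural); for all objects $L,a,b$ continuous maps $c_1^{a,b}:\mathcal{P}(L,a\otimes b)\to\mathcal{P}(L,a)$ and $c_2^{a,b}:\mathcal{P}(L,a\otimes b)\to\mathcal{P}(L,b)$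 such that for all $\alpha:a\to a'$, $\beta:b\to b'$, $\psi:L\to a\otimes b$ one has $c_1^{a',b'}((\alpha\otimes\beta)\psi)=\alpha c_1^{a,b}(\psi)$ and $c_2^{a',b'}((\alpha\otimes\beta)\psi)=\beta c_2^{a,b}(\psi)$; and, putting $N_L^{a,b}(\psi)=(c_1^{a,b}(\psi)\otimes c_2^{a,b}(\psi))\delta_L$, continuous maps $\Theta_L^{a,b}:[0,1]\times\mathcal{P}(L,a\otimes b)\to\mathcal{P}(L,a\otimes b)$ with $\Theta_L^{a,b}(0,\psi)=\psi$, $\Theta_L^{a,b}(1,\psi)=N_L^{a,b}(\psi)$ and $\Theta_L^{a',b'}(u,(\alpha\otimes\beta)\psi)=(\alpha\otimes\beta)\Theta_L^{a,b}(u,\psi)$. A reparametrization category with cuts is a reparametrization category that admits a cut structure. A $\mathcal{P}$-space is an enriched functor $D:\mathcal{P}^{\mathrm{op}}\to\mathrm{Top}$; maps of $\mathcal{P}$-spaces are natural transformations, and a map is an objectwise weak homotopy equivalence if its evaluation at every $L\in\mathrm{Obj}(\mathcal{P})$ is a weak homotopy equivalence. The tensor product of $\mathcal{P}$-spaces is $(D\otimes E)(L)=\int^{a,b\in\mathrm{Obj}(\mathcal{P})}\mathcal{P}(L,a\otimes b)\times D(a)\times E(b)$ (enriched coend), i.e. the quotient in $\mathrm{Top}$ of $\coprod_{a,b}\mathcal{P}(L,a\otimes b)\times D(a)\times E(b)$ by the relation generated by $[(\alpha\otimes\beta)\psi,x',y']=[\psi,D(\alpha)x',E(\beta)y']$ for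 $\alpha:a\to a'$, $\beta:b\to b'$, $\psi\in\mathcal{P}(L,a\otimes b)$, $x'\in D(a')$, $y'\in E(b')$. The action is $(D\otimes E)(\theta)[\psi,x,y]=[\psi\theta,x,y]$ and $(f\otimes g)[\psi,x,y]=[\psi,f(x),g(y)]$. *)

theory Defs
  imports "HOL-Homology.Homology"
begin

section \<open>The category Top\<close>

abbreviation simplex_top :: "nat \<Rightarrow> (nat \<Rightarrow> real) topology" where
  "simplex_top n \<equiv> subtopology (powertop_real UNIV) (standard_simplex n)"

definition simplex_open :: "'a topology \<Rightarrow> 'a set \<Rightarrow> bool" where
  "simplex_open X U \<longleftrightarrow> U \<subseteq> topspace X \<and>
     (\<forall>n \<sigma>. continuous_map (simplex_top n) X \<sigma> \<longrightarrow>
        openin (simplex_top n) {t \<in> topspace (simplex_top n). \<sigma> t \<in> U})"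

definition delta_generated :: "'a topology \<Rightarrow> bool" where
  "delta_generated X \<longleftrightarrow> (\<forall>U. simplex_open X U \<longrightarrow> openin X U)"

definition delta_Hausdorff :: "'a topology \<Rightarrow> bool" where
  "delta_Hausdorff X \<longleftrightarrow> (\<forall>\<gamma>. pathin X \<gamma> \<longrightarrow> closedin X (\<gamma> ` {0..1}))"

text \<open>The two admissible meanings of Top; everything below is parametrized by this choice.\<close>

datatype top_kind = Delta_Generated | Delta_Generated_Hausdorff

fun in_Top :: "top_kind \<Rightarrow> 'a topology \<Rightarrow> bool" where
  "in_Top Delta_Generated X \<longleftrightarrow> delta_generated X"
| "in_Top Delta_Generated_Hausdorff X \<longleftrightarrow> delta_generated X \<and> delta_Hausdorff X"

text \<open>
  The coreflection of topological spaces onto \<open>\<Delta>\<close>-generated ones. Products and mapping spaces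
  in Top are the coreflections of the usual product topology and of the compact-open topology;
  both are \<open>\<Delta>\<close>-Hausdorff when they are built from \<open>\<Delta>\<close>-Hausdorff spaces, so no reflection is
  needed and the formulas serve both meanings of Top.
\<close>

definition delta_coreflection :: "'a topology \<Rightarrow> 'a topology" where
  "delta_coreflection X = topology (simplex_open X)"

lemma istopology_simplex_open: "istopology (simplex_open X)"
  unfolding istopology_def
proof (intro conjI allI impI)
  fix S T assume S: "simplex_open X S" and T: "simplex_open X T"
  have eq: "{t \<in> A. \<sigma> t \<in> S \<inter> T} = {t \<in> A. \<sigma> t \<in> S} \<inter> {t \<in> A. \<sigma> t \<in> T}"
    for A and \<sigma> :: "(nat \<Rightarrow> real) \<Rightarrow> 'a" by auto
  show "simplex_open X (S \<inter> T)"
    using S T unfolding simplex_open_def eq by (blast intro: openin_Int)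
next
  fix \<K> assume K: "\<forall>K\<in>\<K>. simplex_open X K"
  have eq: "{t \<in> A. \<sigma> t \<in> \<Union>\<K>} = (\<Union>K\<in>\<K>. {t \<in> A. \<sigma> t \<in> K})"
    for A and \<sigma> :: "(nat \<Rightarrow> real) \<Rightarrow> 'a" by auto
  show "simplex_open X (\<Union>\<K>)"
    using K unfolding simplex_open_def eq by blast
qed

lemma openin_delta_coreflection: "openin (delta_coreflection X) U \<longleftrightarrow> simplex_open X U"
  by (simp add: delta_coreflection_def istopology_simplex_open)

lemma topspace_delta_coreflection [simp]: "topspace (delta_coreflection X) = topspace X"
proof
  show "topspace (delta_coreflection X) \<subseteq> topspace X"
    using openin_topspace[of "delta_coreflection X"]
    unfolding openin_delta_coreflection simplex_open_def by blast
  have "simplex_open X (topspace X)"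
    unfolding simplex_open_def using openin_continuous_map_preimage by blast
  then show "topspace X \<subseteq> topspace (delta_coreflection X)"
    by (meson openin_delta_coreflection openin_subset)
qed

definition Top_prod :: "'a topology \<Rightarrow> 'b topology \<Rightarrow> ('a \<times> 'b) topology" where
  "Top_prod X Y = delta_coreflection (prod_topology X Y)"

definition compact_open_topology :: "'a topology \<Rightarrow> 'b topology \<Rightarrow> ('a \<Rightarrow> 'b) topology" where
  "compact_open_topology X Y =
     topology_generated_by
       {{f \<in> extensional (topspace X). continuous_map X Y f \<and> f ` K \<subseteq> U} | K U.
          compactin X K \<and> openin Y U}"

definition Top_map :: "'a topology \<Rightarrow> 'b topology \<Rightarrow> ('a \<Rightarrow> 'b) topology" where
  "Top_map X Y = delta_coreflection (compact_open_topology X Y)"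

definition quotient_space :: "'a topology \<Rightarrow> ('a \<times> 'a) set \<Rightarrow> 'a set topology" where
  "quotient_space X R =
     topology (\<lambda>U. U \<subseteq> topspace X // R \<and> openin X {x \<in> topspace X. R `` {x} \<in> U})"

lemma openin_quotient_space:
  "openin (quotient_space X R) U \<longleftrightarrow>
     U \<subseteq> topspace X // R \<and> openin X {x \<in> topspace X. R `` {x} \<in> U}"
proof -
  have "istopology (\<lambda>U. U \<subseteq> topspace X // R \<and> openin X {x \<in> topspace X. R `` {x} \<in> U})"
    unfolding istopology_def
  proof (intro conjI allI impI)
    fix S T
    assume "S \<subseteq> topspace X // R \<and> openin X {x \<in> topspace X. R `` {x} \<in> S}"
      and "T \<subseteq> topspace X // R \<and> openin X {x \<in> topspace X. R `` {x} \<in> T}"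
    moreover have "{x \<in> topspace X. R `` {x} \<in> S \<inter> T} =
        {x \<in> topspace X. R `` {x} \<in> S} \<inter> {x \<in> topspace X. R `` {x} \<in> T}" by auto
    ultimately show "S \<inter> T \<subseteq> topspace X // R"
      and "openin X {x \<in> topspace X. R `` {x} \<in> S \<inter> T}" by auto
  next
    fix \<K>
    assume K: "\<forall>K\<in>\<K>. K \<subseteq> topspace X // R \<and> openin X {x \<in> topspace X. R `` {x} \<in> K}"
    then show "\<Union>\<K> \<subseteq> topspace X // R" by blast
    have "{x \<in> topspace X. R `` {x} \<in> \<Union>\<K>} = (\<Union>K\<in>\<K>. {x \<in> topspace X. R `` {x} \<in> K})"
      by auto
    then show "openin X {x \<in> topspace X. R `` {x} \<in> \<Union>\<K>}" using K by auto
  qed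
  then show ?thesis by (simp add: quotient_space_def)
qed

text \<open>
  The quotient in Top of \<open>X\<close> by the relation generated by \<open>r\<close>: one divides by the least
  equivalence relation that contains \<open>r\<close> and whose quotient space lies in Top. Quotients of
  \<open>\<Delta>\<close>-generated spaces are \<open>\<Delta>\<close>-generated, so for \<open>Delta_Generated\<close> this is the equivalence
  relation generated by \<open>r\<close>; for \<open>Delta_Generated_Hausdorff\<close> it is the \<open>\<Delta>\<close>-Hausdorff
  reflection of that quotient, i.e. the colimit computed in the full subcategory.
\<close>

definition Top_equiv :: "top_kind \<Rightarrow> 'a topology \<Rightarrow> ('a \<times> 'a) set \<Rightarrow> ('a \<times> 'a) set" where
  "Top_equiv T X r =
     \<Inter> {R. equiv (topspace X) R \<and> r \<subseteq> R \<and> in_Top T (quotient_space X R)}"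

definition Top_quotient :: "top_kind \<Rightarrow> 'a topology \<Rightarrow> ('a \<times> 'a) set \<Rightarrow> 'a set topology" where
  "Top_quotient T X r = quotient_space X (Top_equiv T X r)"


section \<open>Weak homotopy equivalences\<close>

abbreviation cube :: "nat \<Rightarrow> (nat \<Rightarrow> real) topology" where
  "cube n \<equiv> product_topology (\<lambda>_. top_of_set {0..1}) {..<n}"

definition cube_boundary :: "nat \<Rightarrow> (nat \<Rightarrow> real) set" where
  "cube_boundary n = {t \<in> topspace (cube n). \<exists>i<n. t i = 0 \<or> t i = 1}"

abbreviation const_on_boundary :: "nat \<Rightarrow> 'a \<Rightarrow> ((nat \<Rightarrow> real) \<Rightarrow> 'a) \<Rightarrow> bool" where
  "const_on_boundary n x f \<equiv> \<forall>t \<in> cube_boundary n. f t = x"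

definition cube_concat ::
    "((nat \<Rightarrow> real) \<Rightarrow> 'a) \<Rightarrow> ((nat \<Rightarrow> real) \<Rightarrow> 'a) \<Rightarrow> (nat \<Rightarrow> real) \<Rightarrow> 'a" where
  "cube_concat f g t =
     (if t 0 \<le> 1/2 then f (t(0 := 2 * t 0)) else g (t(0 := 2 * t 0 - 1)))"

definition homotopy_class :: "nat \<Rightarrow> 'a topology \<Rightarrow> 'a \<Rightarrow> ((nat \<Rightarrow> real) \<Rightarrow> 'a) \<Rightarrow>
    ((nat \<Rightarrow> real) \<Rightarrow> 'a) set" where
  "homotopy_class n X x f = {g. homotopic_with (const_on_boundary n x) (cube n) X f g}"

text \<open>Intended for \<open>n > 0\<close> and \<open>x \<in> topspace X\<close>.\<close>

definition homotopy_group ::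
    "nat \<Rightarrow> 'a topology \<Rightarrow> 'a \<Rightarrow> ((nat \<Rightarrow> real) \<Rightarrow> 'a) set monoid" where
  "homotopy_group n X x =
     \<lparr>carrier = {homotopy_class n X x f | f.
                   continuous_map (cube n) X f \<and> const_on_boundary n x f},
      mult = (\<lambda>A B. \<Union>f\<in>A. \<Union>g\<in>B. homotopy_class n X x (cube_concat f g)),
      one = homotopy_class n X x (\<lambda>_. x)\<rparr>"

definition homotopy_group_map :: "nat \<Rightarrow> 'b topology \<Rightarrow> ('a \<Rightarrow> 'b) \<Rightarrow> 'a \<Rightarrow>
    ((nat \<Rightarrow> real) \<Rightarrow> 'a) set \<Rightarrow> ((nat \<Rightarrow> real) \<Rightarrow> 'b) set" where
  "homotopy_group_map n Y h x A = (\<Union>f\<in>A. homotopy_class n Y (h x) (h \<circ> f))"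

definition path_components_map :: "'b topology \<Rightarrow> ('a \<Rightarrow> 'b) \<Rightarrow> 'a set \<Rightarrow> 'b set" where
  "path_components_map Y h C = (\<Union>x\<in>C. path_component_of_set Y (h x))"

definition weak_homotopy_equivalence :: "'a topology \<Rightarrow> 'b topology \<Rightarrow> ('a \<Rightarrow> 'b) \<Rightarrow> bool" where
  "weak_homotopy_equivalence X Y h \<longleftrightarrow>
     continuous_map X Y h \<and>
     bij_betw (path_components_map Y h) (path_components_of X) (path_components_of Y) \<and>
     (\<forall>n>0. \<forall>x \<in> topspace X.
        homotopy_group_map n Y h x \<in> iso (homotopy_group n X x) (homotopy_group n Y (h x)))"


section \<open>Reparametrization categories with cuts\<close>

text \<open>
  \<open>Hom P a b\<close> is the space of maps \<open>a \<rightarrow> b\<close>; \<open>Comp P a b c \<psi> \<phi>\<close> is \<open>\<psi>\<phi>\<close> for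
  \<open>\<phi> : a \<rightarrow> b\<close> and \<open>\<psi> : b \<rightarrow> c\<close>; \<open>Tens_map P a a' b b' \<alpha> \<beta>\<close> is \<open>\<alpha> \<otimes> \<beta>\<close> for
  \<open>\<alpha> : a \<rightarrow> a'\<close> and \<open>\<beta> : b \<rightarrow> b'\<close>. Different hom-spaces need not be disjoint, hence the
  object arguments. Values outside of the respective carriers are irrelevant.
\<close>

record ('o, 'm) semimonoidal_cat =
  Obj :: "'o set"
  Hom :: "'o \<Rightarrow> 'o \<Rightarrow> 'm topology"
  Ident :: "'o \<Rightarrow> 'm"
  Comp :: "'o \<Rightarrow> 'o \<Rightarrow> 'o \<Rightarrow> 'm \<Rightarrow> 'm \<Rightarrow> 'm"
  Tens :: "'o \<Rightarrow> 'o \<Rightarrow> 'o"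
  Tens_map :: "'o \<Rightarrow> 'o \<Rightarrow> 'o \<Rightarrow> 'o \<Rightarrow> 'm \<Rightarrow> 'm \<Rightarrow> 'm"

abbreviation maps :: "('o, 'm) semimonoidal_cat \<Rightarrow> 'o \<Rightarrow> 'o \<Rightarrow> 'm set" where
  "maps P a b \<equiv> topspace (Hom P a b)"

definition Top_enriched_category :: "top_kind \<Rightarrow> ('o, 'm) semimonoidal_cat \<Rightarrow> bool" where
  "Top_enriched_category T P \<longleftrightarrow>
     (\<forall>a\<in>Obj P. \<forall>b\<in>Obj P. in_Top T (Hom P a b)) \<and>
     (\<forall>a\<in>Obj P. Ident P a \<in> maps P a a) \<and>
     (\<forall>a\<in>Obj P. \<forall>b\<in>Obj P. \<forall>c\<in>Obj P.
        continuous_map (Top_prod (Hom P b c) (Hom P a b)) (Hom P a c)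
          (\<lambda>(\<psi>, \<phi>). Comp P a b c \<psi> \<phi>)) \<and>
     (\<forall>a\<in>Obj P. \<forall>b\<in>Obj P. \<forall>\<phi>\<in>maps P a b.
        Comp P a a b \<phi> (Ident P a) = \<phi> \<and> Comp P a b b (Ident P b) \<phi> = \<phi>) \<and>
     (\<forall>a\<in>Obj P. \<forall>b\<in>Obj P. \<forall>c\<in>Obj P. \<forall>d\<in>Obj P.
        \<forall>\<phi>\<in>maps P a b. \<forall>\<psi>\<in>maps P b c. \<forall>\<omega>\<in>maps P c d.
          Comp P a c d \<omega> (Comp P a b c \<psi> \<phi>) = Comp P a b d (Comp P b c d \<omega> \<psi>) \<phi>)"

definition enriched_bifunctor_Tens :: "('o, 'm) semimonoidal_cat \<Rightarrow> bool" where
  "enriched_bifunctor_Tens P \<longleftrightarrow>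
     (\<forall>a\<in>Obj P. \<forall>b\<in>Obj P. Tens P a b \<in> Obj P) \<and>
     (\<forall>a\<in>Obj P. \<forall>a'\<in>Obj P. \<forall>b\<in>Obj P. \<forall>b'\<in>Obj P.
        continuous_map (Top_prod (Hom P a a') (Hom P b b')) (Hom P (Tens P a b) (Tens P a' b'))
          (\<lambda>(\<alpha>, \<beta>). Tens_map P a a' b b' \<alpha> \<beta>)) \<and>
     (\<forall>a\<in>Obj P. \<forall>b\<in>Obj P.
        Tens_map P a a b b (Ident P a) (Ident P b) = Ident P (Tens P a b)) \<and>
     (\<forall>a\<in>Obj P. \<forall>a'\<in>Obj P. \<forall>a''\<in>Obj P. \<forall>b\<in>Obj P. \<forall>b'\<in>Obj P. \<forall>b''\<in>Obj P.
        \<forall>\<alpha>\<in>maps P a a'. \<forall>\<alpha>'\<in>maps P a' a''. \<forall>\<beta>\<in>maps P b b'. \<forall>\<beta>'\<in>maps P b' b''.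
          Tens_map P a a'' b b'' (Comp P a a' a'' \<alpha>' \<alpha>) (Comp P b b' b'' \<beta>' \<beta>) =
          Comp P (Tens P a b) (Tens P a' b') (Tens P a'' b'')
            (Tens_map P a' a'' b' b'' \<alpha>' \<beta>') (Tens_map P a a' b b' \<alpha> \<beta>))"

definition strictly_associative_Tens :: "('o, 'm) semimonoidal_cat \<Rightarrow> bool" where
  "strictly_associative_Tens P \<longleftrightarrow>
     (\<forall>a\<in>Obj P. \<forall>b\<in>Obj P. \<forall>c\<in>Obj P. Tens P (Tens P a b) c = Tens P a (Tens P b c)) \<and>
     (\<forall>a\<in>Obj P. \<forall>a'\<in>Obj P. \<forall>b\<in>Obj P. \<forall>b'\<in>Obj P. \<forall>c\<in>Obj P. \<forall>c'\<in>Obj P.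
        \<forall>\<alpha>\<in>maps P a a'. \<forall>\<beta>\<in>maps P b b'. \<forall>\<gamma>\<in>maps P c c'.
          Tens_map P (Tens P a b) (Tens P a' b') c c' (Tens_map P a a' b b' \<alpha> \<beta>) \<gamma> =
          Tens_map P a a' (Tens P b c) (Tens P b' c') \<alpha> (Tens_map P b b' c c' \<beta> \<gamma>))"

text \<open>\<^const>\<open>contractible_space\<close> admits the empty space, which has to be excluded separately.\<close>

definition reparametrization_category :: "top_kind \<Rightarrow> ('o, 'm) semimonoidal_cat \<Rightarrow> bool" where
  "reparametrization_category T P \<longleftrightarrow>
     Top_enriched_category T P \<and> enriched_bifunctor_Tens P \<and> strictly_associative_Tens P \<and>
     (\<forall>a\<in>Obj P. \<forall>b\<in>Obj P. maps P a b \<noteq> {} \<and> contractible_space (Hom P a b)) \<and>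
     (\<forall>l\<in>Obj P. \<forall>l'\<^sub>1\<in>Obj P. \<forall>l'\<^sub>2\<in>Obj P. \<forall>\<phi>\<in>maps P l (Tens P l'\<^sub>1 l'\<^sub>2).
        \<exists>l\<^sub>1\<in>Obj P. \<exists>l\<^sub>2\<in>Obj P. \<exists>\<phi>\<^sub>1\<in>maps P l\<^sub>1 l'\<^sub>1. \<exists>\<phi>\<^sub>2\<in>maps P l\<^sub>2 l'\<^sub>2.
          l = Tens P l\<^sub>1 l\<^sub>2 \<and> \<phi> = Tens_map P l\<^sub>1 l'\<^sub>1 l\<^sub>2 l'\<^sub>2 \<phi>\<^sub>1 \<phi>\<^sub>2)"

text \<open>\<open>act_left P L a a' b b' \<alpha> \<beta> \<psi>\<close> is \<open>(\<alpha> \<otimes> \<beta>)\<psi>\<close> for \<open>\<psi> : L \<rightarrow> a \<otimes> b\<close>.\<close>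

abbreviation act_left :: "('o, 'm) semimonoidal_cat \<Rightarrow> 'o \<Rightarrow> 'o \<Rightarrow> 'o \<Rightarrow> 'o \<Rightarrow> 'o \<Rightarrow>
    'm \<Rightarrow> 'm \<Rightarrow> 'm \<Rightarrow> 'm" where
  "act_left P L a a' b b' \<alpha> \<beta> \<psi> \<equiv>
     Comp P L (Tens P a b) (Tens P a' b') (Tens_map P a a' b b' \<alpha> \<beta>) \<psi>"

definition cut_structure :: "('o, 'm) semimonoidal_cat \<Rightarrow> ('o \<Rightarrow> 'm) \<Rightarrow>
    ('o \<Rightarrow> 'o \<Rightarrow> 'o \<Rightarrow> 'm \<Rightarrow> 'm) \<Rightarrow> ('o \<Rightarrow> 'o \<Rightarrow> 'o \<Rightarrow> 'm \<Rightarrow> 'm) \<Rightarrow>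
    ('o \<Rightarrow> 'o \<Rightarrow> 'o \<Rightarrow> real \<Rightarrow> 'm \<Rightarrow> 'm) \<Rightarrow> bool" where
  "cut_structure P \<delta> c\<^sub>1 c\<^sub>2 \<Theta> \<longleftrightarrow>
     (\<forall>L\<in>Obj P. \<delta> L \<in> maps P L (Tens P L L)) \<and>
     (\<forall>L\<in>Obj P. \<forall>a\<in>Obj P. \<forall>b\<in>Obj P.
        continuous_map (Hom P L (Tens P a b)) (Hom P L a) (c\<^sub>1 L a b) \<and>
        continuous_map (Hom P L (Tens P a b)) (Hom P L b) (c\<^sub>2 L a b) \<and>
        continuous_map (Top_prod (top_of_set {0..1}) (Hom P L (Tens P a b)))
          (Hom P L (Tens P a b)) (\<lambda>(u, \<psi>). \<Theta> L a b u \<psi>)) \<and>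
     (\<forall>L\<in>Obj P. \<forall>a\<in>Obj P. \<forall>b\<in>Obj P. \<forall>\<psi>\<in>maps P L (Tens P a b).
        \<Theta> L a b 0 \<psi> = \<psi> \<and>
        \<Theta> L a b 1 \<psi> = act_left P L L a L b (c\<^sub>1 L a b \<psi>) (c\<^sub>2 L a b \<psi>) (\<delta> L)) \<and>
     (\<forall>L\<in>Obj P. \<forall>a\<in>Obj P. \<forall>a'\<in>Obj P. \<forall>b\<in>Obj P. \<forall>b'\<in>Obj P.
        \<forall>\<alpha>\<in>maps P a a'. \<forall>\<beta>\<in>maps P b b'. \<forall>\<psi>\<in>maps P L (Tens P a b).
          c\<^sub>1 L a' b' (act_left P L a a' b b' \<alpha> \<beta> \<psi>) = Comp P L a a' \<alpha> (c\<^sub>1 L a b \<psi>) \<and>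
          c\<^sub>2 L a' b' (act_left P L a a' b b' \<alpha> \<beta> \<psi>) = Comp P L b b' \<beta> (c\<^sub>2 L a b \<psi>) \<and>
          (\<forall>u\<in>{0..1}. \<Theta> L a' b' u (act_left P L a a' b b' \<alpha> \<beta> \<psi>) =
                        act_left P L a a' b b' \<alpha> \<beta> (\<Theta> L a b u \<psi>)))"

definition reparametrization_category_with_cuts ::
    "top_kind \<Rightarrow> ('o, 'm) semimonoidal_cat \<Rightarrow> bool" where
  "reparametrization_category_with_cuts T P \<longleftrightarrow>
     reparametrization_category T P \<and> (\<exists>\<delta> c\<^sub>1 c\<^sub>2 \<Theta>. cut_structure P \<delta> c\<^sub>1 c\<^sub>2 \<Theta>)"


section \<open>\<open>\<P>\<close>-spaces and their tensor product\<close>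

text \<open>For \<open>\<theta> : a \<rightarrow> b\<close>, \<open>Act D a b \<theta>\<close> is the map \<open>D(\<theta>) : D(b) \<rightarrow> D(a)\<close>.\<close>

record ('o, 'm, 'd) P_space =
  Space :: "'o \<Rightarrow> 'd topology"
  Act :: "'o \<Rightarrow> 'o \<Rightarrow> 'm \<Rightarrow> 'd \<Rightarrow> 'd"

abbreviation points :: "('o, 'm, 'd) P_space \<Rightarrow> 'o \<Rightarrow> 'd set" where
  "points D L \<equiv> topspace (Space D L)"

definition is_P_space :: "top_kind \<Rightarrow> ('o, 'm) semimonoidal_cat \<Rightarrow> ('o, 'm, 'd) P_space \<Rightarrow> bool" where
  "is_P_space T P D \<longleftrightarrow>
     (\<forall>a\<in>Obj P. in_Top T (Space D a)) \<and>
     (\<forall>a\<in>Obj P. \<forall>b\<in>Obj P.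
        continuous_map (Hom P a b) (Top_map (Space D b) (Space D a))
          (\<lambda>\<theta>. restrict (Act D a b \<theta>) (points D b))) \<and>
     (\<forall>a\<in>Obj P. \<forall>x\<in>points D a. Act D a a (Ident P a) x = x) \<and>
     (\<forall>a\<in>Obj P. \<forall>b\<in>Obj P. \<forall>c\<in>Obj P. \<forall>\<phi>\<in>maps P a b. \<forall>\<psi>\<in>maps P b c. \<forall>x\<in>points D c.
        Act D a c (Comp P a b c \<psi> \<phi>) x = Act D a b \<phi> (Act D b c \<psi> x))"

definition P_space_map :: "top_kind \<Rightarrow> ('o, 'm) semimonoidal_cat \<Rightarrow>
    ('o, 'm, 'd) P_space \<Rightarrow> ('o, 'm, 'e) P_space \<Rightarrow> ('o \<Rightarrow> 'd \<Rightarrow> 'e) \<Rightarrow> bool" where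
  "P_space_map T P D E f \<longleftrightarrow>
     is_P_space T P D \<and> is_P_space T P E \<and>
     (\<forall>a\<in>Obj P. continuous_map (Space D a) (Space E a) (f a)) \<and>
     (\<forall>a\<in>Obj P. \<forall>b\<in>Obj P. \<forall>\<theta>\<in>maps P a b. \<forall>x\<in>points D b.
        f a (Act D a b \<theta> x) = Act E a b \<theta> (f b x))"

definition objectwise_weak_homotopy_equivalence :: "top_kind \<Rightarrow> ('o, 'm) semimonoidal_cat \<Rightarrow>
    ('o, 'm, 'd) P_space \<Rightarrow> ('o, 'm, 'e) P_space \<Rightarrow> ('o \<Rightarrow> 'd \<Rightarrow> 'e) \<Rightarrow> bool" where
  "objectwise_weak_homotopy_equivalence T P D E f \<longleftrightarrow>
     P_space_map T P D E f \<and>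
     (\<forall>L\<in>Obj P. weak_homotopy_equivalence (Space D L) (Space E L) (f L))"

text \<open>
  A point of the coproduct is \<open>((a, b), \<psi>, x, y)\<close> with \<open>\<psi> : L \<rightarrow> a \<otimes> b\<close>, \<open>x \<in> D(a)\<close>,
  \<open>y \<in> E(b)\<close>; a point of the tensor product is an equivalence class of those.
\<close>

type_synonym ('o, 'm, 'd, 'e) tensor_rep = "('o \<times> 'o) \<times> 'm \<times> 'd \<times> 'e"

definition tensor_coproduct :: "('o, 'm) semimonoidal_cat \<Rightarrow>
    ('o, 'm, 'd) P_space \<Rightarrow> ('o, 'm, 'e) P_space \<Rightarrow> 'o \<Rightarrow> ('o, 'm, 'd, 'e) tensor_rep topology" where
  "tensor_coproduct P D E L =
     sum_topology (\<lambda>(a, b). Top_prod (Hom P L (Tens P a b)) (Top_prod (Space D a) (Space E b)))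
       (Obj P \<times> Obj P)"

definition tensor_relation :: "('o, 'm) semimonoidal_cat \<Rightarrow>
    ('o, 'm, 'd) P_space \<Rightarrow> ('o, 'm, 'e) P_space \<Rightarrow> 'o \<Rightarrow>
    (('o, 'm, 'd, 'e) tensor_rep \<times> ('o, 'm, 'd, 'e) tensor_rep) set" where
  "tensor_relation P D E L =
     {(((a', b'), act_left P L a a' b b' \<alpha> \<beta> \<psi>, x', y'),
       ((a, b), \<psi>, Act D a a' \<alpha> x', Act E b b' \<beta> y')) | a a' b b' \<alpha> \<beta> \<psi> x' y'.
        a \<in> Obj P \<and> a' \<in> Obj P \<and> b \<in> Obj P \<and> b' \<in> Obj P \<and>
        \<alpha> \<in> maps P a a' \<and> \<beta> \<in> maps P b b' \<and> \<psi> \<in> maps P L (Tens P a b) \<and>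
        x' \<in> points D a' \<and> y' \<in> points E b'}"

definition tensor_equiv :: "top_kind \<Rightarrow> ('o, 'm) semimonoidal_cat \<Rightarrow>
    ('o, 'm, 'd) P_space \<Rightarrow> ('o, 'm, 'e) P_space \<Rightarrow> 'o \<Rightarrow>
    (('o, 'm, 'd, 'e) tensor_rep \<times> ('o, 'm, 'd, 'e) tensor_rep) set" where
  "tensor_equiv T P D E L = Top_equiv T (tensor_coproduct P D E L) (tensor_relation P D E L)"

text \<open>
  A map given on representatives by \<open>h\<close> sends a class \<open>C\<close> to \<open>R `` (h ` C)\<close>, the union of
  the classes of \<open>h z\<close> for \<open>z \<in> C\<close>; this is a single class as \<open>h\<close> respects the relations.
\<close>

definition tensor :: "top_kind \<Rightarrow> ('o, 'm) semimonoidal_cat \<Rightarrow>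
    ('o, 'm, 'd) P_space \<Rightarrow> ('o, 'm, 'e) P_space \<Rightarrow>
    ('o, 'm, ('o, 'm, 'd, 'e) tensor_rep set) P_space" where
  "tensor T P D E =
     \<lparr>Space = (\<lambda>L. Top_quotient T (tensor_coproduct P D E L) (tensor_relation P D E L)),
      Act = (\<lambda>K L \<theta> C. tensor_equiv T P D E K ``
               ((\<lambda>((a, b), \<psi>, x, y). ((a, b), Comp P K L (Tens P a b) \<psi> \<theta>, x, y)) ` C))\<rparr>"

definition tensor_map :: "top_kind \<Rightarrow> ('o, 'm) semimonoidal_cat \<Rightarrow>
    ('o, 'm, 'd') P_space \<Rightarrow> ('o, 'm, 'e') P_space \<Rightarrow>
    ('o \<Rightarrow> 'd \<Rightarrow> 'd') \<Rightarrow> ('o \<Rightarrow> 'e \<Rightarrow> 'e') \<Rightarrow> 'o \<Rightarrow>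
    ('o, 'm, 'd, 'e) tensor_rep set \<Rightarrow> ('o, 'm, 'd', 'e') tensor_rep set" where
  "tensor_map T P D' E' f g L C =
     tensor_equiv T P D' E' L `` ((\<lambda>((a, b), \<psi>, x, y). ((a, b), \<psi>, f a x, g b y)) ` C)"

end

theory Submission
  imports Defs "HOL-Analysis.Abstract_Topological_Spaces"
begin

text \<open>
  A cut structure makes \<open>(D \<otimes> E)(L)\<close> homotopy equivalent to \<open>D(L) \<times> E(L)\<close>, naturally in
  \<open>D\<close> and \<open>E\<close>. In one direction, \<open>[\<psi>, x, y] \<mapsto> (D(c\<^sub>1 \<psi>) x, E(c\<^sub>2 \<psi>) y)\<close> (\<open>cut_map\<close>) respects the
  coend relation because the \<open>c\<^sub>i\<close> commute with \<open>\<alpha> \<otimes> \<beta>\<close>; in the other, \<open>(x, y) \<mapsto> [\<delta>\<^sub>L, x, y]\<close>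
  (\<open>glue_map\<close>). Cutting and then gluing sends \<open>[\<psi>, x, y]\<close> to
  \<open>[\<delta>\<^sub>L, D(c\<^sub>1 \<psi>) x, E(c\<^sub>2 \<psi>) y] = [(c\<^sub>1 \<psi> \<otimes> c\<^sub>2 \<psi>)\<delta>\<^sub>L, x, y]\<close>, so \<open>[\<Theta>(u, \<psi>), x, y]\<close> is a homotopy
  from the identity to this composite. Gluing and then cutting is the action of the two maps
  \<open>c\<^sub>i \<delta>\<^sub>L : L \<rightarrow> L\<close>, which are joined to the identity of \<open>L\<close> by paths in the contractible space
  \<open>P(L, L)\<close>. Under these equivalences \<open>f \<otimes> g\<close> becomes \<open>f\<^sub>L \<times> g\<^sub>L\<close>, which is a weak homotopy
  equivalence since maps from cubes to a product, and homotopies of such maps, are pairs of the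
  same; now weak homotopy equivalences cancel in the naturality square.

  Three bodies of theory carry this.

  Topology: products, mapping spaces and quotients in Top differ from the usual ones. A product
  \<open>K \<times> Y\<close> with \<open>Y\<close> in Top is already \<open>\<Delta>\<close>-generated when \<open>K\<close> is a Hausdorff image of a simplex
  (\<open>delta_generated_prod\<close>), so that homotopies and families over a simplex live on ordinary
  products, and these can be descended to quotients since \<open>K\<close> is locally compact
  (\<open>continuous_map_from_prod_Top_quotient\<close>). Testing on simplices also gives the exponential law
  that turns enriched actions into jointly continuous ones and back (\<open>continuous_map_curry\<close>,
  \<open>continuous_map_uncurry\<close>). The \<open>\<Delta>\<close>-Hausdorff condition is rephrased as closedness of coincidence
  sets (\<open>in_Top_iff\<close>), a form that visibly survives arbitrary intersections of equivalence
  relations; hence the quotient in Top exists and has its universal property.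

  Homotopy: a homotopy equivalence is a weak homotopy equivalence
  (\<open>homotopy_equivalence_imp_weak_homotopy_equivalence\<close>). As the homotopies involved move base
  points, this rests on transport of cube maps along a path, obtained from an explicit map of
  \<open>I \<times> I\<^sup>n\<close> to \<open>0 \<times> I\<^sup>n \<union> I \<times> \<partial>I\<^sup>n\<close> (\<open>stretch\<close>, \<open>overshoot\<close>).

  Tensor products: all continuous maps between tensor products that occur, namely the action,
  \<open>f \<otimes> g\<close> and the homotopy given by \<open>\<Theta>\<close>, are instances of one construction,
  \<open>tensor_induced_map\<close>.
\<close>

section \<open>\<open>\<Delta>\<close>-generated spaces\<close>

abbreviation unit_interval :: "real topology" where
  "unit_interval \<equiv> top_of_set {0..1}"

lemma openin_simplex_open: "openin X U \<Longrightarrow> simplex_open X U"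
  unfolding simplex_open_def
  by (intro conjI allI impI openin_subset openin_continuous_map_preimage)

lemma openin_delta_generated: "delta_generated X \<Longrightarrow> openin X U \<longleftrightarrow> simplex_open X U"
  using delta_generated_def openin_simplex_open by metis

text \<open>
  The universal property of \<open>\<Delta>\<close>-generated spaces. Constant simplices take care of the values of
  \<open>F\<close> lying in \<open>Y\<close>.
\<close>

lemma continuous_map_delta_generated:
  assumes "delta_generated X"
    and F: "\<And>n \<sigma>. continuous_map (simplex_top n) X \<sigma> \<Longrightarrow> continuous_map (simplex_top n) Y (F \<circ> \<sigma>)"
  shows "continuous_map X Y F"
  unfolding continuous_map_def
proof (intro conjI allI impI)
  show "F \<in> topspace X \<rightarrow> topspace Y"
  proof
    fix x assume "x \<in> topspace X"
    then have "continuous_map (simplex_top 0) Y (F \<circ> (\<lambda>_. x))"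
      by (intro F) simp
    then have "(F \<circ> (\<lambda>_. x)) t \<in> topspace Y" if "t \<in> topspace (simplex_top 0)" for t
      using that by (rule continuous_map_funspace[THEN funcset_mem])
    moreover have "(\<lambda>j. if j = 0 then 1 else 0) \<in> topspace (simplex_top 0)" by simp
    ultimately show "F x \<in> topspace Y" unfolding o_def by blast
  qed
next
  fix U assume U: "openin Y U"
  have "simplex_open X {x \<in> topspace X. F x \<in> U}"
    unfolding simplex_open_def
  proof (intro conjI allI impI)
    fix n and \<sigma> :: "(nat \<Rightarrow> real) \<Rightarrow> 'a" assume s: "continuous_map (simplex_top n) X \<sigma>"
    have "{t \<in> topspace (simplex_top n). \<sigma> t \<in> {x \<in> topspace X. F x \<in> U}} =
      {t \<in> topspace (simplex_top n). (F \<circ> \<sigma>) t \<in> U}"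
      using s by (auto simp: continuous_map_def)
    then show "openin (simplex_top n) {t \<in> topspace (simplex_top n). \<sigma> t \<in> {x \<in> topspace X. F x \<in> U}}"
      using openin_continuous_map_preimage[OF F[OF s] U] by simp
  qed auto
  then show "openin X {x \<in> topspace X. F x \<in> U}"
    using assms(1) delta_generated_def by blast
qed

lemma continuous_map_simplex_coreflection:
  "continuous_map (simplex_top n) (delta_coreflection X) \<sigma> \<longleftrightarrow> continuous_map (simplex_top n) X \<sigma>"
proof
  assume "continuous_map (simplex_top n) (delta_coreflection X) \<sigma>"
  then show "continuous_map (simplex_top n) X \<sigma>"
    unfolding continuous_map_def by (auto simp: openin_delta_coreflection openin_simplex_open)
next
  assume "continuous_map (simplex_top n) X \<sigma>"
  then show "continuous_map (simplex_top n) (delta_coreflection X) \<sigma>"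
    unfolding continuous_map_def openin_delta_coreflection simplex_open_def
    by (auto simp: continuous_map_def)
qed

lemma delta_generated_coreflection: "delta_generated (delta_coreflection X)"
  unfolding delta_generated_def openin_delta_coreflection
  by (simp add: simplex_open_def continuous_map_simplex_coreflection)

text \<open>
  Hence continuity into a product or mapping space of Top may be checked for the classical
  topology, as long as the source is \<open>\<Delta>\<close>-generated.
\<close>

lemma continuous_map_into_coreflection:
  assumes "delta_generated X"
  shows "continuous_map X (delta_coreflection Y) F \<longleftrightarrow> continuous_map X Y F"
proof
  assume "continuous_map X (delta_coreflection Y) F"
  then show "continuous_map X Y F"
    unfolding continuous_map_def by (auto simp: openin_delta_coreflection openin_simplex_open)
next
  assume "continuous_map X Y F"
  then have "continuous_map (simplex_top n) Y (F \<circ> \<sigma>)"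
    if "continuous_map (simplex_top n) X \<sigma>" for n \<sigma>
    using continuous_map_compose[OF that] by blast
  then show "continuous_map X (delta_coreflection Y) F"
    by (intro continuous_map_delta_generated[OF assms, where Y = "delta_coreflection Y"])
       (simp add: continuous_map_simplex_coreflection)
qed

lemma delta_generated_simplex: "delta_generated (simplex_top n)"
  unfolding delta_generated_def
proof (intro allI impI)
  fix U assume "simplex_open (simplex_top n) U"
  then have "U \<subseteq> topspace (simplex_top n)"
    and "openin (simplex_top n) {t \<in> topspace (simplex_top n). id t \<in> U}"
    unfolding simplex_open_def using continuous_map_id by blast+
  moreover from this have "{t \<in> topspace (simplex_top n). id t \<in> U} = U" by auto
  ultimately show "openin (simplex_top n) U" by simp
qed

lemma delta_generated_quotient_map:
  assumes q: "quotient_map X Y q" and X: "delta_generated X"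
  shows "delta_generated Y"
  unfolding delta_generated_def
proof (intro allI impI)
  fix U assume U: "simplex_open Y U"
  have "simplex_open X {x \<in> topspace X. q x \<in> U}"
    unfolding simplex_open_def
  proof (intro conjI allI impI)
    fix n and \<sigma> :: "(nat \<Rightarrow> real) \<Rightarrow> 'a" assume s: "continuous_map (simplex_top n) X \<sigma>"
    have "continuous_map (simplex_top n) Y (q \<circ> \<sigma>)"
      using continuous_map_compose[OF s quotient_imp_continuous_map[OF q]] .
    then have "openin (simplex_top n) {t \<in> topspace (simplex_top n). (q \<circ> \<sigma>) t \<in> U}"
      using U unfolding simplex_open_def by blast
    moreover have "{t \<in> topspace (simplex_top n). \<sigma> t \<in> {x \<in> topspace X. q x \<in> U}} =
      {t \<in> topspace (simplex_top n). (q \<circ> \<sigma>) t \<in> U}"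
      using s by (auto simp: continuous_map_def)
    ultimately show "openin (simplex_top n) {t \<in> topspace (simplex_top n). \<sigma> t \<in> {x \<in> topspace X. q x \<in> U}}"
      by simp
  qed auto
  then have "openin X {x \<in> topspace X. q x \<in> U}" using X delta_generated_def by blast
  then show "openin Y U" using q U unfolding quotient_map_def simplex_open_def by auto
qed

lemma delta_generated_sum:
  assumes "\<And>i. i \<in> I \<Longrightarrow> delta_generated (X i)"
  shows "delta_generated (sum_topology X I)"
  unfolding delta_generated_def
proof (intro allI impI)
  fix U assume U: "simplex_open (sum_topology X I) U"
  have "simplex_open (X i) {x. (i, x) \<in> U}" if "i \<in> I" for i
    unfolding simplex_open_def
  proof (intro conjI allI impI)
    show "{x. (i, x) \<in> U} \<subseteq> topspace (X i)" using U unfolding simplex_open_def by auto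
    fix n and \<sigma> :: "(nat \<Rightarrow> real) \<Rightarrow> 'b" assume s: "continuous_map (simplex_top n) (X i) \<sigma>"
    then have "continuous_map (simplex_top n) (sum_topology X I) ((\<lambda>x. (i, x)) \<circ> \<sigma>)"
      using continuous_map_component_injection[OF that] continuous_map_compose by blast
    then have "openin (simplex_top n) {t \<in> topspace (simplex_top n). ((\<lambda>x. (i, x)) \<circ> \<sigma>) t \<in> U}"
      using U unfolding simplex_open_def by blast
    then show "openin (simplex_top n) {t \<in> topspace (simplex_top n). \<sigma> t \<in> {x. (i, x) \<in> U}}"
      by simp
  qed
  then show "openin (sum_topology X I) U"
    using U assms unfolding openin_sum_topology by (auto simp: openin_delta_generated simplex_open_def)
qed

text \<open>
  Products distribute over topological sums, for every \<open>K\<close>: the summands are open.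
\<close>

lemma openin_prod_sum:
  assumes W: "W \<subseteq> topspace (prod_topology K (sum_topology X I))"
    and o: "\<And>i. i \<in> I \<Longrightarrow> openin (prod_topology K (X i)) {(k, x). (k, (i, x)) \<in> W}"
  shows "openin (prod_topology K (sum_topology X I)) W"
  unfolding openin_prod_topology_alt
proof (intro allI impI)
  fix k z assume kz: "(k, z) \<in> W"
  obtain i x where z: "z = (i, x)" by fastforce
  have i: "i \<in> I" using W kz z by auto
  have "(k, x) \<in> {(k, x). (k, (i, x)) \<in> W}" using kz z by simp
  then obtain U V where UV: "openin K U" "openin (X i) V" "k \<in> U" "x \<in> V"
      "U \<times> V \<subseteq> {(k, x). (k, (i, x)) \<in> W}"
    using o[OF i] unfolding openin_prod_topology_alt by meson
  have "openin (sum_topology X I) ((\<lambda>x. (i, x)) ` V)"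
    using open_map_component_injection[OF i, of X] UV(2) unfolding open_map_def by blast
  moreover have "U \<times> (\<lambda>x. (i, x)) ` V \<subseteq> W" using UV(5) by auto
  ultimately show "\<exists>U V. openin K U \<and> openin (sum_topology X I) V \<and> k \<in> U \<and> z \<in> V \<and> U \<times> V \<subseteq> W"
    using UV(1,3,4) z by blast
qed

lemma continuous_map_from_prod_sum:
  assumes F: "\<And>i. i \<in> I \<Longrightarrow> continuous_map (prod_topology K (X i)) Z (\<lambda>(k, x). F (k, (i, x)))"
  shows "continuous_map (prod_topology K (sum_topology X I)) Z F"
  unfolding continuous_map_def
proof (intro conjI allI impI)
  show "F \<in> topspace (prod_topology K (sum_topology X I)) \<rightarrow> topspace Z"
    using continuous_map_funspace[OF F] by (fastforce simp: Pi_iff)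
  fix U assume U: "openin Z U"
  let ?W = "{p \<in> topspace (prod_topology K (sum_topology X I)). F p \<in> U}"
  show "openin (prod_topology K (sum_topology X I)) ?W"
  proof (rule openin_prod_sum)
    fix i assume i: "i \<in> I"
    have "{(k, x). (k, (i, x)) \<in> ?W} = {p \<in> topspace (prod_topology K (X i)). (\<lambda>(k, x). F (k, (i, x))) p \<in> U}"
      using i by auto
    then show "openin (prod_topology K (X i)) {(k, x). (k, (i, x)) \<in> ?W}"
      using openin_continuous_map_preimage[OF F[OF i] U] by simp
  qed auto
qed

lemma quotient_map_compact_Hausdorff:
  assumes "compact_space X" "Hausdorff_space Y" "continuous_map X Y f" "f ` topspace X = topspace Y"
  shows "quotient_map X Y f"
  using assms(3) continuous_imp_closed_map_gen[OF assms(1) Hausdorff_imp_kc_space[OF assms(2)] assms(3)]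
    assms(4) by (rule continuous_closed_imp_quotient_map)

lemma compact_space_simplex: "compact_space (simplex_top n)"
  by (simp add: compact_space_subtopology compactin_standard_simplex)

lemma Hausdorff_space_simplex: "Hausdorff_space (simplex_top n)"
  by (simp add: Hausdorff_space_subtopology Hausdorff_space_product_topology)

lemma continuous_map_simplex_coordinate: "continuous_map (simplex_top n) euclideanreal (\<lambda>t. t i)"
  by (intro continuous_map_from_subtopology continuous_map_product_projection) simp

section \<open>Products with images of simplices\<close>

text \<open>
  A retraction of the orthant of \<open>\<real>\<^sup>k\<close> onto the solid simplex \<open>v\<^sub>0 + \<dots> + v\<^sub>k\<^sub>-\<^sub>1 \<le> 1\<close>, written in
  barycentric coordinates: a vector whose sum exceeds 1 is scaled down, and coordinate \<open>k\<close> is what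
  is missing to 1. Unlike division by the sum it is continuous at the origin.
\<close>

definition cone_point :: "nat \<Rightarrow> (nat \<Rightarrow> real) \<Rightarrow> nat \<Rightarrow> real" where
  "cone_point k v i = (if i < k then v i / max 1 (\<Sum>j<k. v j)
     else if i = k then 1 - (\<Sum>j<k. v j) / max 1 (\<Sum>j<k. v j) else 0)"

lemma cone_point_in_simplex:
  assumes "\<And>j. j < k \<Longrightarrow> 0 \<le> v j"
  shows "cone_point k v \<in> standard_simplex k"
proof -
  let ?s = "\<Sum>j<k. v j"
  have s: "0 \<le> ?s" using assms by (intro sum_nonneg) auto
  have le: "v j \<le> ?s" if "j < k" for j
    using assms that by (intro member_le_sum) auto
  have "(\<Sum>i\<le>k. cone_point k v i) = (\<Sum>i<k. v i / max 1 ?s) + (1 - ?s / max 1 ?s)"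
    by (simp add: cone_point_def flip: lessThan_Suc_atMost)
  also have "\<dots> = 1" by (simp flip: sum_divide_distrib)
  finally show ?thesis
    using assms s le unfolding standard_simplex_def cone_point_def
    by (auto simp: divide_le_eq max_def) (meson le_less_trans linorder_not_less order_less_imp_le order_trans)
qed

lemma cone_point_simplex:
  assumes "t \<in> standard_simplex k"
  shows "cone_point k t = t"
proof -
  have "(\<Sum>j<k. t j) + t k = 1"
    using assms by (simp add: standard_simplex_def flip: lessThan_Suc_atMost)
  then have "(\<Sum>j<k. t j) = 1 - t k" by simp
  moreover have "0 \<le> t k" "\<And>i. i > k \<Longrightarrow> t i = 0" using assms by (auto simp: standard_simplex_def)
  ultimately show ?thesis by (auto simp: cone_point_def fun_eq_iff max_def)
qed

lemma continuous_map_cone_point: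
  assumes "\<And>j. continuous_map X euclideanreal (\<lambda>t. v t j)"
    and "\<And>t j. t \<in> topspace X \<Longrightarrow> 0 \<le> v t j"
  shows "continuous_map X (simplex_top k) (\<lambda>t. cone_point k (v t))"
proof (rule continuous_map_into_subtopology)
  have "continuous_map X euclideanreal (\<lambda>t. cone_point k (v t) i)" for i
    unfolding cone_point_def
    by (cases "i < k"; cases "i = k") (auto intro!: continuous_intros assms)
  then show "continuous_map X (powertop_real UNIV) (\<lambda>t. cone_point k (v t))"
    by (simp add: continuous_map_componentwise_UNIV)
  show "(\<lambda>t. cone_point k (v t)) \<in> topspace X \<rightarrow> standard_simplex k"
    using assms(2) by (simp add: cone_point_in_simplex)
qed

text \<open>
  The coordinates of \<open>\<Delta>\<^sup>n\<^sup>+\<^sup>m\<close> are split into two blocks, which are doubled before they are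
  retracted. Doubling makes the map surjective: halving the barycentric coordinates of \<open>t\<close> and
  \<open>t'\<close> yields a vector of total sum at most 1.
\<close>

lemma simplex_covers_product_of_simplices:
  "\<exists>p. continuous_map (simplex_top (n + m)) (prod_topology (simplex_top n) (simplex_top m)) p \<and>
       p ` topspace (simplex_top (n + m)) = topspace (prod_topology (simplex_top n) (simplex_top m))"
proof -
  define p where "p u = (cone_point n (\<lambda>i. 2 * u i), cone_point m (\<lambda>j. 2 * u (n + j)))"
    for u :: "nat \<Rightarrow> real"
  have nn: "0 \<le> u i" if "u \<in> standard_simplex k" for u i k
    using that by (simp add: standard_simplex_def)
  have c: "continuous_map (simplex_top (n + m)) (prod_topology (simplex_top n) (simplex_top m)) p"
    unfolding p_def
    by (intro continuous_map_pairedI continuous_map_cone_point continuous_intros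
        continuous_map_simplex_coordinate) (auto simp: nn)
  have "\<exists>u\<in>standard_simplex (n + m). (t, t') = p u"
    if t: "t \<in> standard_simplex n" and t': "t' \<in> standard_simplex m" for t t'
  proof
    define u where "u i = (if i < n then t i / 2 else if i < n + m then t' (i - n) / 2 else 0)" for i
    \<comment> \<open>\<open>cone_point\<close> only fills in the last barycentric coordinate here\<close>
    let ?u = "cone_point (n + m) u"
    have sum: "(\<Sum>j<n. t j) = 1 - t n" "(\<Sum>j<m. t' j) = 1 - t' m"
      using t t' by (simp_all add: standard_simplex_def flip: lessThan_Suc_atMost)
    have "(\<Sum>j<n+m. u j) = (\<Sum>j<n. u j) + (\<Sum>j<m. u (n + j))"
      by (induction m) (simp_all add: algebra_simps)
    also have "\<dots> = (\<Sum>j<n. t j) / 2 + (\<Sum>j<m. t' j) / 2"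
      by (simp add: u_def sum_divide_distrib)
    also have "\<dots> \<le> 1"
      using sum nn[OF t, of n] nn[OF t', of m] by (simp add: field_simps)
    finally have "max 1 (\<Sum>j<n+m. u j) = 1" by simp
    then have eq: "?u i = u i" if "i < n + m" for i
      using that by (simp add: cone_point_def)
    show "?u \<in> standard_simplex (n + m)"
      using nn t t' by (intro cone_point_in_simplex) (auto simp: u_def)
    have "cone_point n (\<lambda>i. 2 * ?u i) = cone_point n t"
      unfolding cone_point_def[of n] by (simp add: eq u_def cong: if_cong)
    moreover have "cone_point m (\<lambda>j. 2 * ?u (n + j)) = cone_point m t'"
      unfolding cone_point_def[of m] by (simp add: eq u_def cong: if_cong)
    ultimately show "(t, t') = p ?u"
      using t t' by (simp add: p_def cone_point_simplex)
  qed
  then have "p ` topspace (simplex_top (n + m)) = topspace (prod_topology (simplex_top n) (simplex_top m))"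
    using continuous_map_image_subset_topspace[OF c] by (force simp: image_iff)
  then show ?thesis using c by blast
qed

text \<open>
  These are the spaces over which homotopies and test families are parametrized: simplices, the
  interval and cubes. They are compact Hausdorff, so the covering map is a quotient map.
\<close>

definition simplex_image :: "'a topology \<Rightarrow> bool" where
  "simplex_image K \<longleftrightarrow> Hausdorff_space K \<and>
     (\<exists>n p. continuous_map (simplex_top n) K p \<and> p ` topspace (simplex_top n) = topspace K)"

lemma simplex_image_imp_compact: "simplex_image K \<Longrightarrow> compact_space K"
  unfolding simplex_image_def using compact_space_simplex image_compactin
  by (metis compact_space_def)

lemma simplex_image_imp_delta_generated: "simplex_image K \<Longrightarrow> delta_generated K"
  unfolding simplex_image_def
  using delta_generated_quotient_map[OF quotient_map_compact_Hausdorff[OF compact_space_simplex]]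
    delta_generated_simplex by blast

lemma simplex_image_simplex: "simplex_image (simplex_top n)"
  unfolding simplex_image_def
  by (intro conjI exI[of _ n] exI[of _ id] Hausdorff_space_simplex) auto

lemma simplex_image_interval: "simplex_image unit_interval"
  unfolding simplex_image_def
proof (intro conjI exI)
  show "Hausdorff_space unit_interval"
    by (simp add: Hausdorff_space_subtopology)
  show "continuous_map (simplex_top 1) unit_interval (\<lambda>t. t 0)"
    by (intro continuous_map_into_subtopology continuous_map_simplex_coordinate)
       (auto simp: standard_simplex_def)
  have "(\<lambda>i. if i = 0 then r else if i = 1 then 1 - r else 0) \<in> standard_simplex 1"
    if "0 \<le> r" "r \<le> 1" for r :: real
    using that by (auto simp: standard_simplex_def)
  then have "\<exists>t\<in>standard_simplex 1. r = t 0" if "0 \<le> r" "r \<le> 1" for r :: real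
    using that by (intro bexI[of _ "\<lambda>i. if i = 0 then r else if i = 1 then 1 - r else 0"]) auto
  then show "(\<lambda>t. t 0) ` topspace (simplex_top 1) = topspace unit_interval"
    by (auto simp: standard_simplex_def image_iff)
qed

text \<open>
  The map \<open>t \<mapsto> (min 1 (n t\<^sub>i))\<^sub>i\<close> is onto: \<open>s\<close> is the image of the point with coordinates \<open>s\<^sub>i / n\<close>,
  whose sum is at most 1.
\<close>

lemma simplex_image_cube: "simplex_image (cube n)"
  unfolding simplex_image_def
proof (intro conjI exI)
  let ?p = "\<lambda>t. restrict (\<lambda>i. min 1 (real n * t i)) {..<n}"
  show "Hausdorff_space (cube n)"
    by (simp add: Hausdorff_space_product_topology Hausdorff_space_subtopology)
  show c: "continuous_map (simplex_top n) (cube n) ?p"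
    unfolding continuous_map_componentwise
    by (auto simp: continuous_map_in_subtopology standard_simplex_def
        intro!: continuous_intros continuous_map_simplex_coordinate)
  have "\<exists>t\<in>standard_simplex n. s = ?p t" if s: "s \<in> topspace (cube n)" for s
  proof
    let ?t = "cone_point n (\<lambda>i. s i / n)"
    have s01: "0 \<le> s i \<and> s i \<le> 1" if "i < n" for i
      using s that by (auto simp: PiE_iff)
    show "?t \<in> standard_simplex n"
      using s01 by (intro cone_point_in_simplex) auto
    have "(\<Sum>j<n. s j / n) \<le> (\<Sum>j<n. 1 / n)"
      using s01 by (intro sum_mono divide_right_mono) auto
    then have "(\<Sum>j<n. s j / n) \<le> 1" by (cases "n = 0") auto
    then have "min 1 (real n * ?t i) = s i" if "i < n" for i
      using that s01[OF that] by (simp add: cone_point_def max_def)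
    then show "s = ?p ?t" using s by (auto simp: fun_eq_iff PiE_iff extensional_def)
  qed
  then show "?p ` topspace (simplex_top n) = topspace (cube n)"
    using continuous_map_image_subset_topspace[OF c] by auto
qed

lemma simplex_image_prod:
  assumes "simplex_image K" "simplex_image L"
  shows "simplex_image (prod_topology K L)"
proof -
  obtain n p m q where p: "continuous_map (simplex_top n) K p" "p ` topspace (simplex_top n) = topspace K"
    and q: "continuous_map (simplex_top m) L q" "q ` topspace (simplex_top m) = topspace L"
    using assms unfolding simplex_image_def by blast
  obtain r where r: "continuous_map (simplex_top (n + m)) (prod_topology (simplex_top n) (simplex_top m)) r"
      "r ` topspace (simplex_top (n + m)) = topspace (prod_topology (simplex_top n) (simplex_top m))"
    using simplex_covers_product_of_simplices by blast
  let ?f = "\<lambda>(x, y). (p x, q y)"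
  have "continuous_map (prod_topology (simplex_top n) (simplex_top m)) (prod_topology K L) ?f"
    using p(1) q(1) continuous_map_prod_top by blast
  then have "continuous_map (simplex_top (n + m)) (prod_topology K L) (?f \<circ> r)"
    using continuous_map_compose r(1) by blast
  moreover have "(?f \<circ> r) ` topspace (simplex_top (n + m)) = topspace (prod_topology K L)"
    unfolding image_comp[symmetric] r(2) topspace_prod_topology p(2)[symmetric] q(2)[symmetric] by auto
  ultimately show ?thesis
    using assms unfolding simplex_image_def by (metis Hausdorff_space_prod_topology)
qed

lemma simplex_image_locally_compact:
  "simplex_image K \<Longrightarrow> locally_compact_space K \<and> Hausdorff_space K"
  by (simp add: simplex_image_imp_compact compact_imp_locally_compact_space simplex_image_def)

lemma delta_generated_prod_sum:
  assumes "\<And>i. i \<in> I \<Longrightarrow> delta_generated (prod_topology K (X i))"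
  shows "delta_generated (prod_topology K (sum_topology X I))"
  unfolding delta_generated_def
proof (intro allI impI openin_prod_sum)
  fix W assume W: "simplex_open (prod_topology K (sum_topology X I)) W"
  then show WT: "W \<subseteq> topspace (prod_topology K (sum_topology X I))"
    unfolding simplex_open_def by blast
  fix i assume i: "i \<in> I"
  have "simplex_open (prod_topology K (X i)) {(k, x). (k, (i, x)) \<in> W}"
    unfolding simplex_open_def
  proof (intro conjI allI impI)
    show "{(k, x). (k, i, x) \<in> W} \<subseteq> topspace (prod_topology K (X i))" using WT by auto
    fix n and \<sigma> :: "(nat \<Rightarrow> real) \<Rightarrow> 'b \<times> 'c"
    assume s: "continuous_map (simplex_top n) (prod_topology K (X i)) \<sigma>"
    have "continuous_map (prod_topology K (X i)) (prod_topology K (sum_topology X I))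
        (\<lambda>(k, x). (k, (i, x)))"
      using continuous_map_component_injection[OF i, of X] by (simp add: continuous_map_prod_top)
    then have "continuous_map (simplex_top n) (prod_topology K (sum_topology X I))
        ((\<lambda>(k, x). (k, (i, x))) \<circ> \<sigma>)"
      using s continuous_map_compose by blast
    then have "openin (simplex_top n)
        {t \<in> topspace (simplex_top n). ((\<lambda>(k, x). (k, (i, x))) \<circ> \<sigma>) t \<in> W}"
      using W unfolding simplex_open_def by blast
    then show "openin (simplex_top n)
        {t \<in> topspace (simplex_top n). \<sigma> t \<in> {(k, x). (k, i, x) \<in> W}}"
      by (simp add: case_prod_beta)
  qed
  then show "openin (prod_topology K (X i)) {(k, x). (k, (i, x)) \<in> W}"
    using assms[OF i] delta_generated_def by blast
qed

text \<open>
  \<open>Y\<close> is the quotient of the sum of all its singular simplices. As \<open>K\<close> is locally compact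
  Hausdorff, \<open>K \<times> Y\<close> is then a quotient of a sum of spaces \<open>K \<times> \<Delta>\<^sup>m\<close>, and these are images of
  simplices.
\<close>

lemma delta_generated_prod:
  fixes K :: "'a topology" and Y :: "'b topology"
  assumes K: "simplex_image K" and Y: "delta_generated Y"
  shows "delta_generated (prod_topology K Y)"
proof -
  define I where "I = {(n, \<sigma>). continuous_map (simplex_top n) Y \<sigma>}"
  let ?S = "sum_topology (\<lambda>(n, \<sigma>). simplex_top n) I"
  let ?q = "\<lambda>((n, \<sigma>), t). \<sigma> t"
  have "quotient_map ?S Y ?q"
    unfolding quotient_map_def
  proof (intro conjI allI impI)
    show "?q ` topspace ?S = topspace Y"
    proof
      show "?q ` topspace ?S \<subseteq> topspace Y"
        by (auto simp: I_def continuous_map_def)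
      show "topspace Y \<subseteq> ?q ` topspace ?S"
      proof
        fix y assume y: "y \<in> topspace Y"
        obtain t where t: "t \<in> standard_simplex 0" using nonempty_standard_simplex by blast
        have "((0, \<lambda>_. y), t) \<in> topspace ?S" using y t by (auto simp: I_def)
        then show "y \<in> ?q ` topspace ?S" by (force simp: image_iff)
      qed
    qed
    fix U assume U: "U \<subseteq> topspace Y"
    have "openin ?S {x \<in> topspace ?S. ?q x \<in> U} \<longleftrightarrow> (\<forall>(n, \<sigma>)\<in>I.
       openin (simplex_top n) {t \<in> topspace (simplex_top n). \<sigma> t \<in> U})"
      unfolding openin_sum_topology by (auto simp: Collect_conj_eq)
    also have "\<dots> \<longleftrightarrow> simplex_open Y U"
      using U by (auto simp: simplex_open_def I_def)
    finally show "openin ?S {x \<in> topspace ?S. ?q x \<in> U} \<longleftrightarrow> openin Y U"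
      using Y by (simp add: openin_delta_generated)
  qed
  then have "quotient_map (prod_topology K ?S) (prod_topology K Y) (\<lambda>(x, y). (x, ?q y))"
    using simplex_image_locally_compact[OF K] by (intro quotient_map_prod_right) auto
  moreover have "delta_generated (prod_topology K ?S)"
    using K by (intro delta_generated_prod_sum)
       (auto intro!: simplex_image_imp_delta_generated simplex_image_prod simplex_image_simplex)
  ultimately show ?thesis
    by (rule delta_generated_quotient_map)
qed

section \<open>\<open>\<Delta>\<close>-Hausdorff spaces\<close>

text \<open>
  The counterpart of a closed diagonal. A simplex is compared with a path because path images are
  what has to be closed in a \<open>\<Delta>\<close>-Hausdorff space, while simplices detect closed sets.
\<close>

definition coincidences_closed :: "'a topology \<Rightarrow> bool" where
  "coincidences_closed X \<longleftrightarrow> (\<forall>n \<sigma> \<gamma>. continuous_map (simplex_top n) X \<sigma> \<and> pathin X \<gamma> \<longrightarrow>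
     closedin (prod_topology (simplex_top n) unit_interval)
       {(s, t) \<in> topspace (prod_topology (simplex_top n) unit_interval). \<sigma> s = \<gamma> t})"

lemma pathin_segment:
  assumes g: "pathin X g" and "0 \<le> a" "a \<le> b" "b \<le> 1"
  shows "\<exists>h. pathin X h \<and> h ` {0..1} = g ` {a..b}"
proof (intro exI conjI)
  let ?l = "\<lambda>r. a + (b - a) * r"
  have l: "?l ` {0..1} = {a..b}"
    using image_affinity_atLeastAtMost[of "b - a" a 0 1] assms(3) by (simp add: add.commute)
  have "continuous_map unit_interval unit_interval ?l"
    unfolding continuous_map_in_subtopology
  proof
    show "?l \<in> topspace unit_interval \<rightarrow> {0..1}"
      using l assms by (auto simp: Pi_iff) (metis atLeastAtMost_iff dual_order.trans image_eqI)+
  qed (auto intro: continuous_intros)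
  then show "pathin X (g \<circ> ?l)"
    using g unfolding pathin_def by (rule continuous_map_compose)
  show "(g \<circ> ?l) ` {0..1} = g ` {a..b}"
    by (simp only: image_comp[symmetric] l)
qed

text \<open>
  If \<open>\<sigma> s \<noteq> \<gamma> t\<close>, then \<open>\<gamma>\<close> avoids the closed point \<open>\<sigma> s\<close> on a whole closed interval around \<open>t\<close>. The
  image of that interval is closed, being the image of a path, so \<open>\<sigma>\<close> avoids it near \<open>s\<close>.
\<close>

lemma delta_Hausdorff_imp_coincidences_closed:
  assumes H: "delta_Hausdorff X"
  shows "coincidences_closed X"
  unfolding coincidences_closed_def
proof (intro allI impI)
  fix n \<sigma> \<gamma>
  assume "continuous_map (simplex_top n) X \<sigma> \<and> pathin X \<gamma>"
  then have s: "continuous_map (simplex_top n) X \<sigma>" and g: "pathin X \<gamma>" by auto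
  let ?D = "simplex_top n" and ?I = unit_interval
  let ?E = "{(s, t) \<in> topspace (prod_topology ?D ?I). \<sigma> s = \<gamma> t}"
  have seg: "closedin X (\<gamma> ` {a..b})" if "0 \<le> a" "a \<le> b" "b \<le> 1" for a b
    using pathin_segment[OF g that] H unfolding delta_Hausdorff_def by metis
  have "openin (prod_topology ?D ?I) (topspace (prod_topology ?D ?I) - ?E)"
    unfolding openin_prod_topology_alt
  proof (intro allI impI)
    fix s t assume st: "(s, t) \<in> topspace (prod_topology ?D ?I) - ?E"
    then have sD: "s \<in> topspace ?D" and t01: "t \<in> {0..1}" and ne: "\<sigma> s \<noteq> \<gamma> t" by auto
    have "pathin X (\<lambda>_. \<sigma> s)" using s sD by (auto simp: continuous_map_def)
    then have "closedin X ((\<lambda>_::real. \<sigma> s) ` {0..1})"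
      using H unfolding delta_Hausdorff_def by metis
    moreover have "(\<lambda>_::real. \<sigma> s) ` {0..1} = {\<sigma> s}" by (simp add: image_constant_conv)
    ultimately have "closedin X {\<sigma> s}" by simp
    then have "closedin ?I {r \<in> topspace ?I. \<gamma> r \<in> {\<sigma> s}}"
      using g unfolding pathin_def by (intro closedin_continuous_map_preimage) auto
    then have "openin ?I ({0..1} - {r \<in> {0..1}. \<gamma> r = \<sigma> s})"
      by (simp add: closedin_def)
    then obtain e where e: "e > 0" "\<And>r. r \<in> {0..1} \<Longrightarrow> dist r t < e \<Longrightarrow> \<gamma> r \<noteq> \<sigma> s"
      unfolding openin_euclidean_subtopology_iff using t01 ne by force
    \<comment> \<open>half of \<open>e\<close>, so that the closed interval stays in the ball of radius \<open>e\<close>\<close>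
    define a b where "a = max 0 (t - e/2)" and "b = min 1 (t + e/2)"
    have ab: "0 \<le> a" "a \<le> b" "b \<le> 1" using e t01 by (auto simp: a_def b_def)
    have "\<sigma> s \<notin> \<gamma> ` {a..b}"
      using e ab by (force simp: a_def b_def dist_real_def)
    moreover have "closedin ?D {s \<in> topspace ?D. \<sigma> s \<in> \<gamma> ` {a..b}}"
      using seg[OF ab] s by (rule closedin_continuous_map_preimage[rotated])
    ultimately have oN: "openin ?D (topspace ?D - {s \<in> topspace ?D. \<sigma> s \<in> \<gamma> ` {a..b}})"
      and sN: "s \<in> topspace ?D - {s \<in> topspace ?D. \<sigma> s \<in> \<gamma> ` {a..b}}"
      using sD by (auto simp: closedin_def)
    have oV: "openin ?I ({0..1} \<inter> ball t (e/2))" by (simp add: openin_open_Int)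
    have "{0..1} \<inter> ball t (e/2) \<subseteq> {a..b}"
      by (auto simp: a_def b_def dist_real_def abs_if split: if_splits)
    then have "(topspace ?D - {s \<in> topspace ?D. \<sigma> s \<in> \<gamma> ` {a..b}}) \<times> ({0..1} \<inter> ball t (e/2))
        \<subseteq> topspace (prod_topology ?D ?I) - ?E" by auto
    moreover have "t \<in> {0..1} \<inter> ball t (e/2)" using t01 e by auto
    ultimately show "\<exists>U V. openin ?D U \<and> openin ?I V \<and> s \<in> U \<and> t \<in> V \<and>
        U \<times> V \<subseteq> topspace (prod_topology ?D ?I) - ?E"
      using oN sN oV by blast
  qed
  then show "closedin (prod_topology ?D ?I) ?E"
    by (simp add: closedin_def) auto
qed

text \<open>
  The preimage of \<open>\<gamma>[0, 1]\<close> under a simplex is the projection of a coincidence set along the compact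
  interval.
\<close>

lemma coincidences_closed_imp_delta_Hausdorff:
  assumes "delta_generated X" and C: "coincidences_closed X"
  shows "delta_Hausdorff X"
  unfolding delta_Hausdorff_def
proof (intro allI impI)
  fix \<gamma> assume g: "pathin X \<gamma>"
  let ?I = unit_interval
  have gX: "\<gamma> ` {0..1} \<subseteq> topspace X"
    using g path_image_subset_topspace by blast
  have "simplex_open X (topspace X - \<gamma> ` {0..1})"
    unfolding simplex_open_def
  proof (intro conjI allI impI)
    fix n and \<sigma> :: "(nat \<Rightarrow> real) \<Rightarrow> 'a" assume s: "continuous_map (simplex_top n) X \<sigma>"
    let ?D = "simplex_top n"
    let ?E = "{(s, t) \<in> topspace (prod_topology ?D ?I). \<sigma> s = \<gamma> t}"
    have "closedin (prod_topology ?D ?I) ?E"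
      using C s g unfolding coincidences_closed_def by blast
    then have "compactin (prod_topology ?D ?I) ?E"
      by (intro closedin_compact_space) (simp_all add: compact_space_prod_topology compact_space_simplex
          compact_space_subtopology)
    then have "compactin ?D (fst ` ?E)"
      by (rule image_compactin) (rule continuous_map_fst)
    then have "closedin ?D (fst ` ?E)"
      using Hausdorff_space_simplex compactin_imp_closedin by blast
    moreover have "fst ` ?E = {s \<in> topspace ?D. \<sigma> s \<in> \<gamma> ` {0..1}}" by force
    ultimately have "closedin ?D {s \<in> topspace ?D. \<sigma> s \<in> \<gamma> ` {0..1}}" by simp
    then have "openin ?D (topspace ?D - {s \<in> topspace ?D. \<sigma> s \<in> \<gamma> ` {0..1}})"
      by (simp add: closedin_def)
    moreover have "{t \<in> topspace ?D. \<sigma> t \<in> topspace X - \<gamma> ` {0..1}} =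
        topspace ?D - {s \<in> topspace ?D. \<sigma> s \<in> \<gamma> ` {0..1}}"
      using s by (auto simp: continuous_map_def)
    ultimately show "openin ?D {t \<in> topspace ?D. \<sigma> t \<in> topspace X - \<gamma> ` {0..1}}" by simp
  qed auto
  then show "closedin X (\<gamma> ` {0..1})"
    using assms(1) gX unfolding closedin_def delta_generated_def by blast
qed

lemma in_Top_iff:
  "in_Top T X \<longleftrightarrow> delta_generated X \<and> (T = Delta_Generated_Hausdorff \<longrightarrow> coincidences_closed X)"
  using delta_Hausdorff_imp_coincidences_closed coincidences_closed_imp_delta_Hausdorff
  by (cases T) auto

lemma in_Top_imp_delta_generated: "in_Top T X \<Longrightarrow> delta_generated X"
  by (simp add: in_Top_iff)

lemma coincidences_closed_injective:
  assumes h: "continuous_map X Z h" "inj_on h (topspace X)" and Z: "coincidences_closed Z"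
  shows "coincidences_closed X"
  unfolding coincidences_closed_def
proof (intro allI impI)
  fix n \<sigma> \<gamma>
  assume a: "continuous_map (simplex_top n) X \<sigma> \<and> pathin X \<gamma>"
  then have "continuous_map (simplex_top n) Z (h \<circ> \<sigma>) \<and> pathin Z (h \<circ> \<gamma>)"
    using h(1) by (metis continuous_map_compose pathin_compose)
  then have "closedin (prod_topology (simplex_top n) unit_interval)
    {(s, t) \<in> topspace (prod_topology (simplex_top n) unit_interval). (h \<circ> \<sigma>) s = (h \<circ> \<gamma>) t}"
    using Z unfolding coincidences_closed_def by blast
  moreover have "{(s, t) \<in> topspace (prod_topology (simplex_top n) unit_interval). (h \<circ> \<sigma>) s = (h \<circ> \<gamma>) t}
    = {(s, t) \<in> topspace (prod_topology (simplex_top n) unit_interval). \<sigma> s = \<gamma> t}"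
    using a h(2) by (auto simp: inj_on_eq_iff continuous_map_def pathin_def Pi_iff)
  ultimately show "closedin (prod_topology (simplex_top n) unit_interval)
    {(s, t) \<in> topspace (prod_topology (simplex_top n) unit_interval). \<sigma> s = \<gamma> t}" by simp
qed

section \<open>Products in Top\<close>

lemma topspace_Top_prod [simp]: "topspace (Top_prod X Y) = topspace X \<times> topspace Y"
  by (simp add: Top_prod_def)

lemma delta_generated_Top_prod: "delta_generated (Top_prod X Y)"
  by (simp add: Top_prod_def delta_generated_coreflection)

lemma continuous_map_id_from_coreflection: "continuous_map (delta_coreflection X) X (\<lambda>x. x)"
  using continuous_map_into_coreflection[OF delta_generated_coreflection[of X], where Y = X]
    by (metis continuous_map_id eq_id_iff)

lemma continuous_map_Top_prod_fst: "continuous_map (Top_prod X Y) X fst"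
  and continuous_map_Top_prod_snd: "continuous_map (Top_prod X Y) Y snd"
  using continuous_map_compose[OF continuous_map_id_from_coreflection continuous_map_fst]
    continuous_map_compose[OF continuous_map_id_from_coreflection continuous_map_snd]
  by (simp_all add: Top_prod_def o_def)

lemma continuous_map_into_Top_prod:
  assumes "delta_generated W" "continuous_map W X f" "continuous_map W Y g"
  shows "continuous_map W (Top_prod X Y) (\<lambda>w. (f w, g w))"
  using assms by (simp add: Top_prod_def continuous_map_into_coreflection continuous_map_pairedI)

lemma coincidences_closed_Top_prod:
  assumes "coincidences_closed X" "coincidences_closed Y"
  shows "coincidences_closed (Top_prod X Y)"
  unfolding coincidences_closed_def
proof (intro allI impI)
  fix n \<sigma> \<gamma>
  let ?P = "prod_topology (simplex_top n) unit_interval"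
  assume "continuous_map (simplex_top n) (Top_prod X Y) \<sigma> \<and> pathin (Top_prod X Y) \<gamma>"
  then have "continuous_map (simplex_top n) X (fst \<circ> \<sigma>) \<and> pathin X (fst \<circ> \<gamma>)"
     "continuous_map (simplex_top n) Y (snd \<circ> \<sigma>) \<and> pathin Y (snd \<circ> \<gamma>)"
    using continuous_map_Top_prod_fst continuous_map_Top_prod_snd
    by (meson continuous_map_compose pathin_compose)+
  then have "closedin ?P {(s, t) \<in> topspace ?P. (fst \<circ> \<sigma>) s = (fst \<circ> \<gamma>) t}"
     "closedin ?P {(s, t) \<in> topspace ?P. (snd \<circ> \<sigma>) s = (snd \<circ> \<gamma>) t}"
    using assms unfolding coincidences_closed_def by blast+
  then have "closedin ?P ({(s, t) \<in> topspace ?P. (fst \<circ> \<sigma>) s = (fst \<circ> \<gamma>) t} \<inter>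
      {(s, t) \<in> topspace ?P. (snd \<circ> \<sigma>) s = (snd \<circ> \<gamma>) t})" by (rule closedin_Int)
  moreover have "{(s, t) \<in> topspace ?P. (fst \<circ> \<sigma>) s = (fst \<circ> \<gamma>) t} \<inter>
      {(s, t) \<in> topspace ?P. (snd \<circ> \<sigma>) s = (snd \<circ> \<gamma>) t} = {(s, t) \<in> topspace ?P. \<sigma> s = \<gamma> t}"
    by (auto simp: prod_eq_iff)
  ultimately show "closedin ?P {(s, t) \<in> topspace ?P. \<sigma> s = \<gamma> t}" by simp
qed

lemma in_Top_prod: "in_Top T X \<Longrightarrow> in_Top T Y \<Longrightarrow> in_Top T (Top_prod X Y)"
  by (simp add: in_Top_iff delta_generated_Top_prod coincidences_closed_Top_prod)

section \<open>Quotients in Top\<close>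

lemma topspace_quotient_space:
  assumes "equiv (topspace X) R"
  shows "topspace (quotient_space X R) = topspace X // R"
proof
  show "topspace (quotient_space X R) \<subseteq> topspace X // R"
    using openin_topspace[of "quotient_space X R"] unfolding openin_quotient_space by blast
  have "{x \<in> topspace X. R `` {x} \<in> topspace X // R} = topspace X"
    by (auto intro: quotientI)
  then have "openin (quotient_space X R) (topspace X // R)"
    by (simp add: openin_quotient_space)
  then show "topspace X // R \<subseteq> topspace (quotient_space X R)"
    by (rule openin_subset)
qed

lemma quotient_map_quotient_space:
  assumes "equiv (topspace X) R"
  shows "quotient_map X (quotient_space X R) (\<lambda>x. R `` {x})"
  unfolding quotient_map_def topspace_quotient_space[OF assms] openin_quotient_space
  by (auto simp: quotient_def)

text \<open>
  The least equivalence relation with quotient in Top is an intersection, and it has to be shown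
  that its own quotient lies in Top. The family is not empty, because the quotient by the total
  relation has at most one point. The quotient by the intersection embeds as a set into the product
  of the quotients by the members, so its coincidence sets are intersections of theirs.
\<close>

lemma Top_equiv_props:
  assumes X: "delta_generated X" and r: "r \<subseteq> topspace X \<times> topspace X"
  shows "equiv (topspace X) (Top_equiv T X r)" and "r \<subseteq> Top_equiv T X r"
    and "in_Top T (Top_quotient T X r)"
proof -
  define F where "F = {R. equiv (topspace X) R \<and> r \<subseteq> R \<and> in_Top T (quotient_space X R)}"
  let ?R0 = "Top_equiv T X r" and ?Q = "Top_quotient T X r"
  have R0: "?R0 = \<Inter>F" by (simp add: Top_equiv_def F_def)
  have FD: "equiv (topspace X) R" "r \<subseteq> R" "in_Top T (quotient_space X R)" if "R \<in> F" for R
    using that by (auto simp: F_def)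
  \<comment> \<open>the total relation, as a member of the family\<close>
  define A where "A = topspace X \<times> topspace X"
  have eA: "equiv (topspace X) A"
    unfolding A_def by (auto intro!: equivI simp: refl_on_def sym_def trans_def)
  have A1: "\<And>c d. c \<in> topspace X // A \<Longrightarrow> d \<in> topspace X // A \<Longrightarrow> c = d"
    by (auto simp: quotient_def A_def)
  have "coincidences_closed (quotient_space X A)"
    unfolding coincidences_closed_def
  proof (intro allI impI)
    fix n \<sigma> \<gamma>
    let ?P = "prod_topology (simplex_top n) unit_interval"
    assume "continuous_map (simplex_top n) (quotient_space X A) \<sigma> \<and> pathin (quotient_space X A) \<gamma>"
    then have "\<sigma> s \<in> topspace X // A" "\<gamma> t \<in> topspace X // A"
      if "s \<in> topspace (simplex_top n)" "t \<in> {0..1}" for s t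
      using that by (auto simp: continuous_map_def pathin_def topspace_quotient_space[OF eA] Pi_iff)
    then have "\<sigma> s = \<gamma> t" if "s \<in> topspace (simplex_top n)" "t \<in> {0..1}" for s t
      using A1 that by blast
    then have "{(s, t) \<in> topspace ?P. \<sigma> s = \<gamma> t} = topspace ?P"
      by auto
    then show "closedin ?P {(s, t) \<in> topspace ?P. \<sigma> s = \<gamma> t}"
      by (simp only: closedin_topspace)
  qed
  then have "in_Top T (quotient_space X A)"
    using delta_generated_quotient_map[OF quotient_map_quotient_space[OF eA] X]
    by (simp add: in_Top_iff)
  then have "A \<in> F" using eA r by (auto simp: F_def A_def)
  then have ne: "F \<noteq> {}" by blast
  show e: "equiv (topspace X) ?R0"
  proof (rule equivI)
    show "?R0 \<subseteq> topspace X \<times> topspace X"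
      using \<open>A \<in> F\<close> unfolding R0 A_def by blast
    show "refl_on (topspace X) ?R0"
      using FD(1) unfolding R0 by (auto simp: equiv_def refl_on_def)
    show "sym ?R0"
      using FD(1) unfolding R0 sym_def equiv_def by blast
    show "trans ?R0"
      unfolding R0 by (intro trans_INTER[of F "\<lambda>x. x", simplified]) (use FD(1) in \<open>auto simp: equiv_def\<close>)
  qed
  show "r \<subseteq> ?R0" using FD(2) unfolding R0 by blast
  have Q: "?Q = quotient_space X ?R0" by (simp add: Top_quotient_def)
  have q: "quotient_map X ?Q (\<lambda>x. ?R0 `` {x})"
    unfolding Q by (rule quotient_map_quotient_space[OF e])
  have proj: "continuous_map ?Q (quotient_space X R) (\<lambda>C. R `` C)" if "R \<in> F" for R
  proof (rule continuous_compose_quotient_map[OF q])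
    have "(\<lambda>C. R `` C) (?R0 `` {x}) = R `` {x}" if x: "x \<in> topspace X" for x
    proof -
      have "(x, x) \<in> ?R0" using e x by (simp add: equiv_def refl_on_def)
      moreover have "?R0 \<subseteq> R" using \<open>R \<in> F\<close> unfolding R0 by blast
      moreover have "trans R" using FD(1)[OF \<open>R \<in> F\<close>] by (simp add: equiv_def)
      ultimately show ?thesis by (auto dest: transD)
    qed
    then show "continuous_map X (quotient_space X R) ((\<lambda>C. R `` C) \<circ> (\<lambda>x. ?R0 `` {x}))"
      by (intro continuous_map_eq[OF quotient_imp_continuous_map[OF
              quotient_map_quotient_space[OF FD(1)[OF that]]]]) simp
  qed
  \<comment> \<open>the projections to the quotients by members of \<open>F\<close> jointly separate points\<close>
  have sep: "c = d" if c: "c \<in> topspace ?Q" and d: "d \<in> topspace ?Q"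
    and eq: "\<And>R. R \<in> F \<Longrightarrow> R `` c = R `` d" for c d
  proof -
    obtain x y where x: "x \<in> topspace X" "c = ?R0 `` {x}" and y: "y \<in> topspace X" "d = ?R0 `` {y}"
      using c d unfolding Q topspace_quotient_space[OF e] by (auto simp: quotient_def)
    have "(x, y) \<in> R" if R: "R \<in> F" for R
    proof -
      have eR: "equiv (topspace X) R" using FD(1)[OF R] .
      have "?R0 \<subseteq> R" using R unfolding R0 by blast
      have "y \<in> d" using e y by (simp add: equiv_def refl_on_def)
      then have "y \<in> R `` c" using eq[OF R] eR y(1) by (auto simp: equiv_def refl_on_def)
      then obtain z where "(x, z) \<in> ?R0" "(z, y) \<in> R" using x by auto
      then show ?thesis using \<open>?R0 \<subseteq> R\<close> eR by (meson equivE subsetD transD)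
    qed
    then have "(x, y) \<in> ?R0" unfolding R0 by blast
    then show ?thesis using x y e by (simp add: equiv_class_eq)
  qed
  have "coincidences_closed ?Q" if T: "T = Delta_Generated_Hausdorff"
    unfolding coincidences_closed_def
  proof (intro allI impI)
    fix n \<sigma> \<gamma>
    let ?P = "prod_topology (simplex_top n) unit_interval"
    assume a: "continuous_map (simplex_top n) ?Q \<sigma> \<and> pathin ?Q \<gamma>"
    have "closedin ?P {(s, t) \<in> topspace ?P. ((\<lambda>C. R `` C) \<circ> \<sigma>) s = ((\<lambda>C. R `` C) \<circ> \<gamma>) t}"
      if "R \<in> F" for R
    proof -
      have "continuous_map (simplex_top n) (quotient_space X R) ((\<lambda>C. R `` C) \<circ> \<sigma>)"
        "pathin (quotient_space X R) ((\<lambda>C. R `` C) \<circ> \<gamma>)"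
        using a proj[OF that] by (metis continuous_map_compose pathin_compose)+
      then show ?thesis
        using FD(3)[OF that] T unfolding in_Top_iff coincidences_closed_def by blast
    qed
    then have "closedin ?P (\<Inter>R\<in>F. {(s, t) \<in> topspace ?P. ((\<lambda>C. R `` C) \<circ> \<sigma>) s = ((\<lambda>C. R `` C) \<circ> \<gamma>) t})"
      using ne by (intro closedin_INT) auto
    moreover have \<sigma>\<gamma>: "\<sigma> s \<in> topspace ?Q" "\<gamma> t \<in> topspace ?Q"
      if "s \<in> topspace (simplex_top n)" "t \<in> {0..1}" for s t
      using that a by (auto simp: continuous_map_def pathin_def Pi_iff)
    moreover have "(\<Inter>R\<in>F. {(s, t) \<in> topspace ?P. ((\<lambda>C. R `` C) \<circ> \<sigma>) s = ((\<lambda>C. R `` C) \<circ> \<gamma>) t})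
       = {(s, t) \<in> topspace ?P. \<sigma> s = \<gamma> t}" (is "?lhs = ?rhs")
    proof (intro equalityI subsetI)
      fix p assume p: "p \<in> ?lhs"
      obtain s t where st: "p = (s, t)" by fastforce
      have "s \<in> topspace (simplex_top n)" "t \<in> {0..1}" using p ne st by auto
      moreover have "R `` \<sigma> s = R `` \<gamma> t" if "R \<in> F" for R using p that st by auto
      ultimately show "p \<in> ?rhs" using sep \<sigma>\<gamma> st by auto
    qed auto
    ultimately show "closedin ?P {(s, t) \<in> topspace ?P. \<sigma> s = \<gamma> t}" by simp
  qed
  then show "in_Top T ?Q"
    using delta_generated_quotient_map[OF q X] by (simp add: in_Top_iff)
qed

lemma quotient_map_Top_quotient:
  assumes "delta_generated X" "r \<subseteq> topspace X \<times> topspace X"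
  shows "quotient_map X (Top_quotient T X r) (\<lambda>x. Top_equiv T X r `` {x})"
  unfolding Top_quotient_def by (rule quotient_map_quotient_space[OF Top_equiv_props(1)[OF assms]])

text \<open>
  The kernel of \<open>u\<close> is one of the relations intersected in \<^const>\<open>Top_equiv\<close>, since its quotient
  maps injectively to \<open>Z\<close>. This is the universal property of the quotient in Top.
\<close>

lemma Top_equiv_respected:
  assumes X: "delta_generated X" and r: "r \<subseteq> topspace X \<times> topspace X"
    and u: "continuous_map X Z u" and Z: "in_Top T Z"
    and resp: "\<And>x y. (x, y) \<in> r \<Longrightarrow> u x = u y"
    and xy: "(x, y) \<in> Top_equiv T X r"
  shows "u x = u y"
proof -
  define R where "R = {(x, y) \<in> topspace X \<times> topspace X. u x = u y}"
  have e: "equiv (topspace X) R"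
    unfolding R_def by (auto intro!: equivI simp: refl_on_def sym_def trans_def)
  note q = quotient_map_quotient_space[OF e]
  define v where "v C = u (SOME x. x \<in> C)" for C
  have v: "v (R `` {x}) = u x" if "x \<in> topspace X" for x
  proof -
    have "x \<in> R `` {x}" using that by (simp add: R_def)
    then have "(SOME z. z \<in> R `` {x}) \<in> R `` {x}" by (rule someI)
    moreover have "u z = u x" if "z \<in> R `` {x}" for z using that by (simp add: R_def)
    ultimately show ?thesis unfolding v_def by blast
  qed
  have "continuous_map (quotient_space X R) Z v"
    by (rule continuous_compose_quotient_map[OF q], rule continuous_map_eq[OF u]) (simp add: v)
  moreover have "inj_on v (topspace (quotient_space X R))"
  proof (rule inj_onI)
    fix c d assume "c \<in> topspace (quotient_space X R)" "d \<in> topspace (quotient_space X R)" "v c = v d"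
    then obtain x y where "x \<in> topspace X" "c = R `` {x}" "y \<in> topspace X" "d = R `` {y}" "v c = v d"
      unfolding topspace_quotient_space[OF e] by (auto simp: quotient_def)
    then have "(x, y) \<in> R" using v by (simp add: R_def)
    then show "c = d" using e \<open>c = R `` {x}\<close> \<open>d = R `` {y}\<close> by (simp add: equiv_class_eq)
  qed
  ultimately have "in_Top T (quotient_space X R)"
    using Z coincidences_closed_injective delta_generated_quotient_map[OF q X]
    unfolding in_Top_iff by blast
  moreover have "r \<subseteq> R" using r resp by (auto simp: R_def)
  ultimately have "Top_equiv T X r \<subseteq> R"
    using e unfolding Top_equiv_def by blast
  then show ?thesis using xy by (auto simp: R_def)
qed

lemma continuous_map_from_Top_quotient:
  assumes X: "delta_generated X" and r: "r \<subseteq> topspace X \<times> topspace X"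
    and u: "continuous_map X Z u"
    and v: "\<And>x. x \<in> topspace X \<Longrightarrow> v (Top_equiv T X r `` {x}) = u x"
  shows "continuous_map (Top_quotient T X r) Z v"
  by (rule continuous_compose_quotient_map[OF quotient_map_Top_quotient[OF X r]],
      rule continuous_map_eq[OF u]) (simp add: v)

text \<open>
  Descent of a family over \<open>K\<close>: the product of a quotient map with the locally compact Hausdorff
  space \<open>K\<close> is again a quotient map.
\<close>

lemma continuous_map_from_prod_Top_quotient:
  assumes K: "simplex_image K" and X: "delta_generated X" and r: "r \<subseteq> topspace X \<times> topspace X"
    and u: "continuous_map (prod_topology K X) Z u"
    and v: "\<And>k x. k \<in> topspace K \<Longrightarrow> x \<in> topspace X \<Longrightarrow> v (k, Top_equiv T X r `` {x}) = u (k, x)"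
  shows "continuous_map (prod_topology K (Top_quotient T X r)) Z v"
proof -
  have "quotient_map (prod_topology K X) (prod_topology K (Top_quotient T X r))
      (\<lambda>(k, x). (k, Top_equiv T X r `` {x}))"
    using simplex_image_locally_compact[OF K]
    by (intro quotient_map_prod_right quotient_map_Top_quotient X r) auto
  then show ?thesis
    by (rule continuous_compose_quotient_map, intro continuous_map_eq[OF u]) (auto simp: v)
qed

text \<open>
  This evaluates the description of induced maps on classes as unions of classes, the form in which
  the action and the tensor product of maps are given.
\<close>

lemma class_image_of_map:
  assumes "equiv A R" "equiv B S" "x \<in> A" "\<And>x y. (x, y) \<in> R \<Longrightarrow> (h x, h y) \<in> S"
  shows "S `` (h ` (R `` {x})) = S `` {h x}"
proof -
  have "(x, x) \<in> R" using assms(1,3) by (simp add: equiv_def refl_on_def)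
  moreover have "trans S" using assms(2) by (simp add: equiv_def)
  ultimately show ?thesis using assms(4) by (auto dest: transD)
qed

lemma Top_equiv_image_of_map:
  assumes X: "delta_generated X" "r \<subseteq> topspace X \<times> topspace X"
    and Y: "delta_generated Y" "s \<subseteq> topspace Y \<times> topspace Y"
    and h: "continuous_map X Y h" and hr: "\<And>x y. (x, y) \<in> r \<Longrightarrow> (h x, h y) \<in> s"
    and x: "x \<in> topspace X"
  shows "Top_equiv T Y s `` (h ` (Top_equiv T X r `` {x})) = Top_equiv T Y s `` {h x}"
proof (rule class_image_of_map[OF Top_equiv_props(1)[OF X] Top_equiv_props(1)[OF Y] x])
  fix y z assume yz: "(y, z) \<in> Top_equiv T X r"
  have e: "equiv (topspace Y) (Top_equiv T Y s)" by (rule Top_equiv_props(1)[OF Y])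
  have c: "continuous_map X (Top_quotient T Y s) ((\<lambda>y. Top_equiv T Y s `` {y}) \<circ> h)"
    by (rule continuous_map_compose[OF h quotient_imp_continuous_map[OF quotient_map_Top_quotient[OF Y]]])
  have "((\<lambda>y. Top_equiv T Y s `` {y}) \<circ> h) y = ((\<lambda>y. Top_equiv T Y s `` {y}) \<circ> h) z"
  proof (rule Top_equiv_respected[OF X c Top_equiv_props(3)[OF Y] _ yz])
    fix a b assume "(a, b) \<in> r"
    then have "(h a, h b) \<in> Top_equiv T Y s" using hr Top_equiv_props(2)[OF Y] by blast
    then show "((\<lambda>y. Top_equiv T Y s `` {y}) \<circ> h) a = ((\<lambda>y. Top_equiv T Y s `` {y}) \<circ> h) b"
      using equiv_class_eq[OF e] by simp
  qed
  moreover have "h z \<in> topspace Y"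
  proof -
    have "z \<in> topspace X" using yz Top_equiv_props(1)[OF X, of T] by (auto simp: equiv_def)
    then show ?thesis using h by (auto simp: continuous_map_def)
  qed
  ultimately show "(h y, h z) \<in> Top_equiv T Y s"
    by (intro eq_equiv_class[OF _ e]) simp_all
qed

section \<open>Mapping spaces in Top\<close>

text \<open>
  The subbasic set with empty compact part consists of all continuous maps, so it is the whole
  space.
\<close>

lemma continuous_map_into_compact_open:
  "continuous_map X (compact_open_topology Y Z) G \<longleftrightarrow>
     (\<forall>x\<in>topspace X. G x \<in> extensional (topspace Y) \<and> continuous_map Y Z (G x)) \<and>
     (\<forall>K U. compactin Y K \<longrightarrow> openin Z U \<longrightarrow> openin X {x \<in> topspace X. G x ` K \<subseteq> U})"
    (is "?L \<longleftrightarrow> ?R1 \<and> ?R2")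
proof -
  let ?B = "\<lambda>K U. {f \<in> extensional (topspace Y). continuous_map Y Z f \<and> f ` K \<subseteq> U}"
  let ?S = "{?B K U | K U. compactin Y K \<and> openin Z U}"
  have "?B {} {} \<in> ?S" by blast
  moreover have "?B K U \<subseteq> ?B {} {}" for K U by auto
  ultimately have U: "\<Union>?S = ?B {} {}" by (intro equalityI Union_least Union_upper) auto
  have L: "?L \<longleftrightarrow> (\<forall>K U. compactin Y K \<longrightarrow> openin Z U \<longrightarrow> openin X (G -` ?B K U \<inter> topspace X)) \<and>
      G ` topspace X \<subseteq> ?B {} {}"
    unfolding compact_open_topology_def continuous_on_generated_topo_iff U by blast
  have R1: "G ` topspace X \<subseteq> ?B {} {} \<longleftrightarrow> ?R1" by auto
  have "G -` ?B K U \<inter> topspace X = {x \<in> topspace X. G x ` K \<subseteq> U}" if ?R1 for K U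
    using that by auto
  then show ?thesis unfolding L R1 by auto
qed

text \<open>
  The tube lemma, applied to a compact subset of \<open>Y\<close> over a simplex of \<open>X\<close>. Continuity is only asked
  on \<open>\<Delta>\<^sup>n \<times> Y\<close>, where the product is the ordinary one.
\<close>

lemma continuous_map_curry:
  assumes X: "delta_generated X"
    and F: "\<And>n \<sigma>. continuous_map (simplex_top n) X \<sigma> \<Longrightarrow>
       continuous_map (prod_topology (simplex_top n) Y) Z (\<lambda>(t, y). F (\<sigma> t) y)"
  shows "continuous_map X (Top_map Y Z) (\<lambda>x. restrict (F x) (topspace Y))"
proof (rule continuous_map_delta_generated[OF X])
  fix n and \<sigma> :: "(nat \<Rightarrow> real) \<Rightarrow> 'a" assume s: "continuous_map (simplex_top n) X \<sigma>"
  note Fs = F[OF s]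
  have "continuous_map (simplex_top n) (compact_open_topology Y Z) (\<lambda>t. restrict (F (\<sigma> t)) (topspace Y))"
    unfolding continuous_map_into_compact_open
  proof (intro conjI ballI allI impI)
    fix t assume "t \<in> topspace (simplex_top n)"
    then have "continuous_map Y Z ((\<lambda>(t, y). F (\<sigma> t) y) \<circ> Pair t)"
      using continuous_map_o_Pair[OF Fs] by blast
    then show "continuous_map Y Z (restrict (F (\<sigma> t)) (topspace Y))"
      by (rule continuous_map_eq) auto
  next
    fix K U assume K: "compactin Y K" and U: "openin Z U"
    let ?W = "{p \<in> topspace (prod_topology (simplex_top n) Y). (\<lambda>(t, y). F (\<sigma> t) y) p \<in> U}"
    let ?V = "{t \<in> topspace (simplex_top n). restrict (F (\<sigma> t)) (topspace Y) ` K \<subseteq> U}"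
    have KY: "K \<subseteq> topspace Y" using K compactin_subset_topspace by blast
    have W: "openin (prod_topology (simplex_top n) Y) ?W"
      using Fs U openin_continuous_map_preimage by blast
    show "openin (simplex_top n) ?V"
    proof (subst openin_subopen, intro ballI)
      fix t assume t: "t \<in> ?V"
      have "{t} \<times> K \<subseteq> ?W" using t KY by auto
      moreover have "t \<in> topspace (simplex_top n)" using t by simp
      ultimately have "\<exists>A B. openin (simplex_top n) A \<and> openin Y B \<and> t \<in> A \<and> K \<subseteq> B \<and> A \<times> B \<subseteq> ?W"
        by (intro tube_lemma_right[OF W K])
      then obtain A B where AB: "openin (simplex_top n) A" "openin Y B" "t \<in> A" "K \<subseteq> B" "A \<times> B \<subseteq> ?W"
        by (elim exE conjE) (rule that)
      have "s \<in> ?V" if s: "s \<in> A" for s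
      proof -
        have "F (\<sigma> s) y \<in> U" if "y \<in> K" for y
        proof -
          have "(s, y) \<in> ?W" using AB(4,5) s that by blast
          then show ?thesis by simp
        qed
        moreover have "s \<in> topspace (simplex_top n)" using openin_subset[OF AB(1)] s by blast
        ultimately show ?thesis using KY by auto
      qed
      then have "A \<subseteq> ?V" by blast
      then show "\<exists>T. openin (simplex_top n) T \<and> t \<in> T \<and> T \<subseteq> ?V" using AB by blast
    qed
  qed simp
  then show "continuous_map (simplex_top n) (Top_map Y Z) ((\<lambda>x. restrict (F x) (topspace Y)) \<circ> \<sigma>)"
    by (simp add: Top_map_def continuous_map_simplex_coreflection o_def)
qed

text \<open>
  Evaluation is tested on a simplex \<open>\<tau>\<close> of \<open>W\<close>. Pulling the mapping space back along \<open>b \<tau>\<close> reduces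
  it to evaluation of maps on the compact Hausdorff space \<open>\<Delta>\<^sup>n\<close>, which is continuous: a point has
  a compact neighbourhood \<open>C\<close> that the map at that point sends into a given open set, and its
  image in \<open>Y\<close> is compact.
\<close>

lemma continuous_map_uncurry:
  assumes F: "continuous_map X (Top_map Y Z) (\<lambda>x. restrict (F x) (topspace Y))"
    and W: "delta_generated W" and a: "continuous_map W X a" and b: "continuous_map W Y b"
  shows "continuous_map W Z (\<lambda>w. F (a w) (b w))"
proof (rule continuous_map_delta_generated[OF W])
  fix n and \<tau> :: "(nat \<Rightarrow> real) \<Rightarrow> 'd" assume t: "continuous_map (simplex_top n) W \<tau>"
  let ?D = "simplex_top n"
  define G where "G s = restrict (F (a (\<tau> s))) (topspace Y)" for s
  define \<beta> where "\<beta> = b \<circ> \<tau>"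
  have \<beta>: "continuous_map ?D Y \<beta>"
    unfolding \<beta>_def using t b by (rule continuous_map_compose)
  have "continuous_map ?D (Top_map Y Z) ((\<lambda>x. restrict (F x) (topspace Y)) \<circ> (a \<circ> \<tau>))"
    by (intro continuous_map_compose[OF _ F] continuous_map_compose[OF t a])
  then have G: "continuous_map ?D (compact_open_topology Y Z) G"
    by (simp add: Top_map_def continuous_map_simplex_coreflection o_def G_def[abs_def])
  have GY: "continuous_map Y Z (G s)" if "s \<in> topspace ?D" for s
    using G that unfolding continuous_map_into_compact_open by blast
  have "continuous_map ?D Z (\<lambda>s. G s (\<beta> s))"
    unfolding continuous_map_def
  proof (intro conjI allI impI)
    show "(\<lambda>s. G s (\<beta> s)) \<in> topspace ?D \<rightarrow> topspace Z"
    proof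
      fix s assume s: "s \<in> topspace ?D"
      show "G s (\<beta> s) \<in> topspace Z"
        using continuous_map_funspace[OF GY[OF s]] continuous_map_funspace[OF \<beta>] s by blast
    qed
    fix U assume U: "openin Z U"
    let ?V = "{s \<in> topspace ?D. G s (\<beta> s) \<in> U}"
    show "openin ?D ?V"
    proof (subst openin_subopen, intro ballI)
      fix s0 assume s0: "s0 \<in> ?V"
      have "continuous_map ?D Z (G s0 \<circ> \<beta>)"
        using s0 \<beta> GY continuous_map_compose by blast
      then have o: "openin ?D {s \<in> topspace ?D. (G s0 \<circ> \<beta>) s \<in> U}"
        using U openin_continuous_map_preimage by blast
      have "neighbourhood_base_of (\<lambda>C. compactin ?D C \<and> closedin ?D C) ?D"
        using locally_compact_space_neighbourhood_base_closedin Hausdorff_space_simplex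
          compact_imp_locally_compact_space compact_space_simplex by blast
      then obtain A C where AC: "openin ?D A" "compactin ?D C" "s0 \<in> A" "A \<subseteq> C"
          "C \<subseteq> {s \<in> topspace ?D. (G s0 \<circ> \<beta>) s \<in> U}"
        unfolding neighbourhood_base_of using o s0 by (elim allE[of _ "{s \<in> topspace ?D. (G s0 \<circ> \<beta>) s \<in> U}"]) auto
      let ?N = "{s \<in> topspace ?D. G s ` (\<beta> ` C) \<subseteq> U}"
      have "compactin Y (\<beta> ` C)" using AC(2) \<beta> by (rule image_compactin)
      then have "openin ?D ?N" using G U unfolding continuous_map_into_compact_open by blast
      then have "openin ?D (A \<inter> ?N)" using AC(1) by blast
      moreover have "s0 \<in> A \<inter> ?N" using AC s0 by auto
      moreover have "A \<inter> ?N \<subseteq> ?V" using AC(4) by auto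
      ultimately show "\<exists>T. openin ?D T \<and> s0 \<in> T \<and> T \<subseteq> ?V" by blast
    qed
  qed
  then show "continuous_map ?D Z ((\<lambda>w. F (a w) (b w)) \<circ> \<tau>)"
  proof (rule continuous_map_eq)
    fix s assume "s \<in> topspace ?D"
    then have "\<beta> s \<in> topspace Y" using \<beta> by (auto simp: continuous_map_def)
    then show "G s (\<beta> s) = ((\<lambda>w. F (a w) (b w)) \<circ> \<tau>) s" by (simp add: G_def \<beta>_def)
  qed
qed

section \<open>Homotopy groups in terms of maps on cubes\<close>

definition cube_loop :: "nat \<Rightarrow> 'a topology \<Rightarrow> 'a \<Rightarrow> ((nat \<Rightarrow> real) \<Rightarrow> 'a) \<Rightarrow> bool" where
  "cube_loop n X x f \<longleftrightarrow> continuous_map (cube n) X f \<and> const_on_boundary n x f"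

abbreviation loop_homotopic ::
  "nat \<Rightarrow> 'a topology \<Rightarrow> 'a \<Rightarrow> ((nat \<Rightarrow> real) \<Rightarrow> 'a) \<Rightarrow> ((nat \<Rightarrow> real) \<Rightarrow> 'a) \<Rightarrow> bool" where
  "loop_homotopic n X x \<equiv> homotopic_with (const_on_boundary n x) (cube n) X"

lemma cube_boundary_subset: "t \<in> cube_boundary n \<Longrightarrow> t \<in> topspace (cube n)"
  by (simp add: cube_boundary_def)

lemma loop_homotopicI:
  assumes "continuous_map (prod_topology unit_interval (cube n)) X H"
    and "\<And>t. t \<in> topspace (cube n) \<Longrightarrow> H (0, t) = f t"
    and "\<And>t. t \<in> topspace (cube n) \<Longrightarrow> H (1, t) = g t"
    and "\<And>u t. u \<in> {0..1} \<Longrightarrow> t \<in> cube_boundary n \<Longrightarrow> H (u, t) = x"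
  shows "loop_homotopic n X x f g"
proof -
  have "loop_homotopic n X x f g \<longleftrightarrow>
     (\<exists>h. continuous_map (prod_topology unit_interval (cube n)) X h \<and>
        (\<forall>t \<in> topspace (cube n). h (0, t) = f t) \<and> (\<forall>t \<in> topspace (cube n). h (1, t) = g t) \<and>
        (\<forall>u \<in> {0..1}. const_on_boundary n x (\<lambda>t. h (u, t))))"
    by (rule homotopic_with) (metis cube_boundary_subset)
  then show ?thesis using assms by blast
qed

lemma loop_homotopic_imp_cube_loop:
  "loop_homotopic n X x f g \<Longrightarrow> cube_loop n X x f \<and> cube_loop n X x g"
  unfolding cube_loop_def
  using homotopic_with_imp_continuous_maps homotopic_with_imp_property by blast

lemma loop_homotopic_refl: "cube_loop n X x f \<Longrightarrow> loop_homotopic n X x f f"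
  by (simp add: cube_loop_def)

lemma loop_homotopic_compose:
  assumes "loop_homotopic n X x f g" "continuous_map X Y h"
  shows "loop_homotopic n Y (h x) (h \<circ> f) (h \<circ> g)"
  using assms by (rule homotopic_with_compose_continuous_map_left) simp

lemma cube_loop_compose:
  "cube_loop n X x f \<Longrightarrow> continuous_map X Y h \<Longrightarrow> cube_loop n Y (h x) (h \<circ> f)"
  unfolding cube_loop_def by (auto intro: continuous_map_compose)

lemma homotopy_class_eq_iff:
  assumes "cube_loop n X x f"
  shows "homotopy_class n X x f = homotopy_class n X x g \<longleftrightarrow> loop_homotopic n X x f g"
proof
  assume "homotopy_class n X x f = homotopy_class n X x g"
  then have "loop_homotopic n X x g f"
    using loop_homotopic_refl[OF assms] unfolding homotopy_class_def by blast
  then show "loop_homotopic n X x f g" by (rule homotopic_with_symD)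
next
  assume fg: "loop_homotopic n X x f g"
  show "homotopy_class n X x f = homotopy_class n X x g"
    unfolding homotopy_class_def
    using homotopic_with_trans[OF fg] homotopic_with_trans[OF homotopic_with_symD[OF fg]] by auto
qed

lemma carrier_homotopy_group:
  "carrier (homotopy_group n X x) = {homotopy_class n X x f | f. cube_loop n X x f}"
  by (simp add: homotopy_group_def cube_loop_def)

lemma homotopy_group_map_class:
  assumes h: "continuous_map X Y h" and f: "cube_loop n X x f"
  shows "homotopy_group_map n Y h x (homotopy_class n X x f) = homotopy_class n Y (h x) (h \<circ> f)"
proof -
  have "homotopy_class n Y (h x) (h \<circ> g) = homotopy_class n Y (h x) (h \<circ> f)"
    if "g \<in> homotopy_class n X x f" for g
  proof -
    have "loop_homotopic n X x f g" using that by (simp add: homotopy_class_def)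
    then have "loop_homotopic n Y (h x) (h \<circ> f) (h \<circ> g)" using h by (rule loop_homotopic_compose)
    then show ?thesis using homotopy_class_eq_iff[OF cube_loop_compose[OF f h]] by blast
  qed
  moreover have "f \<in> homotopy_class n X x f"
    using loop_homotopic_refl[OF f] by (simp add: homotopy_class_def)
  ultimately show ?thesis unfolding homotopy_group_map_def by blast
qed

lemma continuous_map_cube_coordinate:
  assumes "continuous_map W (cube n) t" "i < n"
  shows "continuous_map W euclideanreal (\<lambda>w. t w i)"
proof -
  have "continuous_map (cube n) unit_interval (\<lambda>t. t i)"
    using assms(2) by (intro continuous_map_product_projection) auto
  then have "continuous_map (cube n) euclideanreal (\<lambda>t. t i)"
    by (rule continuous_map_into_fulltopology)
  then show ?thesis
    using continuous_map_compose[OF assms(1)] by (fastforce simp: o_def)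
qed

text \<open>
  The constant boundary values make the two halves agree where \<open>t\<^sub>0 = 1/2\<close>.
\<close>

lemma continuous_map_cube_concat:
  assumes n: "0 < n" and F: "continuous_map (prod_topology unit_interval (cube n)) X F"
    and G: "continuous_map (prod_topology unit_interval (cube n)) X G"
    and F0: "\<And>u t. u \<in> {0..1} \<Longrightarrow> t \<in> cube_boundary n \<Longrightarrow> F (u, t) = x"
    and G0: "\<And>u t. u \<in> {0..1} \<Longrightarrow> t \<in> cube_boundary n \<Longrightarrow> G (u, t) = x"
  shows "continuous_map (prod_topology unit_interval (cube n)) X
     (\<lambda>(u, t). cube_concat (\<lambda>t. F (u, t)) (\<lambda>t. G (u, t)) t)"
proof -
  let ?P = "prod_topology unit_interval (cube n)"
  have c: "continuous_map ?P euclideanreal (\<lambda>p. snd p i)" if "i < n" for i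
    using that by (rule continuous_map_cube_coordinate[OF continuous_map_snd])
  have half: "continuous_map (subtopology ?P A) ?P (\<lambda>p. (fst p, (snd p)(0 := 2 * snd p 0 - d)))"
    if A: "\<And>p. p \<in> topspace ?P \<Longrightarrow> p \<in> A \<Longrightarrow> 0 \<le> 2 * snd p 0 - d \<and> 2 * snd p 0 - d \<le> 1" for A d
  proof (intro continuous_map_pairedI continuous_map_from_subtopology[OF continuous_map_fst])
    have ci: "continuous_map (subtopology ?P A) unit_interval (\<lambda>p. ((snd p)(0 := 2 * snd p 0 - d)) i)"
      if i: "i < n" for i
    proof (rule continuous_map_into_subtopology)
      show "continuous_map (subtopology ?P A) euclideanreal (\<lambda>p. ((snd p)(0 := 2 * snd p 0 - d)) i)"
        using c[OF i] c[OF n]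
        by (cases "i = 0") (auto intro!: continuous_intros continuous_map_from_subtopology)
      show "(\<lambda>p. ((snd p)(0 := 2 * snd p 0 - d)) i) \<in> topspace (subtopology ?P A) \<rightarrow> {0..1}"
        using i A by (cases "i = 0") (auto simp: PiE_iff)
    qed
    show "continuous_map (subtopology ?P A) (cube n) (\<lambda>p. (snd p)(0 := 2 * snd p 0 - d))"
      unfolding continuous_map_componentwise
    proof (intro conjI ballI)
      show "(\<lambda>p. (snd p)(0 := 2 * snd p 0 - d)) ` topspace (subtopology ?P A) \<subseteq> extensional {..<n}"
        using n by (auto simp: PiE_iff extensional_def)
    qed (use ci in auto)
  qed
  have s01: "0 \<le> snd p 0" "snd p 0 \<le> 1" if "p \<in> topspace ?P" for p
  proof -
    have "snd p \<in> {..<n} \<rightarrow>\<^sub>E {0..1}" using that by (simp add: mem_Times_iff)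
    then have "snd p 0 \<in> {0..1}" by (rule PiE_mem) (simp add: n)
    then show "0 \<le> snd p 0" "snd p 0 \<le> 1" by auto
  qed
  have "continuous_map ?P X (\<lambda>p. if snd p 0 \<le> 1/2 then (F \<circ> (\<lambda>p. (fst p, (snd p)(0 := 2 * snd p 0 - 0)))) p
      else (G \<circ> (\<lambda>p. (fst p, (snd p)(0 := 2 * snd p 0 - 1)))) p)"
  proof (rule continuous_map_cases_le)
    show "continuous_map ?P euclideanreal (\<lambda>p. snd p 0)" by (rule c[OF n])
    show "continuous_map ?P euclideanreal (\<lambda>p. 1/2)" by simp
    show "continuous_map (subtopology ?P {p \<in> topspace ?P. snd p 0 \<le> 1/2}) X
       (F \<circ> (\<lambda>p. (fst p, (snd p)(0 := 2 * snd p 0 - 0))))"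
    proof (rule continuous_map_compose[OF half F])
      fix p assume "p \<in> topspace ?P" "p \<in> {p \<in> topspace ?P. snd p 0 \<le> 1/2}"
      then show "0 \<le> 2 * snd p 0 - 0 \<and> 2 * snd p 0 - 0 \<le> 1"
        using s01[of p] by auto
    qed
    show "continuous_map (subtopology ?P {p \<in> topspace ?P. 1/2 \<le> snd p 0}) X
       (G \<circ> (\<lambda>p. (fst p, (snd p)(0 := 2 * snd p 0 - 1))))"
    proof (rule continuous_map_compose[OF half G])
      fix p assume "p \<in> topspace ?P" "p \<in> {p \<in> topspace ?P. 1/2 \<le> snd p 0}"
      then show "0 \<le> 2 * snd p 0 - 1 \<and> 2 * snd p 0 - 1 \<le> 1"
        using s01[of p] by auto
    qed
    fix p assume p: "p \<in> topspace ?P" "snd p 0 = 1/2"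
    obtain u t where ut: "p = (u, t)" by fastforce
    have "t(0 := 1) \<in> cube_boundary n" "t(0 := 0) \<in> cube_boundary n"
      using p n ut by (auto simp: cube_boundary_def PiE_iff extensional_def)
    then have "(snd p)(0 := 1) \<in> cube_boundary n" "(snd p)(0 := 0) \<in> cube_boundary n"
      by (simp_all add: ut)
    moreover have "fst p \<in> {0..1}" using p ut by auto
    ultimately have "F (fst p, (snd p)(0 := 1)) = G (fst p, (snd p)(0 := 0))"
      using F0 G0 by metis
    then show "(F \<circ> (\<lambda>p. (fst p, (snd p)(0 := 2 * snd p 0 - 0)))) p =
      (G \<circ> (\<lambda>p. (fst p, (snd p)(0 := 2 * snd p 0 - 1)))) p"
      by (simp add: p(2))
  qed
  then show ?thesis
    by (rule continuous_map_eq) (simp add: cube_concat_def split_beta)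
qed

lemma cube_concat_on_boundary:
  assumes n: "0 < n" and f: "const_on_boundary n x f" and g: "const_on_boundary n x g"
    and t: "t \<in> cube_boundary n"
  shows "cube_concat f g t = x"
proof -
  have tc: "t \<in> topspace (cube n)" and "\<exists>i<n. t i = 0 \<or> t i = 1"
    using t by (auto simp: cube_boundary_def)
  then obtain i where i: "i < n" "t i = 0 \<or> t i = 1" by blast
  have b: "t(0 := r) \<in> cube_boundary n" if "0 \<le> r" "r \<le> 1" "i = 0 \<Longrightarrow> r = 0 \<or> r = 1" for r
  proof -
    have "t(0 := r) \<in> topspace (cube n)" using that(1,2) tc n by (auto simp: PiE_iff extensional_def)
    moreover have "(t(0 := r)) i = 0 \<or> (t(0 := r)) i = 1" using that(3) i by auto
    ultimately show ?thesis using i(1) unfolding cube_boundary_def by blast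
  qed
  have t0: "0 \<le> t 0" "t 0 \<le> 1" using tc n by (auto simp: PiE_iff)
  show ?thesis
  proof (cases "t 0 \<le> 1/2")
    case True
    then have "t(0 := 2 * t 0) \<in> cube_boundary n" using t0 i by (intro b) auto
    then show ?thesis using True f by (simp add: cube_concat_def)
  next
    case False
    then have "t(0 := 2 * t 0 - 1) \<in> cube_boundary n" using t0 i by (intro b) auto
    then show ?thesis using False g by (simp add: cube_concat_def)
  qed
qed

lemma loop_homotopic_concat:
  assumes n: "0 < n" and f: "loop_homotopic n X x f f'" and g: "loop_homotopic n X x g g'"
  shows "loop_homotopic n X x (cube_concat f g) (cube_concat f' g')"
proof -
  obtain F where F: "continuous_map (prod_topology unit_interval (cube n)) X F"
    "\<And>t. F (0, t) = f t" "\<And>t. F (1, t) = f' t"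
    "\<And>u. u \<in> {0..1} \<Longrightarrow> const_on_boundary n x (\<lambda>t. F (u, t))"
    using f unfolding homotopic_with_def by metis
  obtain G where G: "continuous_map (prod_topology unit_interval (cube n)) X G"
    "\<And>t. G (0, t) = g t" "\<And>t. G (1, t) = g' t"
    "\<And>u. u \<in> {0..1} \<Longrightarrow> const_on_boundary n x (\<lambda>t. G (u, t))"
    using g unfolding homotopic_with_def by metis
  show ?thesis
  proof (rule loop_homotopicI)
    show "continuous_map (prod_topology unit_interval (cube n)) X
     (\<lambda>(u, t). cube_concat (\<lambda>t. F (u, t)) (\<lambda>t. G (u, t)) t)"
      using F(4) G(4) by (intro continuous_map_cube_concat n F G) auto
    fix u t assume "u \<in> {0..1::real}" "t \<in> cube_boundary n"
    then show "(case (u, t) of (u, t) \<Rightarrow> cube_concat (\<lambda>t. F (u, t)) (\<lambda>t. G (u, t)) t) = x"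
      using cube_concat_on_boundary[OF n F(4) G(4)] by simp
  qed (simp_all add: F G)
qed

lemma mult_homotopy_group:
  assumes n: "0 < n" and f: "cube_loop n X x f" and g: "cube_loop n X x g"
  shows "homotopy_class n X x f \<otimes>\<^bsub>homotopy_group n X x\<^esub> homotopy_class n X x g
     = homotopy_class n X x (cube_concat f g)"
proof -
  have fg: "loop_homotopic n X x f f" "loop_homotopic n X x g g"
    by (rule loop_homotopic_refl[OF f], rule loop_homotopic_refl[OF g])
  have cl: "cube_loop n X x (cube_concat f g)"
    using loop_homotopic_concat[OF n fg] by (rule loop_homotopic_imp_cube_loop[THEN conjunct1])
  have "homotopy_class n X x (cube_concat f' g') = homotopy_class n X x (cube_concat f g)"
    if "f' \<in> homotopy_class n X x f" "g' \<in> homotopy_class n X x g" for f' g'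
  proof -
    have "loop_homotopic n X x f f'" "loop_homotopic n X x g g'"
      using that by (simp_all add: homotopy_class_def)
    then have "loop_homotopic n X x (cube_concat f g) (cube_concat f' g')"
      by (rule loop_homotopic_concat[OF n])
    then show ?thesis using homotopy_class_eq_iff[OF cl] by blast
  qed
  moreover have "f \<in> homotopy_class n X x f" "g \<in> homotopy_class n X x g"
    using fg by (simp_all add: homotopy_class_def)
  ultimately have "(\<Union>f'\<in>homotopy_class n X x f. \<Union>g'\<in>homotopy_class n X x g.
      homotopy_class n X x (cube_concat f' g')) = homotopy_class n X x (cube_concat f g)"
    by blast
  then show ?thesis by (simp add: homotopy_group_def)
qed

lemma cube_concat_compose: "h \<circ> cube_concat f g = cube_concat (h \<circ> f) (h \<circ> g)"
  by (auto simp: cube_concat_def)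

definition bijective_on_components :: "'a topology \<Rightarrow> 'b topology \<Rightarrow> ('a \<Rightarrow> 'b) \<Rightarrow> bool" where
  "bijective_on_components X Y h \<longleftrightarrow>
     (\<forall>x\<in>topspace X. \<forall>x'\<in>topspace X. path_component_of Y (h x) (h x') \<longrightarrow> path_component_of X x x') \<and>
     (\<forall>y\<in>topspace Y. \<exists>x\<in>topspace X. path_component_of Y (h x) y)"

definition bijective_on_loops :: "nat \<Rightarrow> 'a topology \<Rightarrow> 'b topology \<Rightarrow> ('a \<Rightarrow> 'b) \<Rightarrow> 'a \<Rightarrow> bool" where
  "bijective_on_loops n X Y h x \<longleftrightarrow>
     (\<forall>f g. cube_loop n X x f \<longrightarrow> cube_loop n X x g \<longrightarrow>
        loop_homotopic n Y (h x) (h \<circ> f) (h \<circ> g) \<longrightarrow> loop_homotopic n X x f g) \<and>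
     (\<forall>g. cube_loop n Y (h x) g \<longrightarrow> (\<exists>f. cube_loop n X x f \<and> loop_homotopic n Y (h x) (h \<circ> f) g))"

text \<open>
  Every continuous map is compatible with concatenation on the nose, so only bijectivity is at
  stake.
\<close>

lemma iso_homotopy_group_iff:
  assumes h: "continuous_map X Y h" and n: "0 < n"
  shows "homotopy_group_map n Y h x \<in> iso (homotopy_group n X x) (homotopy_group n Y (h x)) \<longleftrightarrow>
     bijective_on_loops n X Y h x"
proof -
  let ?m = "homotopy_group_map n Y h x"
  let ?c = "homotopy_class n X x" and ?d = "homotopy_class n Y (h x)"
  have m: "?m (?c f) = ?d (h \<circ> f)" if "cube_loop n X x f" for f
    using homotopy_group_map_class[OF h that] .
  have mem: "?m (?c f) \<in> carrier (homotopy_group n Y (h x))" if "cube_loop n X x f" for f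
    using m[OF that] cube_loop_compose[OF that h] by (auto simp: carrier_homotopy_group)
  have "?m \<in> hom (homotopy_group n X x) (homotopy_group n Y (h x))"
  proof (rule homI)
    fix A assume "A \<in> carrier (homotopy_group n X x)"
    then show "?m A \<in> carrier (homotopy_group n Y (h x))"
      using mem by (auto simp: carrier_homotopy_group)
  next
    fix A B assume "A \<in> carrier (homotopy_group n X x)" "B \<in> carrier (homotopy_group n X x)"
    then obtain f g where f: "cube_loop n X x f" "A = ?c f" and g: "cube_loop n X x g" "B = ?c g"
      by (auto simp: carrier_homotopy_group)
    have "cube_loop n X x (cube_concat f g)"
      using loop_homotopic_concat[OF n loop_homotopic_refl[OF f(1)] loop_homotopic_refl[OF g(1)]]
        by (rule loop_homotopic_imp_cube_loop[THEN conjunct1])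
    then show "?m (A \<otimes>\<^bsub>homotopy_group n X x\<^esub> B) = ?m A \<otimes>\<^bsub>homotopy_group n Y (h x)\<^esub> ?m B"
      using f g n by (simp add: mult_homotopy_group m cube_loop_compose[OF _ h] cube_concat_compose)
  qed
  moreover have "inj_on ?m (carrier (homotopy_group n X x)) \<longleftrightarrow>
     (\<forall>f g. cube_loop n X x f \<longrightarrow> cube_loop n X x g \<longrightarrow>
        loop_homotopic n Y (h x) (h \<circ> f) (h \<circ> g) \<longrightarrow> loop_homotopic n X x f g)" (is "?L \<longleftrightarrow> ?R")
  proof -
    have "?L \<longleftrightarrow> (\<forall>f g. cube_loop n X x f \<longrightarrow> cube_loop n X x g \<longrightarrow> ?m (?c f) = ?m (?c g) \<longrightarrow> ?c f = ?c g)"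
      unfolding inj_on_def carrier_homotopy_group by blast
    moreover have "?m (?c f) = ?m (?c g) \<longleftrightarrow> loop_homotopic n Y (h x) (h \<circ> f) (h \<circ> g)"
      if "cube_loop n X x f" "cube_loop n X x g" for f g
      unfolding m[OF that(1)] m[OF that(2)] by (rule homotopy_class_eq_iff[OF cube_loop_compose[OF that(1) h]])
    moreover have "?c f = ?c g \<longleftrightarrow> loop_homotopic n X x f g" if "cube_loop n X x f" for f g
      using that by (rule homotopy_class_eq_iff)
    ultimately show ?thesis by simp
  qed
  moreover have "?m ` carrier (homotopy_group n X x) = carrier (homotopy_group n Y (h x)) \<longleftrightarrow>
     (\<forall>g. cube_loop n Y (h x) g \<longrightarrow> (\<exists>f. cube_loop n X x f \<and> loop_homotopic n Y (h x) (h \<circ> f) g))"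
     (is "?L \<longleftrightarrow> ?R")
  proof -
    have "?L \<longleftrightarrow> carrier (homotopy_group n Y (h x)) \<subseteq> ?m ` carrier (homotopy_group n X x)"
      using mem by (auto simp: carrier_homotopy_group)
    also have "\<dots> \<longleftrightarrow> (\<forall>g. cube_loop n Y (h x) g \<longrightarrow> (\<exists>f. cube_loop n X x f \<and> ?d g = ?m (?c f)))"
      unfolding carrier_homotopy_group by blast
    also have "\<dots> \<longleftrightarrow> ?R"
    proof -
      have "?d g = ?m (?c f) \<longleftrightarrow> loop_homotopic n Y (h x) (h \<circ> f) g" if "cube_loop n X x f" for f g
        unfolding m[OF that] using homotopy_class_eq_iff[OF cube_loop_compose[OF that h]] by (simp only: eq_commute)
      then show ?thesis by (simp cong: conj_cong)
    qed
    finally show ?thesis .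
  qed
  ultimately show ?thesis
    unfolding iso_def bijective_on_loops_def bij_betw_def by blast
qed

lemma bij_betw_path_components_iff:
  assumes h: "continuous_map X Y h"
  shows "bij_betw (path_components_map Y h) (path_components_of X) (path_components_of Y) \<longleftrightarrow>
     bijective_on_components X Y h"
proof -
  let ?m = "path_components_map Y h"
  let ?c = "path_component_of_set X" and ?d = "path_component_of_set Y"
  have hY: "h x \<in> topspace Y" if "x \<in> topspace X" for x
    using h that by (auto simp: continuous_map_def)
  have push: "path_component_of Y (h x) (h x')" if "path_component_of X x x'" for x x'
    using that h unfolding path_component_of_def by (metis comp_apply pathin_compose)
  have ceq: "?c x = ?c x' \<longleftrightarrow> path_component_of X x x'" if "x \<in> topspace X" for x x'
    using that path_component_of_eq[of X x x'] path_component_in_topspace[of X x x'] by auto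
  have deq: "?d y = ?d y' \<longleftrightarrow> path_component_of Y y y'" if "y \<in> topspace Y" for y y'
    using that path_component_of_eq[of Y y y'] path_component_in_topspace[of Y y y'] by auto
  have m: "?m (?c x) = ?d (h x)" if x: "x \<in> topspace X" for x
  proof -
    have "?d (h x') = ?d (h x)" if "x' \<in> ?c x" for x'
      using that push deq[OF hY[OF x]] by auto
    moreover have "x \<in> ?c x" using x by (simp add: path_component_of_refl)
    ultimately show ?thesis unfolding path_components_map_def by blast
  qed
  have "inj_on ?m (path_components_of X) \<longleftrightarrow>
     (\<forall>x\<in>topspace X. \<forall>x'\<in>topspace X. ?m (?c x) = ?m (?c x') \<longrightarrow> ?c x = ?c x')"
    unfolding inj_on_def path_components_of_def by blast
  also have "\<dots> \<longleftrightarrow> (\<forall>x\<in>topspace X. \<forall>x'\<in>topspace X. path_component_of Y (h x) (h x') \<longrightarrow> path_component_of X x x')"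
    using m ceq deq[OF hY] by metis
  finally have 1: "inj_on ?m (path_components_of X) \<longleftrightarrow> \<dots>" .
  have "?m ` path_components_of X = path_components_of Y \<longleftrightarrow> path_components_of Y \<subseteq> ?m ` path_components_of X"
    using m hY by (auto simp: path_components_of_def)
  also have "\<dots> \<longleftrightarrow> (\<forall>y\<in>topspace Y. \<exists>x\<in>topspace X. ?d y = ?m (?c x))"
    unfolding path_components_of_def by blast
  also have "\<dots> \<longleftrightarrow> (\<forall>y\<in>topspace Y. \<exists>x\<in>topspace X. path_component_of Y (h x) y)"
    using m deq[OF hY] by metis
  finally show ?thesis using 1 unfolding bij_betw_def bijective_on_components_def by blast
qed

lemma weak_homotopy_equivalence_iff:
  "weak_homotopy_equivalence X Y h \<longleftrightarrow> continuous_map X Y h \<and> bijective_on_components X Y h \<and>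
     (\<forall>n>0. \<forall>x\<in>topspace X. bijective_on_loops n X Y h x)"
  unfolding weak_homotopy_equivalence_def
  by (cases "continuous_map X Y h") (simp_all add: bij_betw_path_components_iff iso_homotopy_group_iff)

section \<open>Transport of cube maps along paths\<close>

lemma pathin_reverse: "pathin X \<gamma> \<Longrightarrow> pathin X (\<lambda>u. \<gamma> (1 - u))"
proof -
  assume g: "pathin X \<gamma>"
  have "continuous_map unit_interval unit_interval (\<lambda>u. 1 - u)"
    by (intro continuous_map_into_subtopology continuous_intros) auto
  then have "continuous_map unit_interval X (\<gamma> \<circ> (\<lambda>u. 1 - u))"
    using g unfolding pathin_def by (rule continuous_map_compose)
  then show ?thesis by (simp add: pathin_def o_def)
qed

lemma continuous_map_Max:
  fixes f :: "'i \<Rightarrow> 'a \<Rightarrow> real"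
  assumes "finite I" "I \<noteq> {}" "\<And>i. i \<in> I \<Longrightarrow> continuous_map X euclideanreal (f i)"
  shows "continuous_map X euclideanreal (\<lambda>x. Max ((\<lambda>i. f i x) ` I))"
  using assms
proof (induction I rule: finite_ne_induct)
  case (insert i I)
  then have "continuous_map X euclideanreal (\<lambda>x. max (f i x) (Max ((\<lambda>i. f i x) ` I)))"
    by (intro continuous_map_real_max) auto
  then show ?case using insert.hyps by simp
qed simp

text \<open>
  Let \<open>I\<^sup>n\<close> be the unit cube. Stretch the cube about its centre by the factor \<open>1 + u\<close>. A point that
  leaves \<open>I\<^sup>n\<close> is clamped to \<open>\<partial>I\<^sup>n\<close>, and \<open>overshoot\<close>, which is at most \<open>u\<close>, measures by how much it
  left; it is negative inside. Thus \<open>(u, t) \<mapsto> (max 0 (overshoot n u t), stretch n u t)\<close> maps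
  \<open>I \<times> I\<^sup>n\<close> to \<open>0 \<times> I\<^sup>n \<union> I \<times> \<partial>I\<^sup>n\<close>. It is the identity on \<open>0 \<times> I\<^sup>n\<close> and keeps the first coordinate on
  \<open>I \<times> \<partial>I\<^sup>n\<close>, so it does the work of a retraction for data that on \<open>I \<times> \<partial>I\<^sup>n\<close> depend on the first
  coordinate alone.
\<close>

definition stretch :: "nat \<Rightarrow> real \<Rightarrow> (nat \<Rightarrow> real) \<Rightarrow> nat \<Rightarrow> real" where
  "stretch n u t = restrict (\<lambda>i. max 0 (min 1 ((1 + u) * (t i - 1/2) + 1/2))) {..<n}"

definition overshoot :: "nat \<Rightarrow> real \<Rightarrow> (nat \<Rightarrow> real) \<Rightarrow> real" where
  "overshoot n u t = Max ((\<lambda>i. (1 + u) * \<bar>2 * t i - 1\<bar> - 1) ` {..<n})"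

lemma stretch_in_cube: "stretch n u t \<in> topspace (cube n)"
  by (auto simp: stretch_def)

lemma continuous_map_stretch:
  assumes u: "continuous_map W unit_interval u" and t: "continuous_map W (cube n) t"
  shows "continuous_map W (cube n) (\<lambda>w. stretch n (u w) (t w))"
  unfolding continuous_map_componentwise
proof (intro conjI ballI)
  fix i assume i: "i \<in> {..<n}"
  have "continuous_map W unit_interval (\<lambda>w. max 0 (min 1 ((1 + u w) * (t w i - 1/2) + 1/2)))"
  proof (rule continuous_map_into_subtopology)
    show "continuous_map W euclideanreal (\<lambda>w. max 0 (min 1 ((1 + u w) * (t w i - 1/2) + 1/2)))"
      using i continuous_map_into_fulltopology[OF u]
      by (intro continuous_intros continuous_map_cube_coordinate[OF t]) auto
  qed auto
  then show "continuous_map W unit_interval (\<lambda>w. stretch n (u w) (t w) i)"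
    using i by (simp add: stretch_def)
qed (auto simp: stretch_def)

lemma continuous_map_overshoot:
  assumes "0 < n" and u: "continuous_map W unit_interval u" and t: "continuous_map W (cube n) t"
  shows "continuous_map W euclideanreal (\<lambda>w. overshoot n (u w) (t w))"
  unfolding overshoot_def
  using assms(1) continuous_map_into_fulltopology[OF u]
  by (intro continuous_map_Max continuous_intros continuous_map_cube_coordinate[OF t]) auto

lemma overshoot_le:
  assumes n: "0 < n" and u: "0 \<le> u" and t: "t \<in> topspace (cube n)"
  shows "overshoot n u t \<le> u"
proof -
  have "(1 + u) * \<bar>2 * t i - 1\<bar> - 1 \<le> u" if "i < n" for i
  proof -
    have "t i \<in> {0..1}" using t that by (auto simp: PiE_iff)
    then have "\<bar>2 * t i - 1\<bar> \<le> 1" by auto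
    then have "(1 + u) * \<bar>2 * t i - 1\<bar> \<le> (1 + u) * 1" using u by (intro mult_left_mono) auto
    then show ?thesis by simp
  qed
  moreover have "{..<n} \<noteq> {}" using n by auto
  ultimately show ?thesis unfolding overshoot_def by (subst Max_le_iff) auto
qed

lemma stretch_on_boundary:
  assumes n: "0 < n" and u: "0 \<le> u" and o: "0 \<le> overshoot n u t"
  shows "stretch n u t \<in> cube_boundary n"
proof -
  have "overshoot n u t \<in> (\<lambda>i. (1 + u) * \<bar>2 * t i - 1\<bar> - 1) ` {..<n}"
    unfolding overshoot_def using n by (intro Max_in) auto
  then obtain i where i: "i < n" "0 \<le> (1 + u) * \<bar>2 * t i - 1\<bar> - 1" using o by auto
  have "stretch n u t i = 0 \<or> stretch n u t i = 1"
  proof (cases "0 \<le> 2 * t i - 1")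
    case True
    then have "1 \<le> (1 + u) * (t i - 1/2) + 1/2" using i(2) by (simp add: field_simps)
    then show ?thesis using i(1) by (simp add: stretch_def)
  next
    case False
    then have "(1 + u) * (t i - 1/2) + 1/2 \<le> 0" using i(2) by (simp add: field_simps)
    then show ?thesis using i(1) by (simp add: stretch_def)
  qed
  then show ?thesis using i(1) stretch_in_cube[of n u t] unfolding cube_boundary_def by blast
qed

lemma overshoot_boundary:
  assumes u: "0 \<le> u" and t: "t \<in> cube_boundary n"
  shows "overshoot n u t = u"
proof -
  obtain i where i: "i < n" "t i = 0 \<or> t i = 1" and tc: "t \<in> topspace (cube n)"
    using t by (auto simp: cube_boundary_def)
  have "u = (1 + u) * \<bar>2 * t i - 1\<bar> - 1" using i(2) by auto
  then have "u \<in> (\<lambda>i. (1 + u) * \<bar>2 * t i - 1\<bar> - 1) ` {..<n}" using i(1) by blast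
  then have "u \<le> overshoot n u t" unfolding overshoot_def by (intro Max_ge) auto
  then show ?thesis using overshoot_le[of n u t] i(1) u tc by auto
qed

lemma stretch_0: "t \<in> topspace (cube n) \<Longrightarrow> stretch n 0 t = t"
  by (auto simp: stretch_def fun_eq_iff PiE_iff extensional_def)

definition homotopic_along :: "nat \<Rightarrow> 'a topology \<Rightarrow> (real \<Rightarrow> 'a) \<Rightarrow> ((nat \<Rightarrow> real) \<Rightarrow> 'a) \<Rightarrow>
    ((nat \<Rightarrow> real) \<Rightarrow> 'a) \<Rightarrow> bool" where
  "homotopic_along n X \<gamma> f g \<longleftrightarrow> pathin X \<gamma> \<and>
     (\<exists>H. continuous_map (prod_topology unit_interval (cube n)) X H \<and>
        (\<forall>t\<in>topspace (cube n). H (0, t) = f t \<and> H (1, t) = g t) \<and>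
        (\<forall>u\<in>{0..1}. \<forall>t\<in>cube_boundary n. H (u, t) = \<gamma> u))"

lemma homotopic_along_reverse:
  assumes "homotopic_along n X \<gamma> f g"
  shows "homotopic_along n X (\<lambda>u. \<gamma> (1 - u)) g f"
proof -
  obtain H where \<gamma>: "pathin X \<gamma>" and H: "continuous_map (prod_topology unit_interval (cube n)) X H"
    "\<forall>t\<in>topspace (cube n). H (0, t) = f t \<and> H (1, t) = g t"
    "\<forall>u\<in>{0..1}. \<forall>t\<in>cube_boundary n. H (u, t) = \<gamma> u"
    using assms unfolding homotopic_along_def by blast
  have "continuous_map unit_interval unit_interval (\<lambda>u. 1 - u)"
    by (intro continuous_map_into_subtopology continuous_intros) auto
  then have "continuous_map (prod_topology unit_interval (cube n)) (prod_topology unit_interval (cube n))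
      (\<lambda>(u, t). (1 - u, t))"
    by (simp add: continuous_map_prod_top)
  then have "continuous_map (prod_topology unit_interval (cube n)) X (H \<circ> (\<lambda>(u, t). (1 - u, t)))"
    using H(1) by (rule continuous_map_compose)
  then show ?thesis
    unfolding homotopic_along_def using pathin_reverse[OF \<gamma>] H(2,3)
    by (intro conjI exI[of _ "H \<circ> (\<lambda>(u, t). (1 - u, t))"]) auto
qed

text \<open>
  Used with \<open>p\<close> the overshoot: it may be negative, which makes both pieces of the case distinction
  closed.
\<close>

lemma continuous_map_glue_path:
  assumes \<gamma>: "pathin X \<gamma>" and p: "continuous_map W euclideanreal p"
    and p1: "\<And>w. w \<in> topspace W \<Longrightarrow> p w \<le> 1"
    and f: "continuous_map W X f" and glue: "\<And>w. w \<in> topspace W \<Longrightarrow> p w = 0 \<Longrightarrow> f w = \<gamma> 0"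
  shows "continuous_map W X (\<lambda>w. if p w \<le> 0 then f w else \<gamma> (p w))"
proof (rule continuous_map_cases_le)
  show "continuous_map (subtopology W {w \<in> topspace W. p w \<le> 0}) X f"
    using f by (rule continuous_map_from_subtopology)
  have "continuous_map (subtopology W {w \<in> topspace W. 0 \<le> p w}) unit_interval p"
    using p1 by (intro continuous_map_into_subtopology continuous_map_from_subtopology p) auto
  then have "continuous_map (subtopology W {w \<in> topspace W. 0 \<le> p w}) X (\<gamma> \<circ> p)"
    using \<gamma> unfolding pathin_def by (rule continuous_map_compose)
  then show "continuous_map (subtopology W {w \<in> topspace W. 0 \<le> p w}) X (\<lambda>w. \<gamma> (p w))"
    by (simp add: o_def)
qed (use p glue in auto)

text \<open>
  Homotopy extension: compose the map given by \<open>f\<close> on \<open>0 \<times> I\<^sup>n\<close> and by \<open>\<gamma>\<close> on \<open>I \<times> \<partial>I\<^sup>n\<close> with the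
  map described at \<open>stretch\<close>.
\<close>

lemma homotopic_along_exists:
  assumes n: "0 < n" and \<gamma>: "pathin X \<gamma>" and f: "cube_loop n X (\<gamma> 0) f"
  shows "\<exists>g. cube_loop n X (\<gamma> 1) g \<and> homotopic_along n X \<gamma> f g"
proof -
  let ?P = "prod_topology unit_interval (cube n)"
  let ?H = "\<lambda>p. if overshoot n (fst p) (snd p) \<le> 0 then (f \<circ> (\<lambda>p. stretch n (fst p) (snd p))) p
      else \<gamma> (overshoot n (fst p) (snd p))"
  have c: "continuous_map ?P X ?H"
  proof (rule continuous_map_glue_path[OF \<gamma>])
    show "continuous_map ?P euclideanreal (\<lambda>p. overshoot n (fst p) (snd p))"
      by (intro continuous_map_overshoot n continuous_map_fst continuous_map_snd)
    show "continuous_map ?P X (f \<circ> (\<lambda>p. stretch n (fst p) (snd p)))"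
      using f unfolding cube_loop_def
      by (intro continuous_map_compose[of _ "cube n"] continuous_map_stretch continuous_map_fst continuous_map_snd) auto
  next
    fix p assume p: "p \<in> topspace ?P"
    then have u: "0 \<le> fst p" "fst p \<le> 1" and t: "snd p \<in> topspace (cube n)" by (auto simp: mem_Times_iff)
    show "overshoot n (fst p) (snd p) \<le> 1"
      using overshoot_le[OF n u(1) t] u by simp
    show "(f \<circ> (\<lambda>p. stretch n (fst p) (snd p))) p = \<gamma> 0" if "overshoot n (fst p) (snd p) = 0"
      using stretch_on_boundary[OF n u(1)] that f by (simp add: cube_loop_def)
  qed
  have H0: "?H (0, t) = f t" if "t \<in> topspace (cube n)" for t
    using overshoot_le[OF n _ that, of 0] stretch_0[OF that] by simp
  have Hb: "?H (u, t) = \<gamma> u" if "u \<in> {0..1}" "t \<in> cube_boundary n" for u t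
    using that overshoot_boundary[of u t n] stretch_on_boundary[OF n, of u t] f
    by (auto simp: cube_loop_def)
  let ?g = "\<lambda>t. ?H (1, t)"
  have "continuous_map (cube n) X (?H \<circ> Pair 1)"
    by (rule continuous_map_o_Pair[OF c]) simp
  then have "cube_loop n X (\<gamma> 1) ?g"
    using Hb[of 1] unfolding cube_loop_def by (simp add: o_def)
  moreover have "homotopic_along n X \<gamma> f ?g"
    unfolding homotopic_along_def using \<gamma> c H0 Hb by (intro conjI exI[of _ ?H]) auto
  ultimately show ?thesis by blast
qed

lemma continuous_map_unit_interval_max:
  assumes "continuous_map W unit_interval u" "continuous_map W euclideanreal p"
    "\<And>w. w \<in> topspace W \<Longrightarrow> p w \<le> 1"
  shows "continuous_map W unit_interval (\<lambda>w. max (u w) (p w))"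
  using assms unfolding continuous_map_in_subtopology
  by (auto intro!: continuous_intros simp: Pi_iff le_max_iff_disj)

text \<open>
  The end \<open>b\<close> of a homotopy along \<open>\<gamma>\<close> is determined up to homotopy by \<open>a\<close> and \<open>\<gamma>\<close>: it is \<open>a\<close> on the
  inner cube followed by \<open>\<gamma>\<close> on the shells around it. To see this, evaluate the homotopy \<open>H\<close> on the
  stretched cube at time \<open>max v (overshoot n 1 t)\<close> and let \<open>v\<close> run from 0 to 1. At \<open>v = 0\<close> the inner
  part shows \<open>a\<close>, and a shell, being clamped to the boundary, shows \<open>\<gamma>\<close>; at \<open>v = 1\<close> only \<open>b\<close> is left,
  precomposed with a stretching that is undone by letting its factor return to 1.
\<close>

lemma homotopic_along_imp_path_action:
  assumes n: "0 < n" and H: "homotopic_along n X \<gamma> a b"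
  shows "loop_homotopic n X (\<gamma> 1)
     (\<lambda>t. if overshoot n 1 t \<le> 0 then a (stretch n 1 t) else \<gamma> (overshoot n 1 t)) b"
proof -
  let ?P = "prod_topology unit_interval (cube n)"
  let ?c = "\<lambda>t. if overshoot n 1 t \<le> 0 then a (stretch n 1 t) else \<gamma> (overshoot n 1 t)"
  obtain H where \<gamma>: "pathin X \<gamma>" and H: "continuous_map ?P X H"
    "\<And>t. t \<in> topspace (cube n) \<Longrightarrow> H (0, t) = a t"
    "\<And>t. t \<in> topspace (cube n) \<Longrightarrow> H (1, t) = b t"
    "\<And>u t. u \<in> {0..1} \<Longrightarrow> t \<in> cube_boundary n \<Longrightarrow> H (u, t) = \<gamma> u"
    using assms unfolding homotopic_along_def by blast
  \<comment> \<open>the stretching factor is kept at its maximum, so that shells exist at every stage\<close>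
  have one: "continuous_map ?P unit_interval (\<lambda>_. 1)" by simp
  have ov1: "overshoot n 1 t \<le> 1" if "t \<in> topspace (cube n)" for t
    using overshoot_le[OF n _ that] by simp
  let ?K = "\<lambda>p. H (max (fst p) (overshoot n 1 (snd p)), stretch n 1 (snd p))"
  have "continuous_map ?P ?P (\<lambda>p. (max (fst p) (overshoot n 1 (snd p)), stretch n 1 (snd p)))"
    by (intro continuous_map_pairedI continuous_map_unit_interval_max continuous_map_fst
        continuous_map_overshoot[OF n one] continuous_map_stretch[OF one] continuous_map_snd)
       (use ov1 in \<open>auto simp: mem_Times_iff\<close>)
  from continuous_map_compose[OF this H(1)] have K: "continuous_map ?P X ?K"
    by (simp add: o_def)
  have "loop_homotopic n X (\<gamma> 1) ?c (b \<circ> stretch n 1)"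
  proof (rule loop_homotopicI[OF K])
    fix t assume t: "t \<in> topspace (cube n)"
    show "?K (0, t) = ?c t"
    proof (cases "overshoot n 1 t \<le> 0")
      case True
      then show ?thesis using H(2)[OF stretch_in_cube] by (simp add: max_def)
    next
      case False
      then show ?thesis
        using H(4)[OF _ stretch_on_boundary[OF n, of 1 t]] ov1[OF t] by (simp add: max_def)
    qed
    show "?K (1, t) = (b \<circ> stretch n 1) t"
      using H(3)[OF stretch_in_cube] ov1[OF t] by (simp add: max_def)
  next
    fix u :: real and t assume u: "u \<in> {0..1}" and t: "t \<in> cube_boundary n"
    have "overshoot n 1 t = 1" using overshoot_boundary[OF _ t] by simp
    then show "?K (u, t) = \<gamma> 1"
      using u H(4)[of 1, OF _ stretch_on_boundary[OF n, of 1 t]] by (simp add: max_def)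
  qed
  \<comment> \<open>boundary points stay on the boundary while the stretching factor varies\<close>
  moreover have "loop_homotopic n X (\<gamma> 1) b (b \<circ> stretch n 1)"
  proof (rule loop_homotopicI)
    have "continuous_map (cube n) X (H \<circ> Pair 1)"
      by (rule continuous_map_o_Pair[OF H(1)]) simp
    then have "continuous_map (cube n) X b"
      by (rule continuous_map_eq) (simp add: H(3))
    then have "continuous_map ?P X (b \<circ> (\<lambda>p. stretch n (fst p) (snd p)))"
      by (intro continuous_map_compose[of _ "cube n"] continuous_map_stretch continuous_map_fst continuous_map_snd)
    then show "continuous_map ?P X (\<lambda>p. b (stretch n (fst p) (snd p)))"
      by (simp add: o_def)
  next
    fix u :: real and t assume u: "u \<in> {0..1}" and t: "t \<in> cube_boundary n"
    then have s: "stretch n u t \<in> cube_boundary n"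
      using overshoot_boundary[OF _ t, of u] by (intro stretch_on_boundary[OF n]) auto
    then show "b (stretch n (fst (u, t)) (snd (u, t))) = \<gamma> 1"
      using H(3)[OF cube_boundary_subset[OF s]] H(4)[OF _ s, of 1] by simp
  qed (simp_all add: stretch_0)
  ultimately show ?thesis by (blast intro: homotopic_with_trans homotopic_with_symD)
qed

text \<open>
  Both \<open>b\<close> and \<open>b'\<close> are replaced by the normal form just found, to which a homotopy from \<open>a\<close> to \<open>a'\<close>
  applies directly.
\<close>

lemma homotopic_along_respects_loop_homotopy:
  assumes n: "0 < n" and ab: "homotopic_along n X \<gamma> a b" "homotopic_along n X \<gamma> a' b'"
    and aa: "loop_homotopic n X (\<gamma> 0) a a'"
  shows "loop_homotopic n X (\<gamma> 1) b b'"
proof -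
  let ?P = "prod_topology unit_interval (cube n)"
  let ?c = "\<lambda>a t. if overshoot n 1 t \<le> 0 then a (stretch n 1 t) else \<gamma> (overshoot n 1 t)"
  have \<gamma>: "pathin X \<gamma>" using ab unfolding homotopic_along_def by blast
  obtain F where F: "continuous_map ?P X F" "\<And>t. F (0, t) = a t" "\<And>t. F (1, t) = a' t"
    "\<And>u. u \<in> {0..1} \<Longrightarrow> const_on_boundary n (\<gamma> 0) (\<lambda>t. F (u, t))"
    using aa unfolding homotopic_with_def by metis
  have one: "continuous_map ?P unit_interval (\<lambda>_. 1)" by simp
  let ?F = "\<lambda>p. F (fst p, stretch n 1 (snd p))"
  have "continuous_map ?P ?P (\<lambda>p. (fst p, stretch n 1 (snd p)))"
    by (intro continuous_map_pairedI continuous_map_fst continuous_map_stretch[OF one] continuous_map_snd)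
  from continuous_map_compose[OF this F(1)] have F': "continuous_map ?P X ?F"
    by (simp add: o_def)
  have "loop_homotopic n X (\<gamma> 1) (?c a) (?c a')"
  proof (rule loop_homotopicI)
    show "continuous_map ?P X (\<lambda>p. if overshoot n 1 (snd p) \<le> 0 then ?F p else \<gamma> (overshoot n 1 (snd p)))"
    proof (rule continuous_map_glue_path[OF \<gamma> _ _ F'])
      show "continuous_map ?P euclideanreal (\<lambda>p. overshoot n 1 (snd p))"
        by (intro continuous_map_overshoot[OF n one] continuous_map_snd)
      fix p assume p: "p \<in> topspace ?P"
      then have t: "snd p \<in> topspace (cube n)" and u: "fst p \<in> {0..1}" by (auto simp: mem_Times_iff)
      show "overshoot n 1 (snd p) \<le> 1" using overshoot_le[OF n _ t] by simp
      show "?F p = \<gamma> 0" if "overshoot n 1 (snd p) = 0"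
        using F(4)[OF u] stretch_on_boundary[OF n, of 1 "snd p"] that by simp
    qed
    fix u :: real and t assume "u \<in> {0..1}" and t: "t \<in> cube_boundary n"
    show "(if overshoot n 1 (snd (u, t)) \<le> 0 then ?F (u, t) else \<gamma> (overshoot n 1 (snd (u, t)))) = \<gamma> 1"
      using overshoot_boundary[OF _ t, of 1] by simp
  qed (simp_all add: F)
  then show ?thesis
    using homotopic_along_imp_path_action[OF n ab(1)] homotopic_along_imp_path_action[OF n ab(2)]
    by (blast intro: homotopic_with_trans homotopic_with_symD)
qed

section \<open>Homotopy equivalences are weak homotopy equivalences\<close>

lemma homotopic_with_TrueI:
  assumes "continuous_map (prod_topology unit_interval X) Y H"
    and "\<And>x. x \<in> topspace X \<Longrightarrow> H (0, x) = f x" "\<And>x. x \<in> topspace X \<Longrightarrow> H (1, x) = g x"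
  shows "homotopic_with (\<lambda>_. True) X Y f g"
  using assms by (subst homotopic_with) auto

text \<open>
  A homotopy \<open>G\<close> from the identity to \<open>k\<close> moves \<open>x\<close> along \<open>\<gamma> = G(_, x)\<close>, and every \<open>f\<close> at \<open>x\<close> is
  homotopic along \<open>\<gamma>\<close> to \<open>k f\<close>. So \<open>k\<close> acts on \<open>\<pi>\<^sub>n\<close> as transport along \<open>\<gamma>\<close>, with inverse the
  transport along the reversed path.
\<close>

lemma homotopic_to_identity_bijective:
  assumes k: "homotopic_with (\<lambda>_. True) X X id k"
  shows "bijective_on_components X X k"
    and "0 < n \<Longrightarrow> x \<in> topspace X \<Longrightarrow> bijective_on_loops n X X k x"
proof -
  obtain G where G: "continuous_map (prod_topology unit_interval X) X G"
    "\<And>x. G (0, x) = x" "\<And>x. G (1, x) = k x"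
    using k unfolding homotopic_with_def by (metis id_apply)
  have path: "pathin X (\<lambda>u. G (u, x))" if "x \<in> topspace X" for x
  proof -
    have "continuous_map unit_interval (prod_topology unit_interval X) (\<lambda>u. (u, x))"
      using that by (intro continuous_map_pairedI) auto
    from continuous_map_compose[OF this G(1)] show ?thesis by (simp add: pathin_def o_def)
  qed
  have pc: "path_component_of X x (k x)" if "x \<in> topspace X" for x
    using path[OF that] G(2,3) unfolding path_component_of_def by blast
  show "bijective_on_components X X k"
    unfolding bijective_on_components_def
    using pc by (meson path_component_of_sym path_component_of_trans)
  assume n: "0 < n" and x: "x \<in> topspace X"
  let ?\<gamma> = "\<lambda>u. G (u, x)"
  have along: "homotopic_along n X ?\<gamma> f (k \<circ> f)" if f: "cube_loop n X x f" for f
  proof -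
    have "continuous_map (prod_topology unit_interval (cube n)) (prod_topology unit_interval X) (\<lambda>(u, t). (u, f t))"
      using f by (simp add: continuous_map_prod_top cube_loop_def)
    then have "continuous_map (prod_topology unit_interval (cube n)) X (G \<circ> (\<lambda>(u, t). (u, f t)))"
      using G(1) by (rule continuous_map_compose)
    then show ?thesis
      unfolding homotopic_along_def using path[OF x] G f
      by (intro conjI exI[of _ "G \<circ> (\<lambda>(u, t). (u, f t))"]) (auto simp: cube_loop_def)
  qed
  show "bijective_on_loops n X X k x"
    unfolding bijective_on_loops_def
  proof (intro conjI allI impI)
    fix f g assume f: "cube_loop n X x f" and g: "cube_loop n X x g"
      and "loop_homotopic n X (k x) (k \<circ> f) (k \<circ> g)"
    then have "loop_homotopic n X (?\<gamma> (1 - 0)) (k \<circ> f) (k \<circ> g)" by (simp add: G)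
    then have "loop_homotopic n X (?\<gamma> (1 - 1)) f g"
      by (intro homotopic_along_respects_loop_homotopy[OF n homotopic_along_reverse[OF along[OF f]]
          homotopic_along_reverse[OF along[OF g]]])
    then show "loop_homotopic n X x f g" by (simp add: G)
  next
    fix g assume g: "cube_loop n X (k x) g"
    have "pathin X (\<lambda>u. ?\<gamma> (1 - u))" using pathin_reverse[OF path[OF x]] .
    moreover have "cube_loop n X ((\<lambda>u. ?\<gamma> (1 - u)) 0) g" using g by (simp add: G)
    ultimately obtain f where "cube_loop n X ((\<lambda>u. ?\<gamma> (1 - u)) 1) f"
      and gf: "homotopic_along n X (\<lambda>u. ?\<gamma> (1 - u)) g f"
      using homotopic_along_exists[OF n] by blast
    then have f: "cube_loop n X x f" by (simp add: G)
    \<comment> \<open>\<open>f\<close> transports to \<open>g\<close>, but also to \<open>k f\<close>\<close>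
    have fg: "homotopic_along n X ?\<gamma> f g"
      using homotopic_along_reverse[OF gf] by simp
    have "loop_homotopic n X (?\<gamma> 0) f f" using loop_homotopic_refl[OF f] by (simp add: G)
    then have "loop_homotopic n X (?\<gamma> 1) (k \<circ> f) g"
      by (rule homotopic_along_respects_loop_homotopy[OF n along[OF f] fg])
    then show "\<exists>f. cube_loop n X x f \<and> loop_homotopic n X (k x) (k \<circ> f) g"
      using f by (auto simp: G)
  qed
qed

text \<open>
  Both composites are bijective by the previous lemma. For surjectivity of \<open>\<phi>\<close> at \<open>g\<close>, bijectivity of
  \<open>s \<phi>\<close> at \<open>x\<close> gives \<open>f\<close> with \<open>s \<phi> f\<close> homotopic to \<open>s g\<close>, and bijectivity of \<open>\<phi> s\<close> at \<open>\<phi> x\<close> cancels \<open>s\<close>.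
\<close>

lemma homotopy_equivalence_imp_weak_homotopy_equivalence:
  assumes \<phi>: "continuous_map X R \<phi>" and s: "continuous_map R X s"
    and sp: "homotopic_with (\<lambda>_. True) X X id (s \<circ> \<phi>)"
    and ps: "homotopic_with (\<lambda>_. True) R R id (\<phi> \<circ> s)"
  shows "weak_homotopy_equivalence X R \<phi>"
  unfolding weak_homotopy_equivalence_iff
proof (intro conjI allI impI ballI \<phi>)
  have push: "path_component_of X (s y) (s y')" if "path_component_of R y y'" for y y'
    using that s unfolding path_component_of_def by (metis comp_apply pathin_compose)
  have sR: "s y \<in> topspace X" if "y \<in> topspace R" for y
    using s that by (auto simp: continuous_map_def)
  note c1 = homotopic_to_identity_bijective(1)[OF sp] and c2 = homotopic_to_identity_bijective(1)[OF ps]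
  show "bijective_on_components X R \<phi>"
    unfolding bijective_on_components_def
  proof (intro conjI ballI impI)
    fix x x' assume "x \<in> topspace X" "x' \<in> topspace X" "path_component_of R (\<phi> x) (\<phi> x')"
    then show "path_component_of X x x'"
      using push c1 unfolding bijective_on_components_def by simp
  next
    fix y assume "y \<in> topspace R"
    then obtain y' where "y' \<in> topspace R" "path_component_of R ((\<phi> \<circ> s) y') y"
      using c2 unfolding bijective_on_components_def by blast
    then show "\<exists>x\<in>topspace X. path_component_of R (\<phi> x) y" using sR by auto
  qed
  fix n :: nat and x assume n: "0 < n" and x: "x \<in> topspace X"
  have \<phi>x: "\<phi> x \<in> topspace R" using \<phi> x by (auto simp: continuous_map_def)
  note l1 = homotopic_to_identity_bijective(2)[OF sp n x]
    and l2 = homotopic_to_identity_bijective(2)[OF ps n \<phi>x]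
  show "bijective_on_loops n X R \<phi> x"
    unfolding bijective_on_loops_def
  proof (intro conjI allI impI)
    fix f g assume fg: "cube_loop n X x f" "cube_loop n X x g" "loop_homotopic n R (\<phi> x) (\<phi> \<circ> f) (\<phi> \<circ> g)"
    have "loop_homotopic n X ((s \<circ> \<phi>) x) ((s \<circ> \<phi>) \<circ> f) ((s \<circ> \<phi>) \<circ> g)"
      using loop_homotopic_compose[OF fg(3) s] by (simp add: comp_assoc)
    then show "loop_homotopic n X x f g"
      using l1 fg(1,2) unfolding bijective_on_loops_def by blast
  next
    fix g assume g: "cube_loop n R (\<phi> x) g"
    have "cube_loop n X ((s \<circ> \<phi>) x) (s \<circ> g)"
      using cube_loop_compose[OF g s] by simp
    then obtain f where f: "cube_loop n X x f" "loop_homotopic n X ((s \<circ> \<phi>) x) ((s \<circ> \<phi>) \<circ> f) (s \<circ> g)"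
      using l1 unfolding bijective_on_loops_def by blast
    have "loop_homotopic n R ((\<phi> \<circ> s) (\<phi> x)) ((\<phi> \<circ> s) \<circ> (\<phi> \<circ> f)) ((\<phi> \<circ> s) \<circ> g)"
      using loop_homotopic_compose[OF f(2) \<phi>] by (simp add: comp_assoc)
    moreover have "cube_loop n R (\<phi> x) (\<phi> \<circ> f)" using cube_loop_compose[OF f(1) \<phi>] .
    ultimately have "loop_homotopic n R (\<phi> x) (\<phi> \<circ> f) g"
      using l2 g unfolding bijective_on_loops_def by blast
    then show "\<exists>f. cube_loop n X x f \<and> loop_homotopic n R (\<phi> x) (\<phi> \<circ> f) g" using f(1) by blast
  qed
qed

text \<open>
  Two of three, in the easy case: all base points in question are images of points of \<open>X\<close>, so none
  has to be moved, and \<open>p'\<close> can be cancelled from the left.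
\<close>

lemma weak_homotopy_equivalence_cancel_square:
  assumes p: "weak_homotopy_equivalence X R p" and k: "weak_homotopy_equivalence R R' k"
    and p': "weak_homotopy_equivalence X' R' p'" and h: "continuous_map X X' h"
    and sq: "\<And>x. x \<in> topspace X \<Longrightarrow> p' (h x) = k (p x)"
  shows "weak_homotopy_equivalence X X' h"
  unfolding weak_homotopy_equivalence_iff
proof (intro conjI allI impI ballI h)
  have pc: "continuous_map X R p" and kc: "continuous_map R R' k" and pc': "continuous_map X' R' p'"
    using p k p' by (simp_all add: weak_homotopy_equivalence_iff)
  have push: "path_component_of R' (p' y) (p' y')" if "path_component_of X' y y'" for y y'
    using that pc' unfolding path_component_of_def by (metis comp_apply pathin_compose)
  have push2: "path_component_of R' (k y) (k y')" if "path_component_of R y y'" for y y'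
    using that kc unfolding path_component_of_def by (metis comp_apply pathin_compose)
  have pX: "p x \<in> topspace R" "h x \<in> topspace X'" if "x \<in> topspace X" for x
    using that pc h by (auto simp: continuous_map_def)
  show "bijective_on_components X X' h"
    unfolding bijective_on_components_def
  proof (intro conjI ballI impI)
    fix x x' assume x: "x \<in> topspace X" "x' \<in> topspace X" "path_component_of X' (h x) (h x')"
    then have "path_component_of R' (k (p x)) (k (p x'))" using push[OF x(3)] sq by simp
    then have "path_component_of R (p x) (p x')"
      using k x pX unfolding weak_homotopy_equivalence_iff bijective_on_components_def by blast
    then show "path_component_of X x x'"
      using p x unfolding weak_homotopy_equivalence_iff bijective_on_components_def by blast
  next
    fix y assume y: "y \<in> topspace X'"
    then have "p' y \<in> topspace R'" using pc' by (auto simp: continuous_map_def)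
    then obtain r where r: "r \<in> topspace R" "path_component_of R' (k r) (p' y)"
      using k unfolding weak_homotopy_equivalence_iff bijective_on_components_def by blast
    then obtain x where x: "x \<in> topspace X" "path_component_of R (p x) r"
      using p unfolding weak_homotopy_equivalence_iff bijective_on_components_def by blast
    have "path_component_of R' (p' (h x)) (p' y)"
      using path_component_of_trans[OF push2[OF x(2)] r(2)] sq[OF x(1)] by simp
    then have "path_component_of X' (h x) y"
      using p' y pX[OF x(1)] unfolding weak_homotopy_equivalence_iff bijective_on_components_def by blast
    then show "\<exists>x\<in>topspace X. path_component_of X' (h x) y" using x(1) by blast
  qed
  fix n :: nat and x assume n: "0 < n" and x: "x \<in> topspace X"
  have bp: "bijective_on_loops n X R p x" and bk: "bijective_on_loops n R R' k (p x)"
    and bp': "bijective_on_loops n X' R' p' (h x)"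
    using p k p' n x pX[OF x] unfolding weak_homotopy_equivalence_iff by blast+
  have sq': "loop_homotopic n R' (k (p x)) (p' \<circ> (h \<circ> f)) (k \<circ> (p \<circ> f))" if f: "cube_loop n X x f" for f
  proof (rule homotopic_with_eq)
    show "loop_homotopic n R' (k (p x)) (k \<circ> (p \<circ> f)) (k \<circ> (p \<circ> f))"
      using f pc kc by (intro loop_homotopic_refl cube_loop_compose)
    show "(p' \<circ> (h \<circ> f)) t = (k \<circ> (p \<circ> f)) t" if "t \<in> topspace (cube n)" for t
    proof -
      have "f t \<in> topspace X"
        using f that unfolding cube_loop_def by (metis continuous_map_funspace funcset_mem)
      then show ?thesis using sq by simp
    qed
  qed (use cube_boundary_subset in \<open>auto simp: Ball_def\<close>)
  show "bijective_on_loops n X X' h x"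
    unfolding bijective_on_loops_def
  proof (intro conjI allI impI)
    fix f g assume f: "cube_loop n X x f" and g: "cube_loop n X x g"
      and fg: "loop_homotopic n X' (h x) (h \<circ> f) (h \<circ> g)"
    have "loop_homotopic n R' (k (p x)) (p' \<circ> (h \<circ> f)) (p' \<circ> (h \<circ> g))"
      using loop_homotopic_compose[OF fg pc'] sq[OF x] by simp
    then have "loop_homotopic n R' (k (p x)) (k \<circ> (p \<circ> f)) (k \<circ> (p \<circ> g))"
      using sq'[OF f] sq'[OF g] by (blast intro: homotopic_with_trans homotopic_with_symD)
    then have "loop_homotopic n R (p x) (p \<circ> f) (p \<circ> g)"
      using bk cube_loop_compose[OF f pc] cube_loop_compose[OF g pc] unfolding bijective_on_loops_def by blast
    then show "loop_homotopic n X x f g"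
      using bp f g unfolding bijective_on_loops_def by blast
  next
    fix g assume g: "cube_loop n X' (h x) g"
    have "cube_loop n R' (k (p x)) (p' \<circ> g)" using cube_loop_compose[OF g pc'] sq[OF x] by simp
    then obtain r where r: "cube_loop n R (p x) r" "loop_homotopic n R' (k (p x)) (k \<circ> r) (p' \<circ> g)"
      using bk unfolding bijective_on_loops_def by blast
    then obtain f where f: "cube_loop n X x f" "loop_homotopic n R (p x) (p \<circ> f) r"
      using bp unfolding bijective_on_loops_def by blast
    have "loop_homotopic n R' (k (p x)) (p' \<circ> (h \<circ> f)) (p' \<circ> g)"
      using sq'[OF f(1)] loop_homotopic_compose[OF f(2) kc] r(2) by (blast intro: homotopic_with_trans)
    then have "loop_homotopic n R' (p' (h x)) (p' \<circ> (h \<circ> f)) (p' \<circ> g)" using sq[OF x] by simp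
    then have "loop_homotopic n X' (h x) (h \<circ> f) g"
      using bp' g cube_loop_compose[OF f(1) h] unfolding bijective_on_loops_def by blast
    then show "\<exists>f. cube_loop n X x f \<and> loop_homotopic n X' (h x) (h \<circ> f) g" using f(1) by blast
  qed
qed

section \<open>Weak homotopy equivalences of products\<close>

lemma delta_generated_cube: "delta_generated (cube n)"
  by (simp add: simplex_image_cube simplex_image_imp_delta_generated)

lemma delta_generated_interval_cube: "delta_generated (prod_topology unit_interval (cube n))"
  by (intro delta_generated_prod simplex_image_interval delta_generated_cube)

lemma path_component_of_Top_prod:
  "path_component_of (Top_prod X Y) p q \<longleftrightarrow>
     path_component_of X (fst p) (fst q) \<and> path_component_of Y (snd p) (snd q)"
proof
  assume "path_component_of (Top_prod X Y) p q"
  then obtain \<gamma> where "pathin (Top_prod X Y) \<gamma>" "\<gamma> 0 = p" "\<gamma> 1 = q"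
    unfolding path_component_of_def by blast
  then show "path_component_of X (fst p) (fst q) \<and> path_component_of Y (snd p) (snd q)"
    unfolding path_component_of_def
    using pathin_compose[OF _ continuous_map_Top_prod_fst] pathin_compose[OF _ continuous_map_Top_prod_snd]
    by (metis comp_apply)
next
  assume "path_component_of X (fst p) (fst q) \<and> path_component_of Y (snd p) (snd q)"
  then obtain \<gamma> \<delta> where g: "pathin X \<gamma>" "\<gamma> 0 = fst p" "\<gamma> 1 = fst q"
    and d: "pathin Y \<delta>" "\<delta> 0 = snd p" "\<delta> 1 = snd q"
    unfolding path_component_of_def by blast
  have "pathin (Top_prod X Y) (\<lambda>u. (\<gamma> u, \<delta> u))"
    using g(1) d(1) unfolding pathin_def
    by (intro continuous_map_into_Top_prod simplex_image_imp_delta_generated simplex_image_interval)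
  then show "path_component_of (Top_prod X Y) p q"
    unfolding path_component_of_def using g d by (intro exI[of _ "\<lambda>u. (\<gamma> u, \<delta> u)"]) auto
qed

lemma cube_loop_Top_prod:
  "cube_loop n (Top_prod X Y) p f \<longleftrightarrow> cube_loop n X (fst p) (fst \<circ> f) \<and> cube_loop n Y (snd p) (snd \<circ> f)"
proof
  assume "cube_loop n (Top_prod X Y) p f"
  then show "cube_loop n X (fst p) (fst \<circ> f) \<and> cube_loop n Y (snd p) (snd \<circ> f)"
    using cube_loop_compose continuous_map_Top_prod_fst continuous_map_Top_prod_snd by metis
next
  assume a: "cube_loop n X (fst p) (fst \<circ> f) \<and> cube_loop n Y (snd p) (snd \<circ> f)"
  then have "continuous_map (cube n) (Top_prod X Y) (\<lambda>t. ((fst \<circ> f) t, (snd \<circ> f) t))"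
    unfolding cube_loop_def by (intro continuous_map_into_Top_prod delta_generated_cube) blast+
  then show "cube_loop n (Top_prod X Y) p f"
    using a by (auto simp: cube_loop_def prod_eq_iff)
qed

text \<open>
  The product in Top has more open sets than the classical one, but since \<open>I \<times> I\<^sup>n\<close> is
  \<open>\<Delta>\<close>-generated the two receive the same homotopies.
\<close>

lemma loop_homotopic_Top_prod:
  "loop_homotopic n (Top_prod X Y) p f g \<longleftrightarrow>
     loop_homotopic n X (fst p) (fst \<circ> f) (fst \<circ> g) \<and> loop_homotopic n Y (snd p) (snd \<circ> f) (snd \<circ> g)"
proof
  assume fg: "loop_homotopic n (Top_prod X Y) p f g"
  show "loop_homotopic n X (fst p) (fst \<circ> f) (fst \<circ> g) \<and> loop_homotopic n Y (snd p) (snd \<circ> f) (snd \<circ> g)"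
    using loop_homotopic_compose[OF fg continuous_map_Top_prod_fst]
      loop_homotopic_compose[OF fg continuous_map_Top_prod_snd] by (rule conjI)
next
  assume a: "loop_homotopic n X (fst p) (fst \<circ> f) (fst \<circ> g) \<and> loop_homotopic n Y (snd p) (snd \<circ> f) (snd \<circ> g)"
  obtain F where F: "continuous_map (prod_topology unit_interval (cube n)) X F"
    "\<And>t. F (0, t) = fst (f t)" "\<And>t. F (1, t) = fst (g t)"
    "\<And>u. u \<in> {0..1} \<Longrightarrow> const_on_boundary n (fst p) (\<lambda>t. F (u, t))"
    using a unfolding homotopic_with_def comp_def by metis
  obtain G where G: "continuous_map (prod_topology unit_interval (cube n)) Y G"
    "\<And>t. G (0, t) = snd (f t)" "\<And>t. G (1, t) = snd (g t)"
    "\<And>u. u \<in> {0..1} \<Longrightarrow> const_on_boundary n (snd p) (\<lambda>t. G (u, t))"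
    using a unfolding homotopic_with_def comp_def by metis
  have "continuous_map (prod_topology unit_interval (cube n)) (Top_prod X Y) (\<lambda>q. (F q, G q))"
    by (intro continuous_map_into_Top_prod delta_generated_interval_cube F(1) G(1))
  then show "loop_homotopic n (Top_prod X Y) p f g"
    by (rule loop_homotopicI) (use F G in \<open>auto simp: prod_eq_iff\<close>)
qed

lemma weak_homotopy_equivalence_Top_prod:
  assumes f: "weak_homotopy_equivalence X X' f" and g: "weak_homotopy_equivalence Y Y' g"
  shows "weak_homotopy_equivalence (Top_prod X Y) (Top_prod X' Y') (map_prod f g)"
  unfolding weak_homotopy_equivalence_iff
proof (intro conjI allI impI ballI)
  have fc: "continuous_map X X' f" and gc: "continuous_map Y Y' g"
    using f g by (simp_all add: weak_homotopy_equivalence_iff)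
  have "continuous_map (Top_prod X Y) (Top_prod X' Y') (\<lambda>p. ((f \<circ> fst) p, (g \<circ> snd) p))"
    by (intro continuous_map_into_Top_prod delta_generated_Top_prod
        continuous_map_compose[OF continuous_map_Top_prod_fst fc]
        continuous_map_compose[OF continuous_map_Top_prod_snd gc])
  then show "continuous_map (Top_prod X Y) (Top_prod X' Y') (map_prod f g)"
    by (simp add: map_prod_def split_beta')
  show "bijective_on_components (Top_prod X Y) (Top_prod X' Y') (map_prod f g)"
    using f g unfolding weak_homotopy_equivalence_iff bijective_on_components_def
    by (fastforce simp: path_component_of_Top_prod)
  fix n :: nat and p assume n: "0 < n" and p: "p \<in> topspace (Top_prod X Y)"
  have bf: "bijective_on_loops n X X' f (fst p)" and bg: "bijective_on_loops n Y Y' g (snd p)"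
    using f g n p unfolding weak_homotopy_equivalence_iff by auto
  have c: "fst \<circ> (map_prod f g \<circ> a) = f \<circ> (fst \<circ> a)" "snd \<circ> (map_prod f g \<circ> a) = g \<circ> (snd \<circ> a)"
    for a :: "(nat \<Rightarrow> real) \<Rightarrow> _" by auto
  show "bijective_on_loops n (Top_prod X Y) (Top_prod X' Y') (map_prod f g) p"
    unfolding bijective_on_loops_def cube_loop_Top_prod loop_homotopic_Top_prod c fst_map_prod snd_map_prod
  proof (intro conjI allI impI; (elim conjE)?)
    fix a b
    assume "cube_loop n X (fst p) (fst \<circ> a)" "cube_loop n X (fst p) (fst \<circ> b)"
      "loop_homotopic n X' (f (fst p)) (f \<circ> (fst \<circ> a)) (f \<circ> (fst \<circ> b))"
    then show "loop_homotopic n X (fst p) (fst \<circ> a) (fst \<circ> b)"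
      using bf unfolding bijective_on_loops_def by blast
  next
    fix a b
    assume "cube_loop n Y (snd p) (snd \<circ> a)" "cube_loop n Y (snd p) (snd \<circ> b)"
      "loop_homotopic n Y' (g (snd p)) (g \<circ> (snd \<circ> a)) (g \<circ> (snd \<circ> b))"
    then show "loop_homotopic n Y (snd p) (snd \<circ> a) (snd \<circ> b)"
      using bg unfolding bijective_on_loops_def by blast
  next
    fix b assume "cube_loop n X' (f (fst p)) (fst \<circ> b)" "cube_loop n Y' (g (snd p)) (snd \<circ> b)"
    moreover obtain a where "cube_loop n X (fst p) a" "loop_homotopic n X' (f (fst p)) (f \<circ> a) (fst \<circ> b)"
      using bf calculation(1) unfolding bijective_on_loops_def by blast
    moreover obtain a' where "cube_loop n Y (snd p) a'" "loop_homotopic n Y' (g (snd p)) (g \<circ> a') (snd \<circ> b)"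
      using bg calculation(2) unfolding bijective_on_loops_def by blast
    moreover have "fst \<circ> (\<lambda>t. (a t, a' t)) = a" "snd \<circ> (\<lambda>t. (a t, a' t)) = a'"
      by (simp_all add: o_def)
    ultimately show "\<exists>a. (cube_loop n X (fst p) (fst \<circ> a) \<and> cube_loop n Y (snd p) (snd \<circ> a)) \<and>
        loop_homotopic n X' (f (fst p)) (f \<circ> (fst \<circ> a)) (fst \<circ> b) \<and>
        loop_homotopic n Y' (g (snd p)) (g \<circ> (snd \<circ> a)) (snd \<circ> b)"
      by (intro exI[of _ "\<lambda>t. (a t, a' t)"]) (simp only: simp_thms)
  qed
qed

section \<open>Tensor products of \<open>P\<close>-spaces\<close>

locale reparam_cat =
  fixes T :: top_kind and P :: "('o, 'm) semimonoidal_cat"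
  assumes reparam: "reparametrization_category T P"
begin

lemma enriched: "Top_enriched_category T P"
  and bifunctor: "enriched_bifunctor_Tens P"
  using reparam by (simp_all add: reparametrization_category_def)

lemma Hom_delta_generated: "a \<in> Obj P \<Longrightarrow> b \<in> Obj P \<Longrightarrow> delta_generated (Hom P a b)"
  using enriched[unfolded Top_enriched_category_def, THEN conjunct1] in_Top_imp_delta_generated by blast

lemma Ident_maps: "a \<in> Obj P \<Longrightarrow> Ident P a \<in> maps P a a"
  using enriched[unfolded Top_enriched_category_def, THEN conjunct2, THEN conjunct1] by blast

lemma continuous_Comp:
  assumes "a \<in> Obj P" "b \<in> Obj P" "c \<in> Obj P"
  shows "continuous_map (Top_prod (Hom P b c) (Hom P a b)) (Hom P a c) (\<lambda>(\<psi>, \<phi>). Comp P a b c \<psi> \<phi>)"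
  using enriched[unfolded Top_enriched_category_def, THEN conjunct2, THEN conjunct2, THEN conjunct1]
    assms by blast

lemma Comp_Ident_right: "a \<in> Obj P \<Longrightarrow> b \<in> Obj P \<Longrightarrow> \<phi> \<in> maps P a b \<Longrightarrow> Comp P a a b \<phi> (Ident P a) = \<phi>"
  using enriched[unfolded Top_enriched_category_def, THEN conjunct2, THEN conjunct2, THEN conjunct2,
      THEN conjunct1] by blast

lemma Comp_assoc:
  assumes "a \<in> Obj P" "b \<in> Obj P" "c \<in> Obj P" "d \<in> Obj P"
    "\<phi> \<in> maps P a b" "\<psi> \<in> maps P b c" "\<omega> \<in> maps P c d"
  shows "Comp P a c d \<omega> (Comp P a b c \<psi> \<phi>) = Comp P a b d (Comp P b c d \<omega> \<psi>) \<phi>"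
  using enriched[unfolded Top_enriched_category_def, THEN conjunct2, THEN conjunct2, THEN conjunct2,
      THEN conjunct2] assms by blast

lemma Tens_Obj: "a \<in> Obj P \<Longrightarrow> b \<in> Obj P \<Longrightarrow> Tens P a b \<in> Obj P"
  using bifunctor[unfolded enriched_bifunctor_Tens_def, THEN conjunct1] by blast

lemma continuous_map_Comp:
  assumes abc: "a \<in> Obj P" "b \<in> Obj P" "c \<in> Obj P" and W: "delta_generated W"
    and f: "continuous_map W (Hom P b c) f" and g: "continuous_map W (Hom P a b) g"
  shows "continuous_map W (Hom P a c) (\<lambda>w. Comp P a b c (f w) (g w))"
  using continuous_map_compose[OF continuous_map_into_Top_prod[OF W f g] continuous_Comp[OF abc]]
  by (simp add: o_def)

lemma Comp_maps:
  assumes "a \<in> Obj P" "b \<in> Obj P" "c \<in> Obj P" "\<phi> \<in> maps P a b" "\<psi> \<in> maps P b c"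
  shows "Comp P a b c \<psi> \<phi> \<in> maps P a c"
  using continuous_map_funspace[OF continuous_Comp[OF assms(1-3)]] assms(4,5) by (auto simp: Pi_iff)

lemma Tens_map_maps:
  assumes "a \<in> Obj P" "a' \<in> Obj P" "b \<in> Obj P" "b' \<in> Obj P" "\<alpha> \<in> maps P a a'" "\<beta> \<in> maps P b b'"
  shows "Tens_map P a a' b b' \<alpha> \<beta> \<in> maps P (Tens P a b) (Tens P a' b')"
proof -
  have "continuous_map (Top_prod (Hom P a a') (Hom P b b')) (Hom P (Tens P a b) (Tens P a' b'))
          (\<lambda>(\<alpha>, \<beta>). Tens_map P a a' b b' \<alpha> \<beta>)"
    using bifunctor[unfolded enriched_bifunctor_Tens_def, THEN conjunct2, THEN conjunct1] assms(1-4)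
    by blast
  from continuous_map_funspace[OF this] show ?thesis using assms(5,6) by (auto simp: Pi_iff)
qed

lemma act_left_maps:
  assumes "L \<in> Obj P" "a \<in> Obj P" "a' \<in> Obj P" "b \<in> Obj P" "b' \<in> Obj P"
    "\<alpha> \<in> maps P a a'" "\<beta> \<in> maps P b b'" "\<psi> \<in> maps P L (Tens P a b)"
  shows "act_left P L a a' b b' \<alpha> \<beta> \<psi> \<in> maps P L (Tens P a' b')"
  using assms by (intro Comp_maps Tens_map_maps Tens_Obj)

lemma Hom_path_connected: "a \<in> Obj P \<Longrightarrow> b \<in> Obj P \<Longrightarrow> path_connected_space (Hom P a b)"
  using reparam[unfolded reparametrization_category_def, THEN conjunct2, THEN conjunct2, THEN conjunct2,
      THEN conjunct1] contractible_imp_path_connected_space by blast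

lemma continuous_map_Act:
  assumes D: "is_P_space T P D" and ab: "a \<in> Obj P" "b \<in> Obj P" and W: "delta_generated W"
    and \<theta>: "continuous_map W (Hom P a b) \<theta>" and x: "continuous_map W (Space D b) x"
  shows "continuous_map W (Space D a) (\<lambda>w. Act D a b (\<theta> w) (x w))"
proof (rule continuous_map_uncurry[OF _ W \<theta> x])
  show "continuous_map (Hom P a b) (Top_map (Space D b) (Space D a))
          (\<lambda>\<theta>. restrict (Act D a b \<theta>) (points D b))"
    using D ab unfolding is_P_space_def by blast
qed

text \<open>
  An enriched functor provides the action only as a restricted function in a mapping space; the
  value is recovered by evaluating on a constant simplex.
\<close>

lemma Act_points:
  assumes D: "is_P_space T P D" and ab: "a \<in> Obj P" "b \<in> Obj P"
    and \<theta>: "\<theta> \<in> maps P a b" and x: "x \<in> points D b"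
  shows "Act D a b \<theta> x \<in> points D a"
proof -
  have "continuous_map (simplex_top 0) (Space D a) (\<lambda>_. Act D a b \<theta> x)"
    using \<theta> x by (intro continuous_map_Act[OF D ab delta_generated_simplex]) auto
  then have "(\<lambda>_. Act D a b \<theta> x) t \<in> points D a" if "t \<in> topspace (simplex_top 0)" for t :: "nat \<Rightarrow> real"
    using that by (rule continuous_map_funspace[THEN funcset_mem])
  moreover have "(\<lambda>j. if j = 0 then 1 else 0) \<in> topspace (simplex_top 0)" by simp
  ultimately show ?thesis by blast
qed

lemma delta_generated_tensor_coproduct: "delta_generated (tensor_coproduct P D E L)"
  unfolding tensor_coproduct_def
  by (intro delta_generated_sum) (auto simp: delta_generated_Top_prod)

lemma topspace_tensor_coproduct:
  "((a, b), \<psi>, x, y) \<in> topspace (tensor_coproduct P D E L) \<longleftrightarrow>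
     a \<in> Obj P \<and> b \<in> Obj P \<and> \<psi> \<in> maps P L (Tens P a b) \<and> x \<in> points D a \<and> y \<in> points E b"
  by (auto simp: tensor_coproduct_def)

lemma tensor_relation_subset:
  assumes "is_P_space T P D" "is_P_space T P E" "L \<in> Obj P"
  shows "tensor_relation P D E L \<subseteq> topspace (tensor_coproduct P D E L) \<times> topspace (tensor_coproduct P D E L)"
  unfolding tensor_relation_def
  using assms(3) act_left_maps Act_points[OF assms(1)] Act_points[OF assms(2)]
  by (auto simp: topspace_tensor_coproduct)

abbreviation tensor_class where
  "tensor_class D E L z \<equiv> tensor_equiv T P D E L `` {z}"

lemma Space_tensor: "Space (tensor T P D E) L = Top_quotient T (tensor_coproduct P D E L) (tensor_relation P D E L)"
  by (simp add: tensor_def)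

lemma tensor_points:
  assumes "is_P_space T P D" "is_P_space T P E" "L \<in> Obj P"
  shows "points (tensor T P D E) L = tensor_class D E L ` topspace (tensor_coproduct P D E L)"
proof -
  have "quotient_map (tensor_coproduct P D E L) (Space (tensor T P D E) L) (tensor_class D E L)"
    unfolding Space_tensor tensor_equiv_def
    by (rule quotient_map_Top_quotient[OF delta_generated_tensor_coproduct tensor_relation_subset[OF assms]])
  then show ?thesis by (simp add: quotient_map_def)
qed

lemma tensor_points_cases:
  assumes "is_P_space T P D" "is_P_space T P E" "L \<in> Obj P" "C \<in> points (tensor T P D E) L"
  obtains a b \<psi> x y where "C = tensor_class D E L ((a, b), \<psi>, x, y)" "a \<in> Obj P" "b \<in> Obj P"
    "\<psi> \<in> maps P L (Tens P a b)" "x \<in> points D a" "y \<in> points E b"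
proof -
  obtain z where z: "z \<in> topspace (tensor_coproduct P D E L)" "C = tensor_class D E L z"
    using assms(4) unfolding tensor_points[OF assms(1-3)] by blast
  obtain a b \<psi> x y where "z = ((a, b), \<psi>, x, y)" by (metis surj_pair)
  then show ?thesis using z that by (auto simp: topspace_tensor_coproduct)
qed

lemma tensor_class_balanced:
  assumes DE: "is_P_space T P D" "is_P_space T P E" and L: "L \<in> Obj P"
    and o: "a \<in> Obj P" "a' \<in> Obj P" "b \<in> Obj P" "b' \<in> Obj P"
    and m: "\<alpha> \<in> maps P a a'" "\<beta> \<in> maps P b b'" "\<psi> \<in> maps P L (Tens P a b)"
    and p: "x \<in> points D a'" "y \<in> points E b'"
  shows "tensor_class D E L ((a', b'), act_left P L a a' b b' \<alpha> \<beta> \<psi>, x, y) =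
     tensor_class D E L ((a, b), \<psi>, Act D a a' \<alpha> x, Act E b b' \<beta> y)"
proof -
  note props = Top_equiv_props[OF delta_generated_tensor_coproduct tensor_relation_subset[OF DE L], of T]
  have "(((a', b'), act_left P L a a' b b' \<alpha> \<beta> \<psi>, x, y),
       ((a, b), \<psi>, Act D a a' \<alpha> x, Act E b b' \<beta> y)) \<in> tensor_relation P D E L"
    unfolding tensor_relation_def using o m p by blast
  then show ?thesis
    unfolding tensor_equiv_def using props(1,2) by (intro equiv_class_eq) auto
qed

lemma continuous_map_tensor_coproducts:
  assumes K: "simplex_image K"
    and A: "\<And>a b. a \<in> Obj P \<Longrightarrow> b \<in> Obj P \<Longrightarrow>
      continuous_map (prod_topology K (Hom P L (Tens P a b))) (Hom P L' (Tens P a b)) (\<lambda>(k, \<psi>). A k a b \<psi>)"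
    and f: "\<And>a. a \<in> Obj P \<Longrightarrow> continuous_map (Space D a) (Space D' a) (f a)"
    and g: "\<And>a. a \<in> Obj P \<Longrightarrow> continuous_map (Space E a) (Space E' a) (g a)"
  shows "continuous_map (prod_topology K (tensor_coproduct P D E L)) (tensor_coproduct P D' E' L')
     (\<lambda>(k, (a, b), \<psi>, x, y). ((a, b), A k a b \<psi>, f a x, g b y))"
  unfolding tensor_coproduct_def[of P D E L]
proof (rule continuous_map_from_prod_sum)
  fix i assume "i \<in> Obj P \<times> Obj P"
  then obtain a b where i: "i = (a, b)" and ab: "a \<in> Obj P" "b \<in> Obj P" by blast
  let ?X = "Top_prod (Hom P L (Tens P a b)) (Top_prod (Space D a) (Space E b))"
  let ?W = "prod_topology K ?X"
  have W: "delta_generated ?W" by (intro delta_generated_prod K delta_generated_Top_prod)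
  have s: "continuous_map ?W ?X snd" by (rule continuous_map_snd)
  have "continuous_map ?W (prod_topology K (Hom P L (Tens P a b))) (\<lambda>w. (fst w, (fst \<circ> snd) w))"
    by (intro continuous_map_pairedI continuous_map_fst continuous_map_compose[OF s continuous_map_Top_prod_fst])
  from continuous_map_compose[OF this A[OF ab]]
  have 1: "continuous_map ?W (Hom P L' (Tens P a b)) (\<lambda>w. A (fst w) a b (fst (snd w)))"
    by (simp add: o_def)
  note ss = continuous_map_compose[OF s continuous_map_Top_prod_snd]
  have 2: "continuous_map ?W (Space D' a) (\<lambda>w. f a (fst (snd (snd w))))"
    using continuous_map_compose[OF continuous_map_compose[OF ss continuous_map_Top_prod_fst] f[OF ab(1)]]
    by (simp add: o_def)
  have 3: "continuous_map ?W (Space E' b) (\<lambda>w. g b (snd (snd (snd w))))"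
    using continuous_map_compose[OF continuous_map_compose[OF ss continuous_map_Top_prod_snd] g[OF ab(2)]]
    by (simp add: o_def)
  have "continuous_map (Top_prod (Hom P L' (Tens P a b)) (Top_prod (Space D' a) (Space E' b)))
     (tensor_coproduct P D' E' L') (\<lambda>p. ((a, b), p))"
    unfolding tensor_coproduct_def
    using continuous_map_component_injection[of "(a, b)" "Obj P \<times> Obj P"
        "\<lambda>(a, b). Top_prod (Hom P L' (Tens P a b)) (Top_prod (Space D' a) (Space E' b))"] ab by simp
  from continuous_map_compose[OF continuous_map_into_Top_prod[OF W 1 continuous_map_into_Top_prod[OF W 2 3]] this]
  have "continuous_map ?W (tensor_coproduct P D' E' L')
      (\<lambda>w. ((a, b), A (fst w) a b (fst (snd w)), f a (fst (snd (snd w))), g b (snd (snd (snd w)))))"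
    by (simp add: o_def)
  then show "continuous_map (prod_topology K (case i of (a, b) \<Rightarrow> Top_prod (Hom P L (Tens P a b)) (Top_prod (Space D a) (Space E b))))
      (tensor_coproduct P D' E' L')
      (\<lambda>(k, x). (\<lambda>(k, (a, b), \<psi>, x, y). ((a, b), A k a b \<psi>, f a x, g b y)) (k, (i, x)))"
    by (simp add: i split_beta')
qed

text \<open>
  A family over \<open>K\<close> of natural transformations \<open>P(L, a \<otimes> b) \<rightarrow> P(L', a \<otimes> b)\<close>, together with maps
  \<open>f\<close> and \<open>g\<close> of \<open>P\<close>-spaces, induces a family of maps of tensor products. Taking \<open>K\<close> to be a simplex of
  \<open>P(L', L)\<close> and composing with it gives the action, the constant family gives \<open>f \<otimes> g\<close>, and \<open>\<Theta>\<close> over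
  the interval gives the homotopy from the identity to cutting and gluing.
\<close>

lemma tensor_induced_map:
  fixes D :: "('o, 'm, 'd) P_space" and E :: "('o, 'm, 'e) P_space"
    and D' :: "('o, 'm, 'd') P_space" and E' :: "('o, 'm, 'e') P_space"
  assumes K: "simplex_image K" and L: "L \<in> Obj P" and L': "L' \<in> Obj P"
    and A: "\<And>a b. a \<in> Obj P \<Longrightarrow> b \<in> Obj P \<Longrightarrow>
      continuous_map (prod_topology K (Hom P L (Tens P a b))) (Hom P L' (Tens P a b)) (\<lambda>(k, \<psi>). A k a b \<psi>)"
    and Anat: "\<And>k a a' b b' \<alpha> \<beta> \<psi>. k \<in> topspace K \<Longrightarrow> a \<in> Obj P \<Longrightarrow> a' \<in> Obj P \<Longrightarrow> b \<in> Obj P \<Longrightarrow> b' \<in> Obj P \<Longrightarrow>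
      \<alpha> \<in> maps P a a' \<Longrightarrow> \<beta> \<in> maps P b b' \<Longrightarrow> \<psi> \<in> maps P L (Tens P a b) \<Longrightarrow>
      A k a' b' (act_left P L a a' b b' \<alpha> \<beta> \<psi>) = act_left P L' a a' b b' \<alpha> \<beta> (A k a b \<psi>)"
    and f: "P_space_map T P D D' f" and g: "P_space_map T P E E' g"
  defines "h \<equiv> \<lambda>k ((a, b), \<psi>, x, y). ((a, b), A k a b \<psi>, f a x, g b y)"
  shows "\<And>k z. k \<in> topspace K \<Longrightarrow> z \<in> topspace (tensor_coproduct P D E L) \<Longrightarrow>
      tensor_equiv T P D' E' L' `` (h k ` (tensor_class D E L z)) = tensor_class D' E' L' (h k z)"
    and "continuous_map (prod_topology K (Space (tensor T P D E) L)) (Space (tensor T P D' E') L')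
      (\<lambda>(k, C). tensor_equiv T P D' E' L' `` (h k ` C))"
proof -
  have DE: "is_P_space T P D" "is_P_space T P E" and DE': "is_P_space T P D'" "is_P_space T P E'"
    and fc: "\<And>a. a \<in> Obj P \<Longrightarrow> continuous_map (Space D a) (Space D' a) (f a)"
    and gc: "\<And>a. a \<in> Obj P \<Longrightarrow> continuous_map (Space E a) (Space E' a) (g a)"
    and fn: "\<And>a b \<theta> x. a \<in> Obj P \<Longrightarrow> b \<in> Obj P \<Longrightarrow> \<theta> \<in> maps P a b \<Longrightarrow> x \<in> points D b \<Longrightarrow>
      f a (Act D a b \<theta> x) = Act D' a b \<theta> (f b x)"
    and gn: "\<And>a b \<theta> x. a \<in> Obj P \<Longrightarrow> b \<in> Obj P \<Longrightarrow> \<theta> \<in> maps P a b \<Longrightarrow> x \<in> points E b \<Longrightarrow>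
      g a (Act E a b \<theta> x) = Act E' a b \<theta> (g b x)"
    using f g unfolding P_space_map_def by blast+
  note X = delta_generated_tensor_coproduct[of D E L] tensor_relation_subset[OF DE L]
  note Y = delta_generated_tensor_coproduct[of D' E' L'] tensor_relation_subset[OF DE' L']
  have c: "continuous_map (prod_topology K (tensor_coproduct P D E L)) (tensor_coproduct P D' E' L') (\<lambda>(k, z). h k z)"
    using continuous_map_tensor_coproducts[OF K A fc gc] unfolding h_def by simp
  have ck: "continuous_map (tensor_coproduct P D E L) (tensor_coproduct P D' E' L') (h k)" if "k \<in> topspace K" for k
    using continuous_map_o_Pair[OF c that] by (simp add: o_def)
  have hr: "(h k z, h k w) \<in> tensor_relation P D' E' L'"
    if k: "k \<in> topspace K" and zw: "(z, w) \<in> tensor_relation P D E L" for k z w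
  proof -
    obtain a a' b b' \<alpha> \<beta> \<psi> x' y' where
      z: "z = ((a', b'), act_left P L a a' b b' \<alpha> \<beta> \<psi>, x', y')"
      and w: "w = ((a, b), \<psi>, Act D a a' \<alpha> x', Act E b b' \<beta> y')"
      and o: "a \<in> Obj P" "a' \<in> Obj P" "b \<in> Obj P" "b' \<in> Obj P"
      and m: "\<alpha> \<in> maps P a a'" "\<beta> \<in> maps P b b'" "\<psi> \<in> maps P L (Tens P a b)"
      and p: "x' \<in> points D a'" "y' \<in> points E b'"
      using zw unfolding tensor_relation_def by blast
    have "A k a b \<psi> \<in> maps P L' (Tens P a b)"
      using continuous_map_funspace[OF A[OF o(1,3)]] k m(3) by (auto simp: Pi_iff)
    moreover have "f a' x' \<in> points D' a'" "g b' y' \<in> points E' b'"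
      using fc[OF o(2)] gc[OF o(4)] p by (auto simp: continuous_map_def)
    moreover have "h k z = ((a', b'), act_left P L' a a' b b' \<alpha> \<beta> (A k a b \<psi>), f a' x', g b' y')"
      using Anat[OF k o m] by (simp add: h_def z)
    moreover have "h k w = ((a, b), A k a b \<psi>, Act D' a a' \<alpha> (f a' x'), Act E' b b' \<beta> (g b' y'))"
      using fn[OF o(1,2) m(1) p(1)] gn[OF o(3,4) m(2) p(2)] by (simp add: h_def w)
    ultimately show ?thesis
      unfolding tensor_relation_def using o m by blast
  qed
  show 1: "tensor_equiv T P D' E' L' `` (h k ` (tensor_class D E L z)) = tensor_class D' E' L' (h k z)"
    if "k \<in> topspace K" "z \<in> topspace (tensor_coproduct P D E L)" for k z
    unfolding tensor_equiv_def
    by (rule Top_equiv_image_of_map[OF X Y ck[OF that(1)] hr[OF that(1)] that(2)])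
  have q: "continuous_map (tensor_coproduct P D' E' L') (Space (tensor T P D' E') L') (tensor_class D' E' L')"
    unfolding Space_tensor tensor_equiv_def
    by (rule quotient_imp_continuous_map[OF quotient_map_Top_quotient[OF Y]])
  show "continuous_map (prod_topology K (Space (tensor T P D E) L)) (Space (tensor T P D' E') L')
      (\<lambda>(k, C). tensor_equiv T P D' E' L' `` (h k ` C))"
    unfolding Space_tensor[of D E]
    by (rule continuous_map_from_prod_Top_quotient[OF K X continuous_map_compose[OF c q]])
       (simp add: 1[unfolded tensor_equiv_def[of T P D E]])
qed

lemma P_space_map_id: "is_P_space T P D \<Longrightarrow> P_space_map T P D D (\<lambda>_ x. x)"
  unfolding P_space_map_def by simp

lemma Act_tensor:
  "Act (tensor T P D E) K L \<theta> C = tensor_equiv T P D E K ``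
     ((\<lambda>((a, b), \<psi>, x, y). ((a, b), Comp P K L (Tens P a b) \<psi> \<theta>, x, y)) ` C)"
  by (simp add: tensor_def)

lemma
  assumes DE: "is_P_space T P D" "is_P_space T P E" and K: "K \<in> Obj P" and L: "L \<in> Obj P"
    and S: "simplex_image S" and s: "continuous_map S (Hom P K L) \<sigma>"
  shows continuous_map_Act_tensor:
      "continuous_map (prod_topology S (Space (tensor T P D E) L)) (Space (tensor T P D E) K)
         (\<lambda>(t, C). Act (tensor T P D E) K L (\<sigma> t) C)"
    and Act_tensor_class_param: "t \<in> topspace S \<Longrightarrow> a \<in> Obj P \<Longrightarrow> b \<in> Obj P \<Longrightarrow> \<psi> \<in> maps P L (Tens P a b) \<Longrightarrow>
       x \<in> points D a \<Longrightarrow> y \<in> points E b \<Longrightarrow>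
       Act (tensor T P D E) K L (\<sigma> t) (tensor_class D E L ((a, b), \<psi>, x, y)) =
       tensor_class D E K ((a, b), Comp P K L (Tens P a b) \<psi> (\<sigma> t), x, y)"
proof -
  let ?A = "\<lambda>t a b \<psi>. Comp P K L (Tens P a b) \<psi> (\<sigma> t)"
  have A: "continuous_map (prod_topology S (Hom P L (Tens P a b))) (Hom P K (Tens P a b)) (\<lambda>(t, \<psi>). ?A t a b \<psi>)"
    if "a \<in> Obj P" "b \<in> Obj P" for a b
  proof -
    have "delta_generated (prod_topology S (Hom P L (Tens P a b)))"
      using S L that by (intro delta_generated_prod Hom_delta_generated Tens_Obj)
    moreover have "continuous_map (prod_topology S (Hom P L (Tens P a b))) (Hom P K L) (\<lambda>p. \<sigma> (fst p))"
      using continuous_map_compose[OF continuous_map_fst s] by (simp add: o_def)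
    ultimately have "continuous_map (prod_topology S (Hom P L (Tens P a b))) (Hom P K (Tens P a b))
        (\<lambda>p. Comp P K L (Tens P a b) (snd p) (\<sigma> (fst p)))"
      using K L that by (intro continuous_map_Comp Tens_Obj continuous_map_snd)
    then show ?thesis by (simp add: split_beta')
  qed
  have nat: "?A t a' b' (act_left P L a a' b b' \<alpha> \<beta> \<psi>) = act_left P K a a' b b' \<alpha> \<beta> (?A t a b \<psi>)"
    if "t \<in> topspace S" "a \<in> Obj P" "a' \<in> Obj P" "b \<in> Obj P" "b' \<in> Obj P"
      "\<alpha> \<in> maps P a a'" "\<beta> \<in> maps P b b'" "\<psi> \<in> maps P L (Tens P a b)" for t a a' b b' \<alpha> \<beta> \<psi>
  proof -
    have "\<sigma> t \<in> maps P K L" using s that(1) by (auto simp: continuous_map_def)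
    then show ?thesis using that K L by (intro Comp_assoc[symmetric] Tens_Obj Tens_map_maps)
  qed
  note ind = tensor_induced_map[OF S L K, of ?A, OF A nat P_space_map_id[OF DE(1)] P_space_map_id[OF DE(2)]]
  show "continuous_map (prod_topology S (Space (tensor T P D E) L)) (Space (tensor T P D E) K)
         (\<lambda>(t, C). Act (tensor T P D E) K L (\<sigma> t) C)"
    unfolding Act_tensor by (rule ind(2))
  show "Act (tensor T P D E) K L (\<sigma> t) (tensor_class D E L ((a, b), \<psi>, x, y)) =
       tensor_class D E K ((a, b), Comp P K L (Tens P a b) \<psi> (\<sigma> t), x, y)"
    if "t \<in> topspace S" "a \<in> Obj P" "b \<in> Obj P" "\<psi> \<in> maps P L (Tens P a b)"
       "x \<in> points D a" "y \<in> points E b"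
    unfolding Act_tensor
    by (subst ind(1)) (use that in \<open>auto simp: topspace_tensor_coproduct\<close>)
qed

lemma Act_tensor_class:
  assumes "is_P_space T P D" "is_P_space T P E" "K \<in> Obj P" "L \<in> Obj P" "\<theta> \<in> maps P K L"
    "a \<in> Obj P" "b \<in> Obj P" "\<psi> \<in> maps P L (Tens P a b)" "x \<in> points D a" "y \<in> points E b"
  shows "Act (tensor T P D E) K L \<theta> (tensor_class D E L ((a, b), \<psi>, x, y)) =
       tensor_class D E K ((a, b), Comp P K L (Tens P a b) \<psi> \<theta>, x, y)"
  using Act_tensor_class_param[OF assms(1-4) simplex_image_interval, of "\<lambda>_. \<theta>" 0] assms(5-) by simp

text \<open>
  The action is continuous into the mapping space by the exponential law, for which it is enough to
  know it over the simplices of the space of maps.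
\<close>

lemma is_P_space_tensor:
  assumes DE: "is_P_space T P D" "is_P_space T P E"
  shows "is_P_space T P (tensor T P D E)"
  unfolding is_P_space_def
proof (intro conjI ballI)
  fix a assume a: "a \<in> Obj P"
  show "in_Top T (Space (tensor T P D E) a)"
    unfolding Space_tensor
    by (rule Top_equiv_props(3)[OF delta_generated_tensor_coproduct tensor_relation_subset[OF DE a]])
next
  fix a b assume ab: "a \<in> Obj P" "b \<in> Obj P"
  show "continuous_map (Hom P a b) (Top_map (Space (tensor T P D E) b) (Space (tensor T P D E) a))
          (\<lambda>\<theta>. restrict (Act (tensor T P D E) a b \<theta>) (points (tensor T P D E) b))"
    using continuous_map_Act_tensor[OF DE ab simplex_image_simplex]
    by (intro continuous_map_curry Hom_delta_generated ab)
next
  fix a C assume a: "a \<in> Obj P" and C: "C \<in> points (tensor T P D E) a"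
  show "Act (tensor T P D E) a a (Ident P a) C = C"
    by (rule tensor_points_cases[OF DE a C])
       (simp add: Act_tensor_class[OF DE a a Ident_maps[OF a]] Comp_Ident_right a Tens_Obj)
next
  fix a b c \<phi> \<psi> C assume o: "a \<in> Obj P" "b \<in> Obj P" "c \<in> Obj P"
    and m: "\<phi> \<in> maps P a b" "\<psi> \<in> maps P b c" and C: "C \<in> points (tensor T P D E) c"
  show "Act (tensor T P D E) a c (Comp P a b c \<psi> \<phi>) C =
      Act (tensor T P D E) a b \<phi> (Act (tensor T P D E) b c \<psi> C)"
    by (rule tensor_points_cases[OF DE o(3) C])
       (simp add: Act_tensor_class DE o m Comp_maps Tens_Obj Comp_assoc)
qed

lemma
  assumes f: "P_space_map T P D D' f" and g: "P_space_map T P E E' g" and L: "L \<in> Obj P"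
  shows continuous_map_tensor_map:
      "continuous_map (Space (tensor T P D E) L) (Space (tensor T P D' E') L) (tensor_map T P D' E' f g L)"
    and tensor_map_class: "a \<in> Obj P \<Longrightarrow> b \<in> Obj P \<Longrightarrow> \<psi> \<in> maps P L (Tens P a b) \<Longrightarrow>
       x \<in> points D a \<Longrightarrow> y \<in> points E b \<Longrightarrow>
       tensor_map T P D' E' f g L (tensor_class D E L ((a, b), \<psi>, x, y)) =
       tensor_class D' E' L ((a, b), \<psi>, f a x, g b y)"
proof -
  let ?A = "\<lambda>(_ :: real) (a :: 'o) (b :: 'o) \<psi>. \<psi>"
  have A: "continuous_map (prod_topology unit_interval (Hom P L (Tens P a b))) (Hom P L (Tens P a b)) (\<lambda>(t, \<psi>). ?A t a b \<psi>)"
    for a b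
    using continuous_map_snd by (simp add: split_beta')
  note ind = tensor_induced_map[OF simplex_image_interval L L, of ?A, OF A refl f g]
  show "continuous_map (Space (tensor T P D E) L) (Space (tensor T P D' E') L) (tensor_map T P D' E' f g L)"
    using continuous_map_o_Pair[OF ind(2), of 0] unfolding tensor_map_def[abs_def] by (simp add: o_def)
  show "tensor_map T P D' E' f g L (tensor_class D E L ((a, b), \<psi>, x, y)) =
       tensor_class D' E' L ((a, b), \<psi>, f a x, g b y)"
    if "a \<in> Obj P" "b \<in> Obj P" "\<psi> \<in> maps P L (Tens P a b)" "x \<in> points D a" "y \<in> points E b"
    unfolding tensor_map_def
    by (subst ind(1)[of 0]) (use that in \<open>auto simp: topspace_tensor_coproduct\<close>)
qed

lemma P_space_map_points:
  "P_space_map T P D D' f \<Longrightarrow> a \<in> Obj P \<Longrightarrow> x \<in> points D a \<Longrightarrow> f a x \<in> points D' a"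
  unfolding P_space_map_def continuous_map_def by blast

lemma P_space_map_tensor:
  assumes f: "P_space_map T P D D' f" and g: "P_space_map T P E E' g"
  shows "P_space_map T P (tensor T P D E) (tensor T P D' E') (tensor_map T P D' E' f g)"
proof -
  have DE: "is_P_space T P D" "is_P_space T P E" and DE': "is_P_space T P D'" "is_P_space T P E'"
    using f g unfolding P_space_map_def by blast+
  show ?thesis
    unfolding P_space_map_def
  proof (intro conjI ballI is_P_space_tensor DE DE' continuous_map_tensor_map[OF f g])
    fix a b \<theta> C assume ab: "a \<in> Obj P" "b \<in> Obj P" and \<theta>: "\<theta> \<in> maps P a b"
      and C: "C \<in> points (tensor T P D E) b"
    show "tensor_map T P D' E' f g a (Act (tensor T P D E) a b \<theta> C) =
        Act (tensor T P D' E') a b \<theta> (tensor_map T P D' E' f g b C)"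
      by (rule tensor_points_cases[OF DE ab(2) C])
         (simp add: Act_tensor_class DE DE' ab \<theta> tensor_map_class[OF f g] Comp_maps Tens_Obj
           P_space_map_points[OF f] P_space_map_points[OF g])
  qed
qed

end

section \<open>Cutting and gluing\<close>

locale reparam_cat_with_cuts = reparam_cat T P for T :: top_kind and P :: "('o, 'm) semimonoidal_cat" +
  fixes \<delta> :: "'o \<Rightarrow> 'm" and c1 c2 :: "'o \<Rightarrow> 'o \<Rightarrow> 'o \<Rightarrow> 'm \<Rightarrow> 'm"
    and \<Theta> :: "'o \<Rightarrow> 'o \<Rightarrow> 'o \<Rightarrow> real \<Rightarrow> 'm \<Rightarrow> 'm"
  assumes cuts: "cut_structure P \<delta> c1 c2 \<Theta>"
begin

lemma delta_maps: "L \<in> Obj P \<Longrightarrow> \<delta> L \<in> maps P L (Tens P L L)"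
  using cuts unfolding cut_structure_def by blast

lemma
  assumes "L \<in> Obj P" "a \<in> Obj P" "b \<in> Obj P"
  shows continuous_map_c1: "continuous_map (Hom P L (Tens P a b)) (Hom P L a) (c1 L a b)"
    and continuous_map_c2: "continuous_map (Hom P L (Tens P a b)) (Hom P L b) (c2 L a b)"
    and continuous_map_Theta: "continuous_map (prod_topology unit_interval (Hom P L (Tens P a b)))
          (Hom P L (Tens P a b)) (\<lambda>(u, \<psi>). \<Theta> L a b u \<psi>)"
proof -
  show "continuous_map (Hom P L (Tens P a b)) (Hom P L a) (c1 L a b)"
     "continuous_map (Hom P L (Tens P a b)) (Hom P L b) (c2 L a b)"
    using assms cuts unfolding cut_structure_def by blast+
  have t: "continuous_map (Top_prod unit_interval (Hom P L (Tens P a b)))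
          (Hom P L (Tens P a b)) (\<lambda>(u, \<psi>). \<Theta> L a b u \<psi>)"
    using assms cuts unfolding cut_structure_def by blast
  have "continuous_map (prod_topology unit_interval (Hom P L (Tens P a b)))
     (Top_prod unit_interval (Hom P L (Tens P a b))) (\<lambda>p. (fst p, snd p))"
    using assms by (intro continuous_map_into_Top_prod delta_generated_prod simplex_image_interval
       Hom_delta_generated Tens_Obj continuous_map_fst continuous_map_snd)
  from continuous_map_compose[OF this t]
  show "continuous_map (prod_topology unit_interval (Hom P L (Tens P a b)))
          (Hom P L (Tens P a b)) (\<lambda>(u, \<psi>). \<Theta> L a b u \<psi>)" by (simp add: o_def split_beta')
qed

lemma c1_maps: "L \<in> Obj P \<Longrightarrow> a \<in> Obj P \<Longrightarrow> b \<in> Obj P \<Longrightarrow> \<psi> \<in> maps P L (Tens P a b) \<Longrightarrow> c1 L a b \<psi> \<in> maps P L a"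
  and c2_maps: "L \<in> Obj P \<Longrightarrow> a \<in> Obj P \<Longrightarrow> b \<in> Obj P \<Longrightarrow> \<psi> \<in> maps P L (Tens P a b) \<Longrightarrow> c2 L a b \<psi> \<in> maps P L b"
  using continuous_map_c1 continuous_map_c2 by (auto simp: continuous_map_def Pi_iff)

lemma Theta_ends:
  assumes "L \<in> Obj P" "a \<in> Obj P" "b \<in> Obj P" "\<psi> \<in> maps P L (Tens P a b)"
  shows "\<Theta> L a b 0 \<psi> = \<psi>"
    and "\<Theta> L a b 1 \<psi> = act_left P L L a L b (c1 L a b \<psi>) (c2 L a b \<psi>) (\<delta> L)"
  using assms cuts unfolding cut_structure_def by blast+

lemma cut_natural:
  assumes "L \<in> Obj P" "a \<in> Obj P" "a' \<in> Obj P" "b \<in> Obj P" "b' \<in> Obj P"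
    "\<alpha> \<in> maps P a a'" "\<beta> \<in> maps P b b'" "\<psi> \<in> maps P L (Tens P a b)"
  shows "c1 L a' b' (act_left P L a a' b b' \<alpha> \<beta> \<psi>) = Comp P L a a' \<alpha> (c1 L a b \<psi>)"
    and "c2 L a' b' (act_left P L a a' b b' \<alpha> \<beta> \<psi>) = Comp P L b b' \<beta> (c2 L a b \<psi>)"
    and "u \<in> {0..1} \<Longrightarrow> \<Theta> L a' b' u (act_left P L a a' b b' \<alpha> \<beta> \<psi>) =
                        act_left P L a a' b b' \<alpha> \<beta> (\<Theta> L a b u \<psi>)"
  using assms cuts unfolding cut_structure_def by blast+

definition cut_rep where
  "cut_rep D E L = (\<lambda>((a, b), \<psi>, x, y). (Act D L a (c1 L a b \<psi>) x, Act E L b (c2 L a b \<psi>) y))"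

definition cut_map where
  "cut_map D E L C = cut_rep D E L (SOME z. z \<in> C)"

definition glue_map where
  "glue_map D E L = (\<lambda>(x, y). tensor_class D E L ((L, L), \<delta> L, x, y))"

lemma Act_Comp:
  assumes "is_P_space T P D" "a \<in> Obj P" "b \<in> Obj P" "c \<in> Obj P" "\<phi> \<in> maps P a b" "\<psi> \<in> maps P b c" "x \<in> points D c"
  shows "Act D a c (Comp P a b c \<psi> \<phi>) x = Act D a b \<phi> (Act D b c \<psi> x)"
  using assms unfolding is_P_space_def by blast

lemma continuous_map_cut_rep:
  assumes DE: "is_P_space T P D" "is_P_space T P E" and L: "L \<in> Obj P"
  shows "continuous_map (tensor_coproduct P D E L) (Top_prod (Space D L) (Space E L)) (cut_rep D E L)"
proof -
  have "continuous_map (prod_topology unit_interval (tensor_coproduct P D E L)) (Top_prod (Space D L) (Space E L))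
     (\<lambda>(k, z). cut_rep D E L z)"
    unfolding tensor_coproduct_def
  proof (rule continuous_map_from_prod_sum)
    fix i assume "i \<in> Obj P \<times> Obj P"
    then obtain a b where i: "i = (a, b)" and ab: "a \<in> Obj P" "b \<in> Obj P" by blast
    let ?X = "Top_prod (Hom P L (Tens P a b)) (Top_prod (Space D a) (Space E b))"
    note X = delta_generated_Top_prod[of "Hom P L (Tens P a b)" "Top_prod (Space D a) (Space E b)"]
    note s = continuous_map_Top_prod_snd[of "Hom P L (Tens P a b)" "Top_prod (Space D a) (Space E b)"]
    note c = continuous_map_Top_prod_fst[of "Hom P L (Tens P a b)" "Top_prod (Space D a) (Space E b)"]
    have "continuous_map ?X (Top_prod (Space D L) (Space E L))
       (\<lambda>p. (Act D L a ((c1 L a b \<circ> fst) p) ((fst \<circ> snd) p), Act E L b ((c2 L a b \<circ> fst) p) ((snd \<circ> snd) p)))"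
      by (intro continuous_map_into_Top_prod X continuous_map_Act DE L ab
          continuous_map_compose[OF c] continuous_map_compose[OF s]
          continuous_map_c1 continuous_map_c2 continuous_map_Top_prod_fst continuous_map_Top_prod_snd)
    from continuous_map_compose[OF continuous_map_snd this]
    show "continuous_map (prod_topology unit_interval
        (case i of (a, b) \<Rightarrow> Top_prod (Hom P L (Tens P a b)) (Top_prod (Space D a) (Space E b))))
       (Top_prod (Space D L) (Space E L)) (\<lambda>(k, x). case (k, i, x) of (k, z) \<Rightarrow> cut_rep D E L z)"
      by (simp add: i cut_rep_def o_def split_beta')
  qed
  from continuous_map_o_Pair[OF this, of 0] show ?thesis by (simp add: o_def)
qed

text \<open>
  Naturality of the cuts gives
  \<open>D(c\<^sub>1((\<alpha> \<otimes> \<beta>)\<psi>)) x = D(\<alpha> (c\<^sub>1 \<psi>)) x = D(c\<^sub>1 \<psi>) (D(\<alpha>) x)\<close>, and likewise for \<open>c\<^sub>2\<close>, so that the value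
  respects the generating relation. As \<open>D(L) \<times> E(L)\<close> lies in Top, it also respects the possibly
  larger relation of the quotient in Top.
\<close>

lemma cut_map_class:
  assumes DE: "is_P_space T P D" "is_P_space T P E" and L: "L \<in> Obj P"
    and z: "z \<in> topspace (tensor_coproduct P D E L)"
  shows "cut_map D E L (tensor_class D E L z) = cut_rep D E L z"
proof -
  note X = delta_generated_tensor_coproduct[of D E L] tensor_relation_subset[OF DE L]
  have Z: "in_Top T (Top_prod (Space D L) (Space E L))"
    using DE L by (intro in_Top_prod) (auto simp: is_P_space_def)
  have "cut_rep D E L p = cut_rep D E L q" if pq_rel: "(p, q) \<in> tensor_relation P D E L" for p q
  proof -
    obtain a a' b b' \<alpha> \<beta> \<psi> x' y' where
      pq: "p = ((a', b'), act_left P L a a' b b' \<alpha> \<beta> \<psi>, x', y')"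
        "q = ((a, b), \<psi>, Act D a a' \<alpha> x', Act E b b' \<beta> y')"
      and o: "a \<in> Obj P" "a' \<in> Obj P" "b \<in> Obj P" "b' \<in> Obj P"
      and m: "\<alpha> \<in> maps P a a'" "\<beta> \<in> maps P b b'" "\<psi> \<in> maps P L (Tens P a b)"
      and "x' \<in> points D a'" "y' \<in> points E b'"
      using pq_rel unfolding tensor_relation_def by blast
    then show ?thesis
      using cut_natural(1,2)[OF L o m] Act_Comp[OF DE(1)] Act_Comp[OF DE(2)] L
      by (simp add: cut_rep_def c1_maps c2_maps)
  qed
  then have resp: "cut_rep D E L p = cut_rep D E L q" if "(p, q) \<in> tensor_equiv T P D E L" for p q
    using Top_equiv_respected[OF X continuous_map_cut_rep[OF DE L] Z _ that[unfolded tensor_equiv_def]] by blast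
  have "z \<in> tensor_class D E L z"
    using Top_equiv_props(1)[OF X, of T] z by (simp add: tensor_equiv_def equiv_def refl_on_def)
  then have "(SOME w. w \<in> tensor_class D E L z) \<in> tensor_class D E L z" by (rule someI)
  then show ?thesis unfolding cut_map_def using resp by (simp add: Image_singleton_iff)
qed

lemma continuous_map_cut_map:
  assumes DE: "is_P_space T P D" "is_P_space T P E" and L: "L \<in> Obj P"
  shows "continuous_map (Space (tensor T P D E) L) (Top_prod (Space D L) (Space E L)) (cut_map D E L)"
  unfolding Space_tensor
  using cut_map_class[OF DE L] unfolding tensor_equiv_def
  by (intro continuous_map_from_Top_quotient[OF delta_generated_tensor_coproduct tensor_relation_subset[OF DE L]
     continuous_map_cut_rep[OF DE L]])

lemma continuous_map_glue_map:
  assumes DE: "is_P_space T P D" "is_P_space T P E" and L: "L \<in> Obj P"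
  shows "continuous_map (Top_prod (Space D L) (Space E L)) (Space (tensor T P D E) L) (glue_map D E L)"
proof -
  let ?X = "Top_prod (Space D L) (Space E L)"
  have q: "continuous_map (tensor_coproduct P D E L) (Space (tensor T P D E) L) (tensor_class D E L)"
    unfolding Space_tensor tensor_equiv_def
    by (rule quotient_imp_continuous_map[OF quotient_map_Top_quotient[OF
          delta_generated_tensor_coproduct tensor_relation_subset[OF DE L]]])
  have "continuous_map ?X (Top_prod (Hom P L (Tens P L L)) ?X) (\<lambda>p. (\<delta> L, p))"
    using delta_maps[OF L] by (intro continuous_map_into_Top_prod delta_generated_Top_prod) auto
  moreover have "continuous_map (Top_prod (Hom P L (Tens P L L)) ?X) (tensor_coproduct P D E L) (\<lambda>p. ((L, L), p))"
    unfolding tensor_coproduct_def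
    using continuous_map_component_injection[of "(L, L)" "Obj P \<times> Obj P"
        "\<lambda>(a, b). Top_prod (Hom P L (Tens P a b)) (Top_prod (Space D a) (Space E b))"] L by simp
  ultimately have "continuous_map ?X (Space (tensor T P D E) L)
      (tensor_class D E L \<circ> ((\<lambda>p. ((L, L), p)) \<circ> (\<lambda>p. (\<delta> L, p))))"
    by (intro continuous_map_compose[OF _ q] continuous_map_compose)
  then show ?thesis by (simp add: glue_map_def o_def split_beta')
qed

text \<open>
  The homotopy \<open>[\<Theta>(u, \<psi>), x, y]\<close> is well defined since \<open>\<Theta>\<close> commutes with \<open>\<alpha> \<otimes> \<beta>\<close>. At \<open>u = 1\<close> the factor
  \<open>c\<^sub>1 \<psi> \<otimes> c\<^sub>2 \<psi>\<close> of \<open>N(\<psi>)\<close> is moved across the tensor sign.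
\<close>

lemma glue_cut_homotopic_id:
  assumes DE: "is_P_space T P D" "is_P_space T P E" and L: "L \<in> Obj P"
  shows "homotopic_with (\<lambda>_. True) (Space (tensor T P D E) L) (Space (tensor T P D E) L)
     id (glue_map D E L \<circ> cut_map D E L)"
proof -
  let ?h = "\<lambda>u ((a, b), \<psi>, x, y). ((a, b), \<Theta> L a b u \<psi>, x, y)"
  note ind = tensor_induced_map[OF simplex_image_interval L L, of "\<lambda>u a b \<psi>. \<Theta> L a b u \<psi>",
      OF continuous_map_Theta[OF L] _ P_space_map_id[OF DE(1)] P_space_map_id[OF DE(2)]]
  have nat: "\<Theta> L a' b' u (act_left P L a a' b b' \<alpha> \<beta> \<psi>) = act_left P L a a' b b' \<alpha> \<beta> (\<Theta> L a b u \<psi>)"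
    if "u \<in> topspace unit_interval" "a \<in> Obj P" "a' \<in> Obj P" "b \<in> Obj P" "b' \<in> Obj P"
      "\<alpha> \<in> maps P a a'" "\<beta> \<in> maps P b b'" "\<psi> \<in> maps P L (Tens P a b)" for u a a' b b' \<alpha> \<beta> \<psi>
    using cut_natural(3)[OF L that(2-)] that(1) by simp
  note ind = ind[OF _ _ nat]
  let ?H = "\<lambda>(u, C). tensor_equiv T P D E L `` (?h u ` C)"
  have H: "continuous_map (prod_topology unit_interval (Space (tensor T P D E) L)) (Space (tensor T P D E) L) ?H"
    by (rule ind(2))
  have Hc: "?H (u, tensor_class D E L ((a, b), \<psi>, x, y)) = tensor_class D E L ((a, b), \<Theta> L a b u \<psi>, x, y)"
    if "u \<in> {0..1}" "a \<in> Obj P" "b \<in> Obj P" "\<psi> \<in> maps P L (Tens P a b)" "x \<in> points D a" "y \<in> points E b"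
    for u a b \<psi> x y
    using that by (simp only: prod.case, subst ind(1)) (auto simp: topspace_tensor_coproduct)
  have H0: "?H (0, C) = id C" if C: "C \<in> points (tensor T P D E) L" for C
  proof (rule tensor_points_cases[OF DE L C])
    fix a b \<psi> x y assume C: "C = tensor_class D E L ((a, b), \<psi>, x, y)"
      and z: "a \<in> Obj P" "b \<in> Obj P" "\<psi> \<in> maps P L (Tens P a b)" "x \<in> points D a" "y \<in> points E b"
    show ?thesis using Hc[OF _ z, of 0] Theta_ends(1)[OF L z(1-3)] by (simp add: C)
  qed
  have H1: "?H (1, C) = (glue_map D E L \<circ> cut_map D E L) C" if C: "C \<in> points (tensor T P D E) L" for C
  proof (rule tensor_points_cases[OF DE L C])
    fix a b \<psi> x y assume C: "C = tensor_class D E L ((a, b), \<psi>, x, y)"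
      and ab: "a \<in> Obj P" "b \<in> Obj P" and \<psi>: "\<psi> \<in> maps P L (Tens P a b)"
      and xy: "x \<in> points D a" "y \<in> points E b"
    have "?H (1, C) = tensor_class D E L ((a, b), act_left P L L a L b (c1 L a b \<psi>) (c2 L a b \<psi>) (\<delta> L), x, y)"
      unfolding C using Hc[OF _ ab \<psi> xy, of 1] Theta_ends(2)[OF L ab \<psi>] by simp
    also have "\<dots> = tensor_class D E L ((L, L), \<delta> L, Act D L a (c1 L a b \<psi>) x, Act E L b (c2 L a b \<psi>) y)"
      using ab \<psi> xy L by (intro tensor_class_balanced DE c1_maps c2_maps delta_maps)
    also have "\<dots> = (glue_map D E L \<circ> cut_map D E L) C"
      using cut_map_class[OF DE L, of "((a, b), \<psi>, x, y)"] ab \<psi> xy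
      by (simp add: C topspace_tensor_coproduct glue_map_def cut_rep_def)
    finally show ?thesis .
  qed
  show ?thesis
    using H H0 H1 by (rule homotopic_with_TrueI)
qed

text \<open>
  This composite is \<open>(x, y) \<mapsto> (D(c\<^sub>1 \<delta>\<^sub>L) x, E(c\<^sub>2 \<delta>\<^sub>L) y)\<close>, and both \<open>c\<^sub>i \<delta>\<^sub>L\<close> lie in the path
  connected space \<open>P(L, L)\<close>, as does the identity of \<open>L\<close>.
\<close>

lemma cut_glue_homotopic_id:
  assumes DE: "is_P_space T P D" "is_P_space T P E" and L: "L \<in> Obj P"
  shows "homotopic_with (\<lambda>_. True) (Top_prod (Space D L) (Space E L)) (Top_prod (Space D L) (Space E L))
     id (cut_map D E L \<circ> glue_map D E L)"
proof -
  let ?X = "Top_prod (Space D L) (Space E L)"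
  let ?W = "prod_topology unit_interval ?X"
  have "c1 L L L (\<delta> L) \<in> maps P L L" "c2 L L L (\<delta> L) \<in> maps P L L"
    using L by (simp_all add: c1_maps c2_maps delta_maps)
  then obtain p q where p: "pathin (Hom P L L) p" "p 0 = Ident P L" "p 1 = c1 L L L (\<delta> L)"
    and q: "pathin (Hom P L L) q" "q 0 = Ident P L" "q 1 = c2 L L L (\<delta> L)"
    using Hom_path_connected[OF L L] Ident_maps[OF L] unfolding path_connected_space_def by metis
  let ?H = "\<lambda>w. (Act D L L (p (fst w)) (fst (snd w)), Act E L L (q (fst w)) (snd (snd w)))"
  have W: "delta_generated ?W" by (intro delta_generated_prod simplex_image_interval delta_generated_Top_prod)
  have "continuous_map ?W ?X (\<lambda>w. (Act D L L ((p \<circ> fst) w) ((fst \<circ> snd) w), Act E L L ((q \<circ> fst) w) ((snd \<circ> snd) w)))"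
    using p(1) q(1) unfolding pathin_def
    by (intro continuous_map_into_Top_prod W continuous_map_Act DE L
       continuous_map_compose[OF continuous_map_fst] continuous_map_compose[OF continuous_map_snd]
       continuous_map_Top_prod_fst continuous_map_Top_prod_snd)
  then have H: "continuous_map ?W ?X ?H" by (simp add: o_def)
  have ident: "Act D L L (Ident P L) x = x" "Act E L L (Ident P L) y = y"
    if "x \<in> points D L" "y \<in> points E L" for x y
    using DE L that unfolding is_P_space_def by blast+
  have H0: "?H (0, w) = id w" if "w \<in> topspace ?X" for w
    using that ident p q by auto
  have H1: "?H (1, w) = (cut_map D E L \<circ> glue_map D E L) w" if "w \<in> topspace ?X" for w
    using that cut_map_class[OF DE L, of "((L, L), \<delta> L, fst w, snd w)"] L delta_maps[OF L] p q
    by (auto simp: topspace_tensor_coproduct glue_map_def cut_rep_def)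
  show ?thesis
    using H H0 H1 by (rule homotopic_with_TrueI)
qed

lemma cut_map_weak_homotopy_equivalence:
  assumes DE: "is_P_space T P D" "is_P_space T P E" and L: "L \<in> Obj P"
  shows "weak_homotopy_equivalence (Space (tensor T P D E) L) (Top_prod (Space D L) (Space E L)) (cut_map D E L)"
  using continuous_map_cut_map[OF assms] continuous_map_glue_map[OF assms]
    glue_cut_homotopic_id[OF assms] cut_glue_homotopic_id[OF assms]
  by (rule homotopy_equivalence_imp_weak_homotopy_equivalence)

text \<open>
  \<open>cut_map\<close> is natural: it carries \<open>f \<otimes> g\<close> at \<open>L\<close> to \<open>f\<^sub>L \<times> g\<^sub>L\<close> because \<open>f\<close> and \<open>g\<close> commute with the
  actions of \<open>c\<^sub>1 \<psi>\<close> and \<open>c\<^sub>2 \<psi>\<close>.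
\<close>

lemma tensor_objectwise_weak_homotopy_equivalence:
  assumes f: "objectwise_weak_homotopy_equivalence T P D D' f"
    and g: "objectwise_weak_homotopy_equivalence T P E E' g"
  shows "objectwise_weak_homotopy_equivalence T P
           (tensor T P D E) (tensor T P D' E') (tensor_map T P D' E' f g)"
  unfolding objectwise_weak_homotopy_equivalence_def
proof (intro conjI ballI)
  have fm: "P_space_map T P D D' f" and gm: "P_space_map T P E E' g"
    using f g unfolding objectwise_weak_homotopy_equivalence_def by blast+
  then have DE: "is_P_space T P D" "is_P_space T P E" and DE': "is_P_space T P D'" "is_P_space T P E'"
    unfolding P_space_map_def by blast+
  show "P_space_map T P (tensor T P D E) (tensor T P D' E') (tensor_map T P D' E' f g)"
    using fm gm by (rule P_space_map_tensor)
  fix L assume L: "L \<in> Obj P"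
  have k: "weak_homotopy_equivalence (Top_prod (Space D L) (Space E L)) (Top_prod (Space D' L) (Space E' L))
      (map_prod (f L) (g L))"
    using f g L unfolding objectwise_weak_homotopy_equivalence_def
    by (intro weak_homotopy_equivalence_Top_prod) auto
  show "weak_homotopy_equivalence (Space (tensor T P D E) L) (Space (tensor T P D' E') L)
      (tensor_map T P D' E' f g L)"
  proof (rule weak_homotopy_equivalence_cancel_square[OF cut_map_weak_homotopy_equivalence[OF DE L] k
        cut_map_weak_homotopy_equivalence[OF DE' L] continuous_map_tensor_map[OF fm gm L]])
    fix C assume C: "C \<in> points (tensor T P D E) L"
    show "cut_map D' E' L (tensor_map T P D' E' f g L C) = map_prod (f L) (g L) (cut_map D E L C)"
    proof (rule tensor_points_cases[OF DE L C])
      fix a b \<psi> x y assume C: "C = tensor_class D E L ((a, b), \<psi>, x, y)"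
        and ab: "a \<in> Obj P" "b \<in> Obj P" and \<psi>: "\<psi> \<in> maps P L (Tens P a b)"
        and xy: "x \<in> points D a" "y \<in> points E b"
      have "cut_map D' E' L (tensor_map T P D' E' f g L C) = cut_rep D' E' L ((a, b), \<psi>, f a x, g b y)"
        unfolding C tensor_map_class[OF fm gm L ab \<psi> xy]
        using ab \<psi> xy P_space_map_points[OF fm] P_space_map_points[OF gm]
        by (intro cut_map_class DE' L) (simp add: topspace_tensor_coproduct)
      also have "\<dots> = map_prod (f L) (g L) (cut_rep D E L ((a, b), \<psi>, x, y))"
        using fm gm ab \<psi> xy L c1_maps[OF L ab \<psi>] c2_maps[OF L ab \<psi>]
        unfolding P_space_map_def by (simp add: cut_rep_def)
      also have "cut_rep D E L ((a, b), \<psi>, x, y) = cut_map D E L C"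
        unfolding C using ab \<psi> xy by (intro cut_map_class[OF DE L, symmetric]) (simp add: topspace_tensor_coproduct)
      finally show ?thesis .
    qed
  qed
qed

end

theorem theorem5p2:
  fixes T :: top_kind
    and P :: "('o, 'm) semimonoidal_cat"
    and D :: "('o, 'm, 'd) P_space" and D' :: "('o, 'm, 'd') P_space"
    and E :: "('o, 'm, 'e) P_space" and E' :: "('o, 'm, 'e') P_space"
    and f :: "'o \<Rightarrow> 'd \<Rightarrow> 'd'" and g :: "'o \<Rightarrow> 'e \<Rightarrow> 'e'"
  assumes "reparametrization_category_with_cuts T P"
    and "objectwise_weak_homotopy_equivalence T P D D' f"
    and "objectwise_weak_homotopy_equivalence T P E E' g"
  shows "objectwise_weak_homotopy_equivalence T P
           (tensor T P D E) (tensor T P D' E') (tensor_map T P D' E' f g)"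
proof -
  obtain \<delta> c1 c2 \<Theta> where "cut_structure P \<delta> c1 c2 \<Theta>" and "reparametrization_category T P"
    using assms(1) unfolding reparametrization_category_with_cuts_def by blast
  then interpret reparam_cat_with_cuts T P \<delta> c1 c2 \<Theta>
    by unfold_locales
  show ?thesis using assms(2,3) by (rule tensor_objectwise_weak_homotopy_equivalence)
qed

end
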